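(* Let $F$ be a totally real number field of degree $n$, $\mathfrak{f}\subsetneq O_F$ an integral ideal, $\mathfrak{C}\in Cl_F(\mathfrak{f})$ a narrow ray class and $i\in\{1,\dots,n\}$. The value $$X_i(\mathfrak{C})=\prod_{\sigma\in\Phi}\ \prod_{z_\sigma\in P_\sigma\cap(z+\mathfrak{b})}\mathcal{S}\bigl(z_\sigma^{(i)},(\mathrm{gen}\,\sigma)^{(i)}\bigr),\qquad \mathfrak{b}=z\mathfrak{a}_0^{-1}\mathfrak{f},$$ is independent of the choices of $\mathfrak{a}_0$, $z$, $\Phi$ and $(\mathrm{gen}\,\sigma)_{\sigma\in\Phi}$ (the admissible choices being those described in the context).
   Context: Notation. $F$ is embedded in $\mathbb{R}^n$ by $x\mapsto(x^{(1)},\dots,x^{(n)})$, its $n$ real embeddings. For $A\subset\mathbb{R}^n$, $A_+$ is the set of elements of $A$ with all coordinates $>0$. $\mathbb{R}^n$ is given componentwise multiplication. $Cl_F(\mathfrak{f})$ is the narrow ray class group modulo $\mathfrak{f}$, and $E_\mathfrak{f}$ is the group of totally positive units congruent to $1$ modulo $\mathfrak{f}$. Cones. A cone in $\mathbb{R}^n$ is a set $\sigma=\{x_1\omega_1+\cdots+x_d\omega_d\mid x_1,\dots,x_d>0\}$ with $\omega_1,\dots,\omega_d\in\mathbb{R}^n$ linearly independent ($\{0\}$ is the only $0$-dimensional cone); it is rational if the generators can be chosen in $F$, and then they always are. A face of $\sigma$ is a cone generated by a subset of $\{\omega_1,\dots,\omega_d\}$. Admissible choices. $\mathfrak{a}_0$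 is an integral ideal in $\mathfrak{C}$; $z\in F_+$; $\mathfrak{b}=z\mathfrak{a}_0^{-1}\mathfrak{f}$ (then $z\notin\mathfrak{b}$). $\Phi$ is a finite set of rational cones in $\mathbb{R}^n_+$ with $\mathbb{R}^n_+=\coprod_{\varepsilon\in E_\mathfrak{f}}\coprod_{\sigma\in\Phi}\varepsilon\sigma$, such that every face $\neq\{0\}$ of a cone in $\tilde\Phi=\{\varepsilon\sigma\mid\varepsilon\in E_\mathfrak{f},\sigma\in\Phi\}$ belongs to $\tilde\Phi$. For each $\sigma\in\Phi$, $\mathrm{gen}\,\sigma=\{\omega_1,\dots,\omega_d\}$ is a set of linearly independent generators of $\sigma$ contained in $\mathfrak{b}$, and $P_\sigma=\{x_1\omega_1+\cdots+x_d\omega_d\mid 0<x_1,\dots,x_d\le1\}$; $(\mathrm{gen}\,\sigma)^{(i)}=(\omega_1^{(i)},\dots,\omega_d^{(i)})$. Multiple sine function. For positive reals $\underline\omega=(\omega_1,\dots,\omega_d)$ and $w>0$, the Barnes zeta function is $\zeta_d(s,w,\underline\omega)=\sum_{k_1,\dots,k_d\ge0}(w+k_1\omega_1+\cdots+k_d\omega_d)^{-s}$ (convergent for $\mathrm{Re}(s)>d$, meromorphically continued, holomorphic at $s=0$). With $|\underline\omega|=\omega_1+\cdots+\omega_d$ and $0<w<|\underline\omega|$, put $\xi_d(s,w,\underline\omega)=-\zeta_d(s,w,\underline\omega)+(-1)^d\zeta_d(s,|\underline\omega|-w,\underline\omega)$ and $\mathcal{S}(w,\underline\omega)=\exp\bigl(\frac{\partial}{\partial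 s}\xi_d(s,w,\underline\omega)|_{s=0}\bigr)$. *)

theory Defs
  imports
    "HOL-Complex_Analysis.Complex_Analysis"
    "HOL-Algebra.Coset"
    "HOL-Algebra.Ideal"
begin

text \<open>The number field is the universe of a type \<open>'a\<close> of class \<open>field_char_0\<close>.\<close>

definition field_embedding :: "('a::field \<Rightarrow> 'b::field) \<Rightarrow> bool" where
  "field_embedding h \<longleftrightarrow>
     h 1 = 1 \<and> (\<forall>x y. h (x + y) = h x + h y) \<and> (\<forall>x y. h (x * y) = h x * h y)"

definition rat_scale :: "rat \<Rightarrow> 'a::field_char_0 \<Rightarrow> 'a" where
  "rat_scale q x = of_rat q * x"

definition totally_real_number_field :: "'a::field_char_0 itself \<Rightarrow> nat \<Rightarrow> bool" where
  "totally_real_number_field _ n \<longleftrightarrow>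
     (\<exists>B :: 'a set. finite B \<and> module.span rat_scale B = UNIV) \<and>
     vector_space.dim rat_scale (UNIV :: 'a set) = n \<and>
     (\<forall>h :: 'a \<Rightarrow> complex. field_embedding h \<longrightarrow> (\<forall>x. h x \<in> \<real>))"

text \<open>
  \<open>real_embeddings emb\<close>: the \<open>x \<mapsto> emb i x\<close> are the real embeddings of the field, each
  listed exactly once.
\<close>
definition real_embeddings :: "('n \<Rightarrow> 'a::field_char_0 \<Rightarrow> real) \<Rightarrow> bool" where
  "real_embeddings emb \<longleftrightarrow> bij_betw emb UNIV {h. field_embedding h}"

definition emb_vec :: "('n::finite \<Rightarrow> 'a \<Rightarrow> real) \<Rightarrow> 'a \<Rightarrow> real ^ 'n" where
  "emb_vec emb x = (\<chi> i. emb i x)"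

definition totally_positive :: "('n \<Rightarrow> 'a \<Rightarrow> real) \<Rightarrow> 'a \<Rightarrow> bool" where
  "totally_positive emb x \<longleftrightarrow> (\<forall>i. emb i x > 0)"

definition ring_of_integers :: "'a::field_char_0 ring" where
  "ring_of_integers =
     \<lparr>carrier = {x. algebraic_int x}, mult = (*), one = 1, zero = 0, add = (+)\<rparr>"

definition integral_ideal :: "'a::field_char_0 set \<Rightarrow> bool" where
  "integral_ideal I \<longleftrightarrow> ideal I ring_of_integers \<and> I \<noteq> {0}"

definition fractional_ideal :: "'a::field_char_0 set \<Rightarrow> bool" where
  "fractional_ideal J \<longleftrightarrow>
     (\<exists>I d. integral_ideal I \<and> d \<in> carrier ring_of_integers \<and> d \<noteq> 0 \<and> J = (\<lambda>x. x / d) ` I)"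

definition ideal_mult :: "'a::field_char_0 set \<Rightarrow> 'a set \<Rightarrow> 'a set" where
  "ideal_mult I J =
     {\<Sum>k<m. x k * y k | (m::nat) x y. \<forall>k<m. x k \<in> I \<and> y k \<in> J}"

definition ideal_inv :: "'a::field_char_0 set \<Rightarrow> 'a set" where
  "ideal_inv I = {x. \<forall>y\<in>I. x * y \<in> carrier ring_of_integers}"

definition coprime_ideals :: "'a::field_char_0 set \<Rightarrow> 'a set \<Rightarrow> bool" where
  "coprime_ideals I J \<longleftrightarrow> I <+>\<^bsub>ring_of_integers\<^esub> J = carrier ring_of_integers"

text \<open>A fractional ideal is prime to \<open>\<ff>\<close> if it is a quotient of integral ideals prime to \<open>\<ff>\<close>.\<close>
definition ray_ideals :: "'a::field_char_0 set \<Rightarrow> 'a set monoid" where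
  "ray_ideals \<ff> =
     \<lparr>carrier = {I. fractional_ideal I \<and>
        (\<exists>A B. integral_ideal A \<and> integral_ideal B \<and> coprime_ideals A \<ff> \<and> coprime_ideals B \<ff> \<and>
               I = ideal_mult A (ideal_inv B))},
      mult = ideal_mult, one = carrier ring_of_integers\<rparr>"

text \<open>
  The usual multiplicative congruence \<open>x \<equiv> 1\<close> modulo \<open>\<ff>\<close> for \<open>x \<in> F\<^sup>\<times>\<close>:
  \<open>x\<close> is a quotient of two integers that are prime to \<open>\<ff>\<close> and congruent modulo \<open>\<ff>\<close>.
\<close>
definition mult_cong_one :: "'a::field_char_0 set \<Rightarrow> 'a \<Rightarrow> bool" where
  "mult_cong_one \<ff> x \<longleftrightarrow> x \<noteq> 0 \<and>
     (\<exists>\<alpha>\<in>carrier ring_of_integers. \<exists>\<beta>\<in>carrier ring_of_integers.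
        \<beta> \<noteq> 0 \<and> x = \<alpha> / \<beta> \<and> \<alpha> - \<beta> \<in> \<ff> \<and>
        coprime_ideals (PIdl\<^bsub>ring_of_integers\<^esub> \<alpha>) \<ff> \<and>
        coprime_ideals (PIdl\<^bsub>ring_of_integers\<^esub> \<beta>) \<ff>)"

definition narrow_ray ::
    "('n \<Rightarrow> 'a::field_char_0 \<Rightarrow> real) \<Rightarrow> 'a set \<Rightarrow> 'a set set" where
  "narrow_ray emb \<ff> =
     {(\<lambda>y. x * y) ` carrier ring_of_integers | x. totally_positive emb x \<and> mult_cong_one \<ff> x}"

definition narrow_ray_class_group ::
    "('n \<Rightarrow> 'a::field_char_0 \<Rightarrow> real) \<Rightarrow> 'a set \<Rightarrow> 'a set set monoid" where
  "narrow_ray_class_group emb \<ff> = ray_ideals \<ff> Mod narrow_ray emb \<ff>"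

definition ray_units :: "('n \<Rightarrow> 'a::field_char_0 \<Rightarrow> real) \<Rightarrow> 'a set \<Rightarrow> 'a set" where
  "ray_units emb \<ff> =
     {u \<in> Units ring_of_integers. totally_positive emb u \<and> u - 1 \<in> \<ff>}"

text \<open>For linearly independent \<open>W\<close>; in particular \<open>open_cone {} = {0}\<close>.\<close>
definition open_cone :: "(real ^ 'n) set \<Rightarrow> (real ^ 'n) set" where
  "open_cone W = {\<Sum>w\<in>W. x w *\<^sub>R w | x. \<forall>w\<in>W. 0 < x w}"

definition half_open_parallelepiped :: "(real ^ 'n) set \<Rightarrow> (real ^ 'n) set" where
  "half_open_parallelepiped W = {\<Sum>w\<in>W. x w *\<^sub>R w | x. \<forall>w\<in>W. 0 < x w \<and> x w \<le> 1}"

definition rational_cone ::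
    "('n::finite \<Rightarrow> 'a \<Rightarrow> real) \<Rightarrow> (real ^ 'n) set \<Rightarrow> bool" where
  "rational_cone emb \<sigma> \<longleftrightarrow>
     (\<exists>W. finite W \<and> independent W \<and> W \<subseteq> range (emb_vec emb) \<and> \<sigma> = open_cone W)"

definition cone_face :: "(real ^ 'n) set \<Rightarrow> (real ^ 'n) set \<Rightarrow> bool" where
  "cone_face \<tau> \<sigma> \<longleftrightarrow>
     (\<exists>W V. finite W \<and> independent W \<and> \<sigma> = open_cone W \<and> V \<subseteq> W \<and> \<tau> = open_cone V)"

definition positive_orthant :: "(real ^ 'n) set" where
  "positive_orthant = {x. \<forall>i. x $ i > 0}"

text \<open>The product on \<open>real ^ 'n\<close> is componentwise.\<close>
definition translate_cone ::
    "('n::finite \<Rightarrow> 'a \<Rightarrow> real) \<Rightarrow> 'a \<Rightarrow> (real ^ 'n) set \<Rightarrow> (real ^ 'n) set" where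
  "translate_cone emb \<epsilon> \<sigma> = (\<lambda>v. emb_vec emb \<epsilon> * v) ` \<sigma>"

definition translated_cones ::
    "('n::finite \<Rightarrow> 'a::field_char_0 \<Rightarrow> real) \<Rightarrow> 'a set \<Rightarrow> (real ^ 'n) set set \<Rightarrow> (real ^ 'n) set set"
  where
  "translated_cones emb \<ff> \<Phi> = {translate_cone emb \<epsilon> \<sigma> | \<epsilon> \<sigma>. \<epsilon> \<in> ray_units emb \<ff> \<and> \<sigma> \<in> \<Phi>}"

definition shintani_decomposition ::
    "('n::finite \<Rightarrow> 'a::field_char_0 \<Rightarrow> real) \<Rightarrow> 'a set \<Rightarrow> (real ^ 'n) set set \<Rightarrow> bool" where
  "shintani_decomposition emb \<ff> \<Phi> \<longleftrightarrow>
     finite \<Phi> \<and>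
     (\<forall>\<sigma>\<in>\<Phi>. rational_cone emb \<sigma> \<and> \<sigma> \<subseteq> positive_orthant) \<and>
     positive_orthant = (\<Union>\<epsilon>\<in>ray_units emb \<ff>. \<Union>\<sigma>\<in>\<Phi>. translate_cone emb \<epsilon> \<sigma>) \<and>
     disjoint_family_on (\<lambda>(\<epsilon>, \<sigma>). translate_cone emb \<epsilon> \<sigma>) (ray_units emb \<ff> \<times> \<Phi>) \<and>
     (\<forall>\<sigma>\<in>translated_cones emb \<ff> \<Phi>. \<forall>\<tau>. cone_face \<tau> \<sigma> \<and> \<tau> \<noteq> {0} \<longrightarrow>
        \<tau> \<in> translated_cones emb \<ff> \<Phi>)"

text \<open>The tuple \<open>\<omega>\<^sub>1, \<dots>, \<omega>\<^sub>d\<close> is a list of length \<open>d\<close>.\<close>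
definition barnes_series :: "real \<Rightarrow> real list \<Rightarrow> complex \<Rightarrow> complex" where
  "barnes_series w \<omega>s s =
     (\<Sum>\<^sub>\<infinity>ks\<in>{ks :: nat list. length ks = length \<omega>s}.
        complex_of_real (w + (\<Sum>j<length \<omega>s. real (ks ! j) * \<omega>s ! j)) powr (- s))"

text \<open>
  The meromorphic continuation.  \<open>nicely_meromorphic_on\<close> removes the removable singularities and
  gives poles the value 0, so the continuation is unique as a function.
\<close>
definition barnes_zeta :: "real \<Rightarrow> real list \<Rightarrow> complex \<Rightarrow> complex" where
  "barnes_zeta w \<omega>s =
     (THE f. f nicely_meromorphic_on UNIV \<and>
        (\<forall>s. Re s > real (length \<omega>s) \<longrightarrow> f s = barnes_series w \<omega>s s))"

definition barnes_xi :: "real \<Rightarrow> real list \<Rightarrow> complex \<Rightarrow> complex" where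
  "barnes_xi w \<omega>s s =
     - barnes_zeta w \<omega>s s + (- 1) ^ length \<omega>s * barnes_zeta (sum_list \<omega>s - w) \<omega>s s"

definition multiple_sine :: "real \<Rightarrow> real list \<Rightarrow> complex" where
  "multiple_sine w \<omega>s = exp (deriv (barnes_xi w \<omega>s) 0)"

definition shift_ideal :: "'a::field_char_0 set \<Rightarrow> 'a set \<Rightarrow> 'a \<Rightarrow> 'a set" where
  "shift_ideal \<ff> \<aa> z = (\<lambda>y. z * y) ` ideal_mult (ideal_inv \<aa>) \<ff>"

text \<open>\<open>gen \<sigma>\<close> lists the chosen generators of the cone \<open>\<sigma>\<close> in some order.\<close>
definition admissible ::
    "('n::finite \<Rightarrow> 'a::field_char_0 \<Rightarrow> real) \<Rightarrow> 'a set \<Rightarrow> 'a set set \<Rightarrow>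
     'a set \<Rightarrow> 'a \<Rightarrow> (real ^ 'n) set set \<Rightarrow> ((real ^ 'n) set \<Rightarrow> 'a list) \<Rightarrow> bool" where
  "admissible emb \<ff> \<CC> \<aa> z \<Phi> gen \<longleftrightarrow>
     integral_ideal \<aa> \<and> \<aa> \<in> \<CC> \<and> totally_positive emb z \<and>
     shintani_decomposition emb \<ff> \<Phi> \<and>
     (\<forall>\<sigma>\<in>\<Phi>. distinct (gen \<sigma>) \<and> set (gen \<sigma>) \<subseteq> shift_ideal \<ff> \<aa> z \<and>
        independent (emb_vec emb ` set (gen \<sigma>)) \<and>
        open_cone (emb_vec emb ` set (gen \<sigma>)) = \<sigma>)"

definition X_invariant ::
    "('n::finite \<Rightarrow> 'a::field_char_0 \<Rightarrow> real) \<Rightarrow> 'a set \<Rightarrow> 'n \<Rightarrow>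
     'a set \<Rightarrow> 'a \<Rightarrow> (real ^ 'n) set set \<Rightarrow> ((real ^ 'n) set \<Rightarrow> 'a list) \<Rightarrow> complex" where
  "X_invariant emb \<ff> i \<aa> z \<Phi> gen =
     (\<Prod>\<sigma>\<in>\<Phi>. \<Prod>y\<in>{y \<in> (\<lambda>b. z + b) ` shift_ideal \<ff> \<aa> z.
                    emb_vec emb y \<in> half_open_parallelepiped (emb_vec emb ` set (gen \<sigma>))}.
        multiple_sine (emb i y) (map (emb i) (gen \<sigma>)))"

end

theory Submission
  imports Defs "HOL-Real_Asymp.Real_Asymp"
begin

text \<open>
  For a cone \<open>\<sigma>\<close> put \<open>G\<^sub>\<sigma>(t) = \<Sum> exp (- x\<^sup>(\<^sup>i\<^sup>) t)\<close>, summed over \<open>x \<in> \<sigma> \<inter> (z + \<bb>)\<close>; this is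
  \<open>\<Sum> exp (- z\<^sub>\<sigma>\<^sup>(\<^sup>i\<^sup>) t) / \<Prod>\<^sub>j (1 - exp (- \<omega>\<^sub>j\<^sup>(\<^sup>i\<^sup>) t))\<close> over \<open>z\<^sub>\<sigma> \<in> P\<^sub>\<sigma> \<inter> (z + \<bb>)\<close>.  The two halves of
  \<open>\<xi>\<close> are Mellin transforms of \<open>- G\<^sub>\<sigma>(t)\<close> and \<open>G\<^sub>\<sigma>(- t)\<close>, so the exponent of the \<open>\<sigma>\<close>-factor of the
  invariant depends only on the meromorphic function \<open>G\<^sub>\<sigma>\<close>.  It is therefore additive under
  decomposing \<open>\<sigma>\<close> into rational cones inside the positive orthant, and it is unchanged when the cone
  and the lattice are multiplied by a totally positive number, because \<open>\<xi>(0) = 0\<close>: the Laurent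
  expansions of \<open>G\<^sub>\<sigma>(t)\<close> and \<open>G\<^sub>\<sigma>(- t)\<close> have the same constant term.  Two admissible choices are then
  compared on the common refinement of the two cone decompositions modulo units.
\<close>

section \<open>Barnes generating functions and their Mellin transforms\<close>

text \<open>The two exponents, finite sums of numbers \<open>deriv (barnes_xi w ws) 0\<close>, are
  shown to be equal, so no branch of a logarithm is chosen. Three obstacles shape the proof. The sum
  over one set of field elements has many expressions by generators and box points, with pole orders
  at t = 0 that vary; so a number is attached to a set through any finite family of Barnes data
  whose generating functions add up to its sum, and analytic continuation shows that the family does
  not matter. The intersection of two simplicial cones need not be simplicial; it is obtained by
  cutting with rational hyperplanes, and every new generator is a positive combination of old ones,
  hence totally positive. The refinement must be finite although there may be infinitely many units;
  coordinates of points of one cone have bounded ratios, and only finitely many totally positive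
  units have such ratios. The ray class enters twice: its integral ideals are prime to \<ff>, which
  keeps z out of \<bb>, and a change of ideal and of z multiplies z + \<bb> by a totally positive
  number.\<close>

lemma lists_length_Suc_bij:
  "bij_betw (\<lambda>(k, ks). k # ks) (UNIV \<times> {ks :: 'b list. length ks = d}) {ks. length ks = Suc d}"
  by (rule bij_betwI[where g = "\<lambda>ks. (hd ks, tl ks)"]) (auto simp: length_Suc_conv)

text \<open>Fubini, one entry of the list at a time. Absolute convergence is proved together with
  the value because the induction step needs it to sum over pairs.\<close>

lemma abs_summable_has_sum_lists_prod:
  fixes f :: "'c \<Rightarrow> nat \<Rightarrow> 'b::{real_normed_field, banach, second_countable_topology}"
  assumes "\<And>w. w \<in> set ws \<Longrightarrow> (\<lambda>k. norm (f w k)) summable_on UNIV"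
  shows "(\<lambda>ks. norm (\<Prod>j<length ws. f (ws ! j) (ks ! j))) summable_on {ks. length ks = length ws}
       \<and> ((\<lambda>ks. \<Prod>j<length ws. f (ws ! j) (ks ! j)) has_sum (\<Prod>w\<leftarrow>ws. infsum (f w) UNIV))
           {ks. length ks = length ws}"
  using assms
proof (induction ws)
  case Nil
  have "{ks :: nat list. length ks = 0} = {[]}" by auto
  then show ?case by (auto intro: has_sum_finiteI)
next
  case (Cons w ws)
  let ?S = "{ks :: nat list. length ks = length ws}"
  let ?g = "\<lambda>ks. \<Prod>j<length ws. f (ws ! j) (ks ! j)"
  have IH: "(\<lambda>ks. norm (?g ks)) summable_on ?S"
    "(?g has_sum (\<Prod>w\<leftarrow>ws. infsum (f w) UNIV)) ?S"
    using Cons by auto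
  have w: "(\<lambda>k. norm (f w k)) summable_on UNIV" using Cons by auto
  have split: "(\<Prod>j<length (w#ws). f ((w#ws) ! j) ((k#ks) ! j)) = f w k * ?g ks" for k ks
    by (simp add: prod.lessThan_Suc_shift del: prod.lessThan_Suc)
  have abs: "(\<lambda>p. norm (f w (fst p) * ?g (snd p))) summable_on UNIV \<times> ?S"
  proof -
    define c where "c = infsum (\<lambda>ks. norm (?g ks)) ?S"
    have "((\<lambda>ks. norm (f w k) * norm (?g ks)) has_sum (norm (f w k) * c)) ?S" for k
      unfolding c_def by (rule has_sum_cmult_right[OF has_sum_infsum[OF IH(1)]])
    moreover have "(\<lambda>k. norm (f w k) * c) summable_on UNIV"
      by (rule summable_on_cmult_left[OF w])
    ultimately show ?thesis
      by (intro summable_on_SigmaI[where g = "\<lambda>k. norm (f w k) * c"]) (simp_all add: norm_mult)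
  qed
  have 1: "((\<lambda>p. f w (fst p) * ?g (snd p)) has_sum
       infsum (f w) UNIV * (\<Prod>w\<leftarrow>ws. infsum (f w) UNIV)) (UNIV \<times> ?S)"
  proof (rule has_sum_SigmaI)
    fix k :: nat
    show "((\<lambda>ks. f w (fst (k, ks)) * ?g (snd (k, ks))) has_sum (f w k * (\<Prod>w\<leftarrow>ws. infsum (f w) UNIV))) ?S"
      using has_sum_cmult_right[OF IH(2)] by simp
  next
    show "((\<lambda>k. f w k * (\<Prod>w\<leftarrow>ws. infsum (f w) UNIV)) has_sum
       infsum (f w) UNIV * (\<Prod>w\<leftarrow>ws. infsum (f w) UNIV)) UNIV"
      by (rule has_sum_cmult_left[OF has_sum_infsum[OF abs_summable_summable[OF w]]])
  next
    show "(\<lambda>p. f w (fst p) * ?g (snd p)) summable_on UNIV \<times> ?S"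
      by (rule abs_summable_summable[OF abs])
  qed
  note bij = lists_length_Suc_bij[of "length ws", where 'b = nat]
  show ?case
  proof
    have "(\<lambda>p. norm (\<Prod>j<length (w#ws). f ((w#ws) ! j) ((case p of (k, ks) \<Rightarrow> k # ks) ! j)))
       summable_on UNIV \<times> ?S"
      using abs unfolding case_prod_unfold split .
    then show "(\<lambda>ks. norm (\<Prod>j<length (w#ws). f ((w#ws) ! j) (ks ! j))) summable_on
       {ks. length ks = length (w#ws)}"
      using summable_on_reindex_bij_betw[OF bij, of "\<lambda>ks. norm (\<Prod>j<length (w#ws). f ((w#ws) ! j) (ks ! j))"]
      by (simp only: length_Cons)
    have "((\<lambda>p. (\<Prod>j<length (w#ws). f ((w#ws) ! j) ((case p of (k, ks) \<Rightarrow> k # ks) ! j))) has_sum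
        infsum (f w) UNIV * (\<Prod>w\<leftarrow>ws. infsum (f w) UNIV)) (UNIV \<times> ?S)"
      using 1 unfolding case_prod_unfold split .
    then show "((\<lambda>ks. (\<Prod>j<length (w#ws). f ((w#ws) ! j) (ks ! j))) has_sum
       (\<Prod>w\<leftarrow>w#ws. infsum (f w) UNIV)) {ks. length ks = length (w#ws)}"
      using has_sum_reindex_bij_betw[OF bij, of "\<lambda>ks. \<Prod>j<length (w#ws). f ((w#ws) ! j) (ks ! j)"]
      by (simp only: length_Cons list.map prod_list.Cons)
  qed
qed

section \<open>The generating function of a Barnes zeta function and its Mellin transform\<close>

definition lattice_pt :: "real \<Rightarrow> real list \<Rightarrow> nat list \<Rightarrow> real" where
  "lattice_pt w ws ks = w + (\<Sum>j<length ws. real (ks ! j) * ws ! j)"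

definition barnes_gf :: "real \<Rightarrow> real list \<Rightarrow> real \<Rightarrow> real" where
  "barnes_gf w ws t = exp (- w * t) * (\<Prod>\<omega>\<leftarrow>ws. 1 / (1 - exp (- \<omega> * t)))"

lemma lattice_pt_ge:
  assumes "\<And>\<omega>. \<omega> \<in> set ws \<Longrightarrow> \<omega> > 0"
  shows "lattice_pt w ws ks \<ge> w"
  unfolding lattice_pt_def
  using assms by (auto intro!: sum_nonneg mult_nonneg_nonneg simp: less_imp_le)

text \<open>The exponential of a lattice point factors over the generators, and each factor gives a
  geometric series of ratio exp (- \<omega> t) < 1.\<close>

lemma barnes_gf_has_sum:
  assumes pos: "\<And>\<omega>. \<omega> \<in> set ws \<Longrightarrow> \<omega> > 0" and t: "t > 0"
  shows "((\<lambda>ks. exp (- lattice_pt w ws ks * t)) has_sum barnes_gf w ws t) {ks. length ks = length ws}"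
proof -
  define f where "f = (\<lambda>\<omega>::real. \<lambda>k. exp (- \<omega> * t) ^ k)"
  have q: "exp (-\<omega> * t) < 1" if "\<omega> \<in> set ws" for \<omega>
    using pos[OF that] t by simp
  have hs: "(f \<omega> has_sum (1 / (1 - exp (- \<omega> * t)))) UNIV" if "\<omega> \<in> set ws" for \<omega>
    unfolding f_def by (rule norm_summable_imp_has_sum) (use q[OF that] in \<open>auto intro!: geometric_sums summable_geometric simp: norm_power\<close>)
  have "((\<lambda>ks. \<Prod>j<length ws. f (ws ! j) (ks ! j)) has_sum (\<Prod>\<omega>\<leftarrow>ws. infsum (f \<omega>) UNIV))
           {ks. length ks = length ws}"
    using abs_summable_has_sum_lists_prod[of ws f] hs
    by (auto simp: f_def has_sum_iff)
  moreover have "(\<Prod>\<omega>\<leftarrow>ws. infsum (f \<omega>) UNIV) = (\<Prod>\<omega>\<leftarrow>ws. 1 / (1 - exp (- \<omega> * t)))"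
    using hs by (auto simp: has_sum_iff intro!: arg_cong[where f = prod_list])
  ultimately have "((\<lambda>ks. exp (- w * t) * (\<Prod>j<length ws. f (ws ! j) (ks ! j))) has_sum barnes_gf w ws t)
           {ks. length ks = length ws}"
    unfolding barnes_gf_def by (intro has_sum_cmult_right) simp
  moreover have "exp (- w * t) * (\<Prod>j<length ws. f (ws ! j) (ks ! j)) = exp (- lattice_pt w ws ks * t)" for ks
  proof -
    have "(\<Prod>j<length ws. f (ws ! j) (ks ! j)) = exp (\<Sum>j<length ws. real (ks ! j) * (- (ws ! j) * t))"
      unfolding f_def by (subst exp_sum) (simp_all only: exp_of_nat_mult finite_lessThan)
    also have "(\<Sum>j<length ws. real (ks ! j) * (- (ws ! j) * t)) = - (\<Sum>j<length ws. real (ks ! j) * ws ! j) * t"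
      by (simp add: sum_distrib_right sum_negf mult.assoc)
    finally show ?thesis unfolding lattice_pt_def by (simp add: exp_add[symmetric] ring_distribs)
  qed
  ultimately show ?thesis by simp
qed

text \<open>Comparison with a product of one-dimensional series. Each 1 + k_j is at most T = 1 + k_1
  + ... + k_d, so the product of these factors is at most T^d, and T powr (-x) is at most the
  product of the (1 + k_j) powr (-x / d). The exponent x / d exceeds 1.\<close>

lemma lattice_pt_powr_summable:
  assumes pos: "\<And>\<omega>. \<omega> \<in> set ws \<Longrightarrow> \<omega> > 0" and w: "w > 0" and x: "x > real (length ws)" and ne: "ws \<noteq> []"
  shows "(\<lambda>ks. lattice_pt w ws ks powr (- x)) summable_on {ks. length ks = length ws}"
proof -
  define d where "d = length ws"
  have d: "d > 0" using ne by (simp add: d_def)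
  define p where "p = x / d"
  have p: "p > 1" using x d by (simp add: p_def d_def)
  \<comment> \<open>All of w and the generators are at least m, so a lattice point is at least m
    times T.\<close>
  define m where "m = Min (insert w (set ws))"
  have m: "m > 0" using pos w by (auto simp: m_def)
  have mw: "m \<le> w" "\<And>j. j < d \<Longrightarrow> m \<le> ws ! j" by (auto simp: m_def d_def)
  define f where "f = (\<lambda>_::real. \<lambda>k::nat. (1 + real k) powr (-p))"
  have f: "(\<lambda>k. norm (f \<omega> k)) summable_on UNIV" for \<omega>
  proof -
    have "summable (\<lambda>k. real k powr (-p))" using p by (simp add: summable_real_powr_iff)
    then have "summable (\<lambda>k. real (Suc k) powr (-p))" by (subst summable_Suc_iff)
    then show ?thesis unfolding f_def
      by (intro summable_nonneg_imp_summable_on) (auto simp: add.commute)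
  qed
  have "(\<lambda>ks. norm (\<Prod>j<length ws. f (ws ! j) (ks ! j))) summable_on {ks. length ks = length ws}"
    using abs_summable_has_sum_lists_prod[of ws f] f by blast
  then have S: "(\<lambda>ks. m powr (-x) * norm (\<Prod>j<length ws. f (ws ! j) (ks ! j))) summable_on {ks. length ks = length ws}"
    by (rule summable_on_cmult_right)
  show ?thesis
  proof (rule summable_on_comparison_test[OF S])
    fix ks :: "nat list" assume "ks \<in> {ks. length ks = length ws}"
    define T where "T = 1 + (\<Sum>j<d. real (ks ! j))"
    have T: "T \<ge> 1" unfolding T_def by (simp add: sum_nonneg)
    have "m * T \<le> lattice_pt w ws ks"
      unfolding T_def lattice_pt_def distrib_left sum_distrib_left d_def[symmetric]
      using mw by (intro add_mono sum_mono) (auto simp: mult.commute intro!: mult_right_mono)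
    moreover have mT: "m * T > 0" using m T by simp
    ultimately have "lattice_pt w ws ks powr (-x) \<le> (m * T) powr (-x)"
      using x by (intro powr_mono2') auto
    also have "\<dots> = m powr (-x) * T powr (-x)" using m T by (simp add: powr_mult)
    also have "T powr (-x) = (T ^ d) powr (-p)"
      using T d by (simp add: powr_realpow[symmetric] powr_powr p_def)
    also have "\<dots> \<le> (\<Prod>j<d. 1 + real (ks ! j)) powr (-p)"
    proof (rule powr_mono2')
      have "(\<Prod>j<d. 1 + real (ks ! j)) \<le> (\<Prod>j<d. T)"
      proof (intro prod_mono conjI)
        fix j assume "j \<in> {..<d}"
        then show "1 + real (ks ! j) \<le> T" unfolding T_def
          by (intro add_left_mono member_le_sum) auto
      qed auto
      then show "(\<Prod>j<d. 1 + real (ks ! j)) \<le> T ^ d" by simp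
      show "0 < (\<Prod>j<d. 1 + real (ks ! j))" by (intro prod_pos) auto
    qed (use p in auto)
    also have "(\<Prod>j<d. 1 + real (ks ! j)) powr (-p) = (\<Prod>j<d. (1 + real (ks ! j)) powr (-p))"
      by (rule prod_powr_distrib)
    also have "\<dots> = norm (\<Prod>j<length ws. f (ws ! j) (ks ! j))"
      by (simp add: f_def d_def abs_prod)
    finally show "lattice_pt w ws ks powr (-x) \<le> m powr (-x) * norm (\<Prod>j<length ws. f (ws ! j) (ks ! j))"
      using m by simp
  qed auto
qed

text \<open>Substitution of l t for t in Euler's integral for Gamma. It is stated for Lebesgue
  integrals because series are integrated termwise later.\<close>

lemma Gamma_scaled_set_integral:
  assumes s: "Re s > 0" and l: "(l::real) > 0"
  shows "set_integrable lborel {0<..} (\<lambda>t. of_real t powr (s - 1) * of_real (exp (- l * t)) :: complex)"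
    and "(LINT t:{0<..}|lborel. of_real t powr (s - 1) * of_real (exp (- l * t))) = Gamma s * of_real l powr (- s)"
proof -
  let ?f = "\<lambda>t. complex_of_real t powr (s - 1) / of_real (exp t)"
  have i1: "set_integrable lborel {0<..} ?f"
  proof -
    have "?f absolutely_integrable_on {0<..}" by (rule absolutely_integrable_Gamma_integral'[OF s])
    then show ?thesis unfolding set_integrable_def
      by (subst (asm) integrable_completion) (auto intro!: borel_measurable_continuous_on_indicator continuous_intros)
  qed
  have v1: "(LINT t:{0<..}|lborel. ?f t) = Gamma s"
  proof -
    have "(LINT t:{0<..}|lborel. ?f t) = (LINT t:{0<..}|lebesgue. ?f t)"
      unfolding set_lebesgue_integral_def
      by (rule integral_completion[symmetric]) (auto intro!: borel_measurable_continuous_on_indicator continuous_intros)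
    also have "\<dots> = integral {0<..} ?f"
      by (rule set_lebesgue_integral_eq_integral(2)) (rule absolutely_integrable_Gamma_integral'[OF s])
    also have "\<dots> = Gamma s" by (rule integral_unique[OF Gamma_integral_complex'[OF s]])
    finally show ?thesis .
  qed
  \<comment> \<open>The substituted integrand carries the factor l powr (s - 1); the Jacobian
    supplies one more l.\<close>
  have eq: "indicator {0<..} (l * t) *\<^sub>R ?f (l * t) = of_real l powr (s - 1) *
     (indicator {0<..} t *\<^sub>R (of_real t powr (s - 1) * of_real (exp (- l * t))))" for t
  proof (cases "t > 0")
    case True
    have "complex_of_real (l * t) powr (s - 1) = of_real l powr (s - 1) * of_real t powr (s - 1)"
      using True l by (simp add: powr_times_real)
    moreover have "1 / exp (complex_of_real (l * t)) = exp (complex_of_real (- l * t))"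
      by (simp add: exp_minus inverse_eq_divide)
    ultimately show ?thesis using l True
      by (simp add: indicator_def exp_of_real[symmetric] divide_inverse exp_minus mult.assoc del: of_real_mult)
  next
    case False
    then have "\<not> l * t > 0" using l by (simp add: zero_less_mult_iff)
    then show ?thesis using False by simp
  qed
  have nz: "complex_of_real l powr (s - 1) \<noteq> 0" using l by simp
  have i2: "integrable lborel (\<lambda>t. indicator {0<..} (0 + l * t) *\<^sub>R ?f (0 + l * t))"
    using i1 l unfolding set_integrable_def by (subst lborel_integrable_real_affine_iff) auto
  define c where "c = complex_of_real l powr (s - 1)"
  define h where "h = (\<lambda>t. indicator {0<..} t *\<^sub>R (complex_of_real t powr (s - 1) * of_real (exp (- l * t))))"
  have "integrable lborel (\<lambda>t. c * h t)"
    using i2 unfolding add_0 eq c_def h_def .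
  then have "integrable lborel (\<lambda>t. inverse c * (c * h t))" by (rule integrable_mult_right)
  also have "(\<lambda>t. inverse c * (c * h t)) = h"
    using nz by (simp add: c_def[symmetric] fun_eq_iff mult.assoc[symmetric])
  finally show A: "set_integrable lborel {0<..} (\<lambda>t. of_real t powr (s - 1) * of_real (exp (- l * t)) :: complex)"
    unfolding set_integrable_def h_def .
  have "Gamma s = \<bar>l\<bar> *\<^sub>R (\<integral>t. indicator {0<..} (0 + l * t) *\<^sub>R ?f (0 + l * t) \<partial>lborel)"
    unfolding v1[symmetric] set_lebesgue_integral_def by (rule lborel_integral_real_affine) (use l in auto)
  also have "\<dots> = of_real l * of_real l powr (s - 1) * (LINT t:{0<..}|lborel. of_real t powr (s - 1) * of_real (exp (- l * t)))"
    unfolding add_0 eq set_lebesgue_integral_def using l by (simp add: scaleR_conv_of_real)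
  also have "of_real l * of_real l powr (s - 1) = complex_of_real l powr s"
    using l by (simp add: powr_diff)
  finally have "Gamma s = of_real l powr s * (LINT t:{0<..}|lborel. of_real t powr (s - 1) * of_real (exp (- l * t)))" .
  then show "(LINT t:{0<..}|lborel. of_real t powr (s - 1) * of_real (exp (- l * t))) = Gamma s * of_real l powr (- s)"
    using l by (simp add: powr_minus)
qed

text \<open>Termwise integration is a statement about sequences of functions, so the lattice points
  are enumerated by natural numbers. The index set is infinite only for positive d.\<close>

lemma lattice_lists_enum:
  assumes "d > (0::nat)"
  shows "\<exists>e :: nat \<Rightarrow> nat list. bij_betw e UNIV {ks. length ks = d}"
proof -
  have "infinite {ks :: nat list. length ks = d}"
  proof
    assume "finite {ks :: nat list. length ks = d}"
    then have "finite ((\<lambda>ks. ks ! 0) ` {ks :: nat list. length ks = d})" by simp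
    moreover have "(\<lambda>ks. ks ! 0) ` {ks :: nat list. length ks = d} = UNIV"
    proof -
      have "k \<in> (\<lambda>ks. ks ! 0) ` {ks :: nat list. length ks = d}" for k
        by (rule image_eqI[where x = "replicate d k"]) (use assms in auto)
      then show ?thesis by auto
    qed
    ultimately show False by simp
  qed
  then show ?thesis by (intro exI[where x = "from_nat_into {ks :: nat list. length ks = d}"]
      bij_betw_from_nat_into[OF countableI_type])
qed

text \<open>Termwise integration of the exponential series. It is justified by the convergence of
  the sum of the powers l_n powr (- Re s) over the lattice points, which is where Re s > d
  enters.\<close>

lemma barnes_Mellin:
  assumes pos: "\<And>\<omega>. \<omega> \<in> set ws \<Longrightarrow> \<omega> > 0" and w: "w > 0" and s: "Re s > real (length ws)" and ne: "ws \<noteq> []"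
  shows "set_integrable lborel {0<..} (\<lambda>t. of_real t powr (s - 1) * of_real (barnes_gf w ws t) :: complex)"
    and "(LINT t:{0<..}|lborel. of_real t powr (s - 1) * of_real (barnes_gf w ws t)) = Gamma s * barnes_series w ws s"
proof -
  obtain e :: "nat \<Rightarrow> nat list" where e: "bij_betw e UNIV {ks :: nat list. length ks = length ws}"
    using lattice_lists_enum[of "length ws"] ne unfolding length_greater_0_conv by blast
  define l where "l = (\<lambda>n. lattice_pt w ws (e n))"
  have l: "l n > 0" for n using lattice_pt_ge[OF pos, of ws w "e n"] w unfolding l_def by linarith
  have d: "real (length ws) \<ge> 1" using ne by (simp add: Suc_le_eq)
  then have s0: "Re s > 0" "Re (complex_of_real (Re s)) > 0" using s by auto
  have s1: "Re s > 0" using s d by linarith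
  define f where "f = (\<lambda>n t. indicator {0<..} t *\<^sub>R (of_real t powr (s - 1) * of_real (exp (- l n * t)) :: complex))"
  have int_f: "integrable lborel (f n)" "integral\<^sup>L lborel (f n) = Gamma s * of_real (l n) powr (-s)" for n
    using Gamma_scaled_set_integral[OF s1 l[of n]] unfolding f_def set_integrable_def set_lebesgue_integral_def by auto
  \<comment> \<open>The absolute value is the same kind of integrand with Re s in place of s, so its
    integral is again a Gamma integral.\<close>
  have norm_f: "norm (f n t) = Re (indicator {0<..} t *\<^sub>R (of_real t powr (of_real (Re s) - 1) * of_real (exp (- l n * t)) :: complex))" for n t
  proof (cases "t > 0")
    case True
    have "complex_of_real t powr (of_real (Re s) - 1) = of_real (t powr (Re s - 1))"
      using True by (subst powr_of_real[symmetric]) auto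
    then show ?thesis using True
      by (simp add: f_def norm_mult norm_powr_real_powr)
  qed (auto simp: f_def)
  have int_norm: "integral\<^sup>L lborel (\<lambda>t. norm (f n t)) = Gamma (Re s) * l n powr (- Re s)" for n
  proof -
    have "integral\<^sup>L lborel (\<lambda>t. norm (f n t)) = Re (Gamma (of_real (Re s)) * of_real (l n) powr (- of_real (Re s)))"
      unfolding norm_f using Gamma_scaled_set_integral[OF s0(2) l[of n]]
      unfolding set_integrable_def set_lebesgue_integral_def by (subst integral_Re) auto
    also have "complex_of_real (l n) powr (- of_real (Re s)) = of_real (l n powr (- Re s))"
      using l[of n] by (subst powr_of_real[symmetric]) auto
    finally show ?thesis by (simp add: Gamma_complex_of_real)
  qed
  have sum_l: "(\<lambda>n. l n powr (- Re s)) summable_on UNIV"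
    using lattice_pt_powr_summable[OF pos w s ne] summable_on_reindex_bij_betw[OF e, of "\<lambda>ks. lattice_pt w ws ks powr (- Re s)"]
    by (simp add: l_def)
  have gf: "((\<lambda>n. exp (- l n * t)) has_sum barnes_gf w ws t) UNIV" if "t > 0" for t
    using barnes_gf_has_sum[OF pos that, of ws w] has_sum_reindex_bij_betw[OF e, of "\<lambda>ks. exp (- lattice_pt w ws ks * t)"]
    by (simp add: l_def)
  have gfs: "(\<lambda>n. exp (- l n * t)) sums barnes_gf w ws t" if "t > 0" for t
    using has_sum_imp_sums[OF gf[OF that]] .
  have sums_f: "(\<lambda>n. f n t) sums (indicator {0<..} t *\<^sub>R (of_real t powr (s - 1) * of_real (barnes_gf w ws t)))" for t
  proof (cases "t > 0")
    case True
    then show ?thesis unfolding f_def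
      using gfs[OF True] by (auto intro!: sums_mult sums_of_real)
  qed (auto simp: f_def)
  have ae: "AE t in lborel. summable (\<lambda>n. norm (f n t))"
  proof (rule AE_I2)
    fix t :: real
    show "summable (\<lambda>n. norm (f n t))"
    proof (cases "t > 0")
      case True
      have "summable (\<lambda>n. norm (complex_of_real t powr (s - 1)) * exp (- l n * t))"
        using gfs[OF True] by (intro summable_mult) (auto simp: sums_iff)
      then show ?thesis using True by (simp add: f_def norm_mult)
    qed (auto simp: f_def)
  qed
  have s2: "summable (\<lambda>n. integral\<^sup>L lborel (\<lambda>t. norm (f n t)))"
    unfolding int_norm by (intro summable_mult summable_on_imp_summable sum_l)
  have suminf_f: "(\<Sum>n. f n t) = indicator {0<..} t *\<^sub>R (of_real t powr (s - 1) * of_real (barnes_gf w ws t))" for t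
    using sums_f[of t] by (simp add: sums_iff)
  show "set_integrable lborel {0<..} (\<lambda>t. of_real t powr (s - 1) * of_real (barnes_gf w ws t) :: complex)"
    using integrable_suminf[OF int_f(1) ae s2] unfolding suminf_f set_integrable_def .
  have "(\<lambda>n. integral\<^sup>L lborel (f n)) sums (LINT t:{0<..}|lborel. of_real t powr (s - 1) * of_real (barnes_gf w ws t))"
    using sums_integral[OF int_f(1) ae s2] unfolding suminf_f set_lebesgue_integral_def .
  moreover have "(\<lambda>n. integral\<^sup>L lborel (f n)) sums (Gamma s * barnes_series w ws s)"
  proof -
    have "(\<lambda>n. norm (complex_of_real (l n) powr (-s))) summable_on UNIV"
      using sum_l l by (simp add: norm_powr_real_powr less_imp_le)
    then have "(\<lambda>n. complex_of_real (l n) powr (-s)) summable_on UNIV"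
      by (rule abs_summable_summable)
    then have "((\<lambda>n. complex_of_real (l n) powr (-s)) has_sum infsum (\<lambda>n. complex_of_real (l n) powr (-s)) UNIV) UNIV"
      by (rule has_sum_infsum)
    also have "infsum (\<lambda>n. complex_of_real (l n) powr (-s)) UNIV = barnes_series w ws s"
      unfolding barnes_series_def l_def lattice_pt_def
      by (rule infsum_reindex_bij_betw[OF e])
    finally have "(\<lambda>n. complex_of_real (l n) powr (-s)) sums barnes_series w ws s"
      by (rule has_sum_imp_sums)
    then show ?thesis unfolding int_f(2) by (rule sums_mult)
  qed
  ultimately show "(LINT t:{0<..}|lborel. of_real t powr (s - 1) * of_real (barnes_gf w ws t)) = Gamma s * barnes_series w ws s"
    by (rule sums_unique2)
qed

section \<open>Meromorphic continuation\<close>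

text \<open>The difference, freed of its removable singularities, vanishes on U and hence
  everywhere, so f and g agree near each point except perhaps at it. There the normal form decides:
  both have a pole and the value 0, or both take the common limit.\<close>

lemma nicely_meromorphic_eqI:
  assumes f: "f nicely_meromorphic_on UNIV" and g: "g nicely_meromorphic_on UNIV"
    and U: "open U" "U \<noteq> {}" and eq: "\<And>s. s \<in> U \<Longrightarrow> f s = g s"
  shows "f = g"
proof -
  let ?h = "\<lambda>s. f s - g s"
  have mero: "f meromorphic_on UNIV" "g meromorphic_on UNIV"
    using f g by (auto simp: nicely_meromorphic_on_def)
  have h: "?h meromorphic_on UNIV" by (intro meromorphic_intros mero)
  have nh: "remove_sings ?h nicely_meromorphic_on UNIV" by (rule remove_sings_nicely_meromorphic[OF h])
  obtain x where x: "x \<in> U" using U by auto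
  have rU: "remove_sings ?h s = 0" if "s \<in> U" for s
  proof (rule remove_sings_eqI)
    have "eventually (\<lambda>w. w \<in> U) (at s)" using U that by (auto intro: eventually_at_in_open')
    then have "eventually (\<lambda>w. ?h w = 0) (at s)" by eventually_elim (simp add: eq)
    then show "?h \<midarrow>s\<rightarrow> 0" by (rule tendsto_eventually)
  qed
  have "remove_sings ?h constant_on UNIV"
    by (rule constant_on_extend_nicely_meromorphic_on[OF nh, of U]) (use U rU in \<open>auto simp: constant_on_def\<close>)
  then have r0: "remove_sings ?h s = 0" for s
    using rU[OF x] by (auto simp: constant_on_def)
  show "f = g"
  proof
    fix s
    have "eventually (\<lambda>w. remove_sings ?h w = ?h w) (at s)"
      using eventually_remove_sings_eq_at meromorphic_on_isolated_singularity[OF meromorphic_on_subset[OF h]] by blast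
    then have ev: "eventually (\<lambda>w. f w = g w) (at s)" by eventually_elim (simp add: r0)
    then have pole: "is_pole f s \<longleftrightarrow> is_pole g s" by (intro is_pole_cong) auto
    show "f s = g s"
    proof (cases "is_pole f s")
      case True
      then have "\<not> g \<midarrow>s\<rightarrow> g s" "\<not> f \<midarrow>s\<rightarrow> f s" using pole
        using not_tendsto_and_filterlim_at_infinity[of "at s" g] not_tendsto_and_filterlim_at_infinity[of "at s" f]
        unfolding is_pole_def by auto
      then have "f s = 0" "g s = 0" using f g unfolding nicely_meromorphic_on_def by (metis UNIV_I)+
      then show ?thesis by simp
    next
      case False
      then have "f \<midarrow>s\<rightarrow> f s" "g \<midarrow>s\<rightarrow> g s" using f g pole unfolding nicely_meromorphic_on_def by auto
      moreover have "f \<midarrow>s\<rightarrow> g s" using \<open>g \<midarrow>s\<rightarrow> g s\<close> ev by (simp cong: tendsto_cong)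
      ultimately show ?thesis using LIM_unique by blast
    qed
  qed
qed

section \<open>Continuation of a Mellin transform by cutting the integral at a point
  \<delta>\<close>

lemma powr_set_integral:
  assumes z: "Re z > 0" and c: "c > 0"
  shows "set_integrable lborel {0<..c} (\<lambda>t. of_real t powr (z - 1) :: complex)"
    and "(LINT t:{0<..c}|lborel. of_real t powr (z - 1)) = of_real c powr z / z"
proof -
  have r: "set_integrable lborel {0<..c} (\<lambda>t. t powr (Re z - 1))"
  proof -
    have "(\<lambda>t. t powr (Re z - 1)) absolutely_integrable_on {0<..c}"
      by (rule nonnegative_absolutely_integrable_1[OF integrable_on_powr_from_0']) (use z c in auto)
    then show ?thesis unfolding set_integrable_def
      by (subst (asm) integrable_completion) auto
  qed
  show i: "set_integrable lborel {0<..c} (\<lambda>t. of_real t powr (z - 1) :: complex)"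
    unfolding set_integrable_def
  proof (rule Bochner_Integration.integrable_bound[OF r[unfolded set_integrable_def] _ AE_I2])
    show "(\<lambda>t. indicator {0<..c} t *\<^sub>R (of_real t powr (z - 1) :: complex)) \<in> borel_measurable lborel"
      by (auto intro!: borel_measurable_continuous_on_indicator continuous_intros)
    fix t :: real
    show "norm (indicator {0<..c} t *\<^sub>R (of_real t powr (z - 1) :: complex)) \<le> norm (indicator {0<..c} t *\<^sub>R t powr (Re z - 1))"
      by (auto simp: indicator_def norm_powr_real_powr)
  qed
  have "((\<lambda>t. complex_of_real t powr (z - 1)) has_integral
            (of_real c powr z / z - of_real 0 powr z / z)) {0..c}" using z c
    by (intro fundamental_theorem_of_calculus_interior)
       (auto intro!: continuous_intros derivative_eq_intros has_vector_derivative_real_field)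
  then have "((\<lambda>t. complex_of_real t powr (z - 1)) has_integral (of_real c powr z / z)) {0..c}" by simp
  note hi = this
  have neg: "negligible {t \<in> {0..c} - {0<..c}. complex_of_real t powr (z - 1) \<noteq> 0}"
    "negligible {t \<in> {0<..c} - {0..c}. complex_of_real t powr (z - 1) \<noteq> 0}"
    by (rule negligible_subset[of "{0 :: real}"]; auto)+
  have "((\<lambda>t. complex_of_real t powr (z - 1)) has_integral (of_real c powr z / z)) {0<..c}"
    by (rule iffD1[OF has_integral_spike_set_eq[OF neg] hi])
  then show "(LINT t:{0<..c}|lborel. of_real t powr (z - 1)) = of_real c powr z / z"
    using set_borel_integral_eq_integral(2)[OF i] by (simp add: integral_unique)
qed

text \<open>The Mellin integral of \<open>a\<^sub>j t\<^sup>j\<^sup>-\<^sup>d\<close> over \<open>(0, \<delta>]\<close>.\<close>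
definition head_term :: "(nat \<Rightarrow> complex) \<Rightarrow> real \<Rightarrow> nat \<Rightarrow> nat \<Rightarrow> complex \<Rightarrow> complex" where
  "head_term a \<delta> d j s = a j * of_real \<delta> powr (s + of_nat j - of_nat d) / (s + of_nat j - of_nat d)"

text \<open>The term of index j has its only possible pole at s = d - j. Dropping the first N terms
  leaves no pole to the right of d - N, and there the Weierstrass test applies.\<close>

lemma head_tail_analytic:
  assumes \<delta>: "0 < \<delta>" "\<delta> \<le> 1" and sum: "summable (\<lambda>j. norm (a j) * \<delta> ^ j)"
  shows "\<forall>s \<in> {s. Re s > real d - real N}. summable (\<lambda>n. head_term a \<delta> d (n + N) s)"
    and "(\<lambda>s. \<Sum>n. head_term a \<delta> d (n + N) s) holomorphic_on {s. Re s > real d - real N}"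
proof -
  let ?S = "{s. Re s > real d - real N}"
  have S: "open ?S" by (rule open_halfspace_Re_gt)
  have nz: "s + of_nat (n + N) - of_nat d \<noteq> (0::complex)" if "s \<in> ?S" for n s
  proof -
    have "Re (s + of_nat (n + N) - of_nat d) > 0" using that by simp
    then show ?thesis by (metis less_irrefl zero_complex.simps(1))
  qed
  have 1: "(\<lambda>s. head_term a \<delta> d (n + N) s) field_differentiable (at x)" if "x \<in> ?S" for n x
  proof -
    have "(\<lambda>s. head_term a \<delta> d (n + N) s) holomorphic_on ?S"
      unfolding head_term_def using \<delta> nz by (intro holomorphic_intros) auto
    then show ?thesis using S that holomorphic_on_imp_differentiable_at by blast
  qed
  have 2: "\<exists>e h. 0 < e \<and> summable h \<and> range h \<subseteq> \<real>\<^sub>\<ge>\<^sub>0 \<and> (\<forall>\<^sub>F n in sequentially. \<forall>y\<in>ball x e \<inter> ?S. cmod (head_term a \<delta> d (n + N) y) \<le> cmod (h n))"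
    if x: "x \<in> ?S" for x
  proof -
    \<comment> \<open>Half the distance of Re x to the line of real part d - N: on the ball of
      radius e all denominators with index at least N have absolute value at least e.\<close>
    define e where "e = (Re x - (real d - real N)) / 2"
    have e: "e > 0" using x by (simp add: e_def)
    \<comment> \<open>Since \<delta> is at most 1, its powers decrease in the exponent, so the
      smallest real part on the ball gives the bound; e bounds the denominator.\<close>
    define K where "K = \<delta> powr (Re x - e - real d) / e"
    have K: "K \<ge> 0" using e by (simp add: K_def)
    define h where "h = (\<lambda>n. K * (norm (a (n + N)) * \<delta> ^ (n + N)))"
    have "summable h" unfolding h_def using sum by (intro summable_mult) (subst summable_iff_shift)
    moreover have h0: "h n \<ge> 0" for n using K \<delta> by (simp add: h_def)
    moreover have "cmod (head_term a \<delta> d (n + N) y) \<le> h n" if y: "y \<in> ball x e" for y n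
    proof -
      have "\<bar>Re x - Re y\<bar> \<le> dist x y" by (metis abs_Re_le_cmod dist_norm minus_complex.simps(1))
      then have R: "Re y > Re x - e" using y by auto
      have "e \<le> Re (y + of_nat (n + N) - of_nat d)" using R by (simp add: e_def field_simps)
      also have "\<dots> \<le> cmod (y + of_nat (n + N) - of_nat d)" by (rule complex_Re_le_cmod)
      finally have den: "e \<le> cmod (y + of_nat (n + N) - of_nat d)" .
      have "cmod (of_real \<delta> powr (y + of_nat (n + N) - of_nat d)) = \<delta> powr (Re y + real (n + N) - real d)"
        using \<delta> by (simp add: norm_powr_real_powr)
      also have "\<dots> = \<delta> powr (Re y - real d) * \<delta> ^ (n + N)"
        using \<delta> by (simp add: powr_realpow[symmetric] powr_add[symmetric] algebra_simps)
      also have "\<dots> \<le> \<delta> powr (Re x - e - real d) * \<delta> ^ (n + N)"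
        using \<delta> R by (intro mult_right_mono powr_mono') auto
      finally have num: "cmod (of_real \<delta> powr (y + of_nat (n + N) - of_nat d)) \<le> \<delta> powr (Re x - e - real d) * \<delta> ^ (n + N)" .
      have "cmod (head_term a \<delta> d (n + N) y) = norm (a (n + N)) * (cmod (of_real \<delta> powr (y + of_nat (n + N) - of_nat d)) / cmod (y + of_nat (n + N) - of_nat d))"
        by (simp add: head_term_def norm_mult norm_divide)
      also have "\<dots> \<le> norm (a (n + N)) * ((\<delta> powr (Re x - e - real d) * \<delta> ^ (n + N)) / e)"
        using num den e \<delta> by (intro mult_left_mono frac_le) auto
      also have "\<dots> = h n" by (simp add: h_def K_def)
      finally show ?thesis .
    qed
    ultimately show ?thesis using e
      by (intro exI[of _ e] exI[of _ "\<lambda>n. of_real (h n)"] conjI always_eventually allI ballI)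
         (auto simp: summable_complex_of_real)
  qed
  obtain g where g: "\<forall>x \<in> ?S. ((\<lambda>n. head_term a \<delta> d (n + N) x) sums g x) \<and> g field_differentiable (at x)"
    using series_differentiable_comparison_complex[of ?S "\<lambda>n. head_term a \<delta> d (n + N)", OF S 1 2] by blast
  show "\<forall>s \<in> ?S. summable (\<lambda>n. head_term a \<delta> d (n + N) s)"
    using g by (auto simp: sums_iff)
  have "g holomorphic_on ?S" using g
    by (auto simp: holomorphic_on_def intro: field_differentiable_at_within)
  then show "(\<lambda>s. \<Sum>n. head_term a \<delta> d (n + N) s) holomorphic_on ?S"
    by (rule holomorphic_transform) (use g in \<open>auto simp: sums_iff\<close>)
qed

text \<open>Termwise integration of the Laurent expansion of G. The terms are dominated by norm (a
  j) \<delta>^j times the integrable function t powr (Re s - d - 1).\<close>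

lemma head_integral:
  assumes \<delta>: "0 < \<delta>" "\<delta> \<le> 1" and sum: "summable (\<lambda>j. norm (a j) * \<delta> ^ j)"
    and G: "\<And>t. 0 < t \<Longrightarrow> t \<le> \<delta> \<Longrightarrow> (\<lambda>j. a j * of_real t ^ j) sums (of_real t ^ d * G t)"
    and s: "Re s > real d"
  shows "(LINT t:{0<..\<delta>}|lborel. of_real t powr (s - 1) * G t) = (\<Sum>j. head_term a \<delta> d j s)"
proof -
  define z where "z = (\<lambda>j::nat. s + of_nat j - of_nat d)"
  have z: "Re (z j) > 0" for j using s by (simp add: z_def)
  define f where "f = (\<lambda>j t. indicator {0<..\<delta>} t *\<^sub>R (a j * of_real t powr (z j - 1)))"
  have f': "f j t = a j * (indicator {0<..\<delta>} t *\<^sub>R of_real t powr (z j - 1))" for j t by (simp add: f_def)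
  have int: "integrable lborel (f j)" for j
    using powr_set_integral(1)[OF z \<delta>(1), of j] unfolding f' set_integrable_def by (intro integrable_mult_right)
  have val: "integral\<^sup>L lborel (f j) = head_term a \<delta> d j s" for j
  proof -
    have "integral\<^sup>L lborel (f j) = a j * (LINT t:{0<..\<delta>}|lborel. of_real t powr (z j - 1))"
      unfolding f' set_lebesgue_integral_def by (rule integral_mult_right_zero)
    also have "\<dots> = head_term a \<delta> d j s"
      unfolding powr_set_integral(2)[OF z \<delta>(1)] by (simp add: head_term_def z_def)
    finally show ?thesis .
  qed
  have norm_f: "norm (f j t) = norm (a j) * (t ^ j * (indicator {0<..\<delta>} t *\<^sub>R t powr (Re s - d - 1)))" for j t
  proof (cases "0 < t \<and> t \<le> \<delta>")
    case True
    then have "t powr (Re s + real j - real d - 1) = t ^ j * t powr (Re s - d - 1)"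
      by (simp add: powr_realpow[symmetric] powr_add[symmetric] algebra_simps)
    then show ?thesis using True by (simp add: f_def norm_mult norm_powr_real_powr z_def)
  qed (auto simp: f_def)
  have f_eq: "f j t = indicator {0<..\<delta>} t *\<^sub>R (of_real t powr (s - 1 - of_nat d) * (a j * of_real t ^ j))" for j t
  proof (cases "0 < t \<and> t \<le> \<delta>")
    case True
    have "complex_of_real t powr (z j - 1) = of_real t powr ((s - 1 - of_nat d) + of_nat j)"
      by (simp add: z_def algebra_simps)
    also have "\<dots> = of_real t powr (s - 1 - of_nat d) * of_real t powr (of_nat j)" by (rule powr_add)
    finally show ?thesis using True by (simp add: f_def powr_nat')
  qed (auto simp: f_def)
  have f_sums: "(\<lambda>j. f j t) sums (indicator {0<..\<delta>} t *\<^sub>R (of_real t powr (s - 1) * G t))" for t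
  proof (cases "0 < t \<and> t \<le> \<delta>")
    case True
    have "(\<lambda>j. f j t) sums (of_real t powr (s - 1 - of_nat d) * (of_real t ^ d * G t))"
      unfolding f_eq using True G[of t] by (auto intro!: sums_mult)
    also have "of_real t powr (s - 1 - of_nat d) * (of_real t ^ d * G t) = of_real t powr (s - 1) * G t"
      using True by (simp add: powr_diff powr_nat')
    finally show ?thesis using True by simp
  qed (auto simp: f_def)
  have bd: "norm (f j t) \<le> norm (a j) * \<delta> ^ j * (indicator {0<..\<delta>} t *\<^sub>R t powr (Re s - d - 1))" for j t
  proof (cases "0 < t \<and> t \<le> \<delta>")
    case True
    then show ?thesis unfolding norm_f mult.assoc
      by (intro mult_left_mono mult_right_mono power_mono) auto
  qed (auto simp: f_def)
  have ae: "AE t in lborel. summable (\<lambda>j. norm (f j t))"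
  proof (rule AE_I2)
    fix t
    show "summable (\<lambda>j. norm (f j t))"
      by (rule summable_comparison_test'[OF summable_mult2[OF sum], of 0]) (use bd in auto)
  qed
  have int0: "integrable lborel (\<lambda>t. indicator {0<..\<delta>} t *\<^sub>R t powr (Re s - d - 1))"
  proof -
    have "integrable lborel (\<lambda>t. norm (indicator {0<..\<delta>} t *\<^sub>R (of_real t powr ((s - of_nat d) - 1) :: complex)))"
      using powr_set_integral(1)[of "s - of_nat d", OF _ \<delta>(1)] s unfolding set_integrable_def by (intro integrable_norm) auto
    also have "(\<lambda>t. norm (indicator {0<..\<delta>} t *\<^sub>R (of_real t powr ((s - of_nat d) - 1) :: complex))) = (\<lambda>t. indicator {0<..\<delta>} t *\<^sub>R t powr (Re s - d - 1))"
      by (auto simp: fun_eq_iff indicator_def norm_powr_real_powr)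
    finally show ?thesis .
  qed
  have s2: "summable (\<lambda>j. integral\<^sup>L lborel (\<lambda>t. norm (f j t)))"
  proof (rule summable_comparison_test'[OF summable_mult2[OF sum], of 0])
    fix j :: nat
    have "integral\<^sup>L lborel (\<lambda>t. norm (f j t)) \<le> integral\<^sup>L lborel (\<lambda>t. norm (a j) * \<delta> ^ j * (indicator {0<..\<delta>} t *\<^sub>R t powr (Re s - d - 1)))"
      by (intro integral_mono integrable_norm int integrable_mult_right int0 bd)
    also have "\<dots> = norm (a j) * \<delta> ^ j * integral\<^sup>L lborel (\<lambda>t. (indicator {0<..\<delta>} t *\<^sub>R t powr (Re s - d - 1)))"
      by (rule integral_mult_right_zero)
    finally show "norm (integral\<^sup>L lborel (\<lambda>t. norm (f j t))) \<le> norm (a j) * \<delta> ^ j * integral\<^sup>L lborel (\<lambda>t. (indicator {0<..\<delta>} t *\<^sub>R t powr (Re s - d - 1)))"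
      by simp
  qed
  have "(\<lambda>j. integral\<^sup>L lborel (f j)) sums (\<integral>t. (\<Sum>j. f j t) \<partial>lborel)"
    by (rule sums_integral[OF int ae s2])
  moreover have "(\<Sum>j. f j t) = indicator {0<..\<delta>} t *\<^sub>R (of_real t powr (s - 1) * G t)" for t
    using f_sums[of t] by (simp add: sums_iff)
  ultimately show ?thesis unfolding val set_lebesgue_integral_def by (simp add: sums_iff)
qed

text \<open>The half-line is cut into unit intervals. Each partial integral is entire by the Leibniz
  rule, and the exponential decay of G makes their sum converge locally uniformly. The sum is
  identified with the Lebesgue integral wherever the integrand is known to be integrable.\<close>

lemma tail_integral_entire:
  assumes \<delta>: "0 < \<delta>" "\<delta> \<le> 1"
    and cont: "continuous_on {\<delta>..} G" and bd: "\<And>t. t \<ge> \<delta> \<Longrightarrow> norm (G t :: complex) \<le> C * exp (- c * t)" and c: "c > 0"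
  shows "\<exists>E. E holomorphic_on UNIV \<and> (\<forall>s. set_integrable lborel {\<delta><..} (\<lambda>t. of_real t powr (s - 1) * G t) \<longrightarrow>
      E s = (LINT t:{\<delta><..}|lborel. of_real t powr (s - 1) * G t))"
proof -
  define I where "I = (\<lambda>n::nat. cbox (\<delta> + real n) (\<delta> + real n + 1))"
  define f where "f = (\<lambda>n s. integral (I n) (\<lambda>t. of_real t powr (s - 1) * G t))"
  have C: "C \<ge> 0"
    using order_trans[OF norm_ge_zero bd[OF order_refl]] by (simp add: zero_le_mult_iff)
  have It: "t \<ge> \<delta>" "t > 0" if "t \<in> I n" for t n using that \<delta> by (auto simp: I_def)
  have contI: "continuous_on (I n) G" for n
    by (rule continuous_on_subset[OF cont]) (use It in auto)
  have cont1: "continuous_on (I n) (\<lambda>t. of_real t powr (s - 1) * G t)" for n s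
    using It by (intro continuous_intros contI) (auto dest: It(2) intro: less_imp_le)
  have hol: "f n holomorphic_on UNIV" for n
    unfolding f_def I_def
  proof (rule leibniz_rule_holomorphic[where fx = "\<lambda>s t. of_real t powr (s - 1) * of_real (ln t) * G t"])
    fix s :: complex and t assume "t \<in> cbox (\<delta> + real n) (\<delta> + real n + 1)"
    then have t: "t > 0" using It(2)[of t n] unfolding I_def by simp
    show "((\<lambda>s. of_real t powr (s - 1) * G t) has_field_derivative of_real t powr (s - 1) * of_real (ln t) * G t) (at s within UNIV)"
    proof -
      have "((\<lambda>z. of_real t powr z) has_field_derivative Ln (of_real t) * of_real t powr (s - 1)) (at (s - 1))"
        by (rule has_field_derivative_powr_right) (use t in simp)
      moreover have "((\<lambda>s. s - 1) has_field_derivative 1) (at s)"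
        by (auto intro!: derivative_eq_intros)
      ultimately have "((\<lambda>s. of_real t powr (s - 1)) has_field_derivative Ln (of_real t) * of_real t powr (s - 1) * 1) (at s)"
        by (rule DERIV_chain2)
      from DERIV_cmult_right[OF this, of "G t"] show ?thesis using t by (simp add: Ln_of_real mult_ac)
    qed
  next
    show "(\<lambda>t. of_real t powr (s - 1) * G t) integrable_on cbox (\<delta> + real n) (\<delta> + real n + 1)" for s
      using integrable_continuous[of "\<delta> + real n" "\<delta> + real n + 1", OF cont1[of n s, unfolded I_def]] .
    have cG: "continuous_on (UNIV \<times> I n) (\<lambda>p. G (snd p))"
      by (rule continuous_on_compose2[OF contI continuous_on_snd[OF continuous_on_id]]) auto
    have "continuous_on (UNIV \<times> I n) (\<lambda>p. of_real (snd p) powr (fst p - 1) * of_real (ln (snd p)) * G (snd p))"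
      by (intro continuous_on_mult cG continuous_on_of_real continuous_on_ln continuous_on_powr_complex
          continuous_on_diff continuous_on_fst continuous_on_snd continuous_on_id continuous_on_const)
        (auto dest: It(2) intro: less_imp_le)
    then show "continuous_on (UNIV \<times> cbox (\<delta> + real n) (\<delta> + real n + 1)) (\<lambda>(s, t). of_real t powr (s - 1) * of_real (ln t) * G t)"
      by (simp add: case_prod_unfold I_def)
  qed auto
  have 2: "\<exists>e h. 0 < e \<and> summable h \<and> range h \<subseteq> \<real>\<^sub>\<ge>\<^sub>0 \<and> (\<forall>\<^sub>F n in sequentially. \<forall>y\<in>ball x e \<inter> UNIV. cmod (f n y) \<le> cmod (h n))" for x
  proof -
    \<comment> \<open>For y within distance 1 of x, the exponent Re y - 1 has absolute value at most
      R.\<close>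
    define R where "R = cmod x + 2"
    have R: "R \<ge> 2" by (simp add: R_def)
    \<comment> \<open>The power is split as \<delta> powr (Re y - 1) times (t / \<delta>) powr (Re y
      - 1), with \<delta> at most 1 and t / \<delta> at least 1. Each of the two factors contributes
      \<delta> powr (- R); the rest uses that t lies between n and n + 2.\<close>
    define h where "h = (\<lambda>n::nat. \<delta> powr (- 2 * R) * C * ((real n + 2) powr R * exp (- c * real n)))"
    have h0: "h n \<ge> 0" for n using C by (simp add: h_def)
    have "summable (\<lambda>n. (real n + 2) powr R * exp (- c * real n))"
    proof (rule summable_comparison_test_bigo)
      show "summable (\<lambda>n. norm (real n powr (-2)))" by (simp add: summable_real_powr_iff)
      show "(\<lambda>n. (real n + 2) powr R * exp (- c * real n)) \<in> O(\<lambda>n. real n powr (-2))"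
        using c by real_asymp
    qed
    then have "summable h" unfolding h_def by (rule summable_mult)
    moreover have "cmod (f n y) \<le> h n" if y: "y \<in> ball x 1" for y n
    proof -
      have "cmod y \<le> cmod x + 1" using y norm_triangle_ineq2[of y x] by (simp add: dist_norm norm_minus_commute)
      then have y': "\<bar>Re y - 1\<bar> \<le> R" using abs_Re_le_cmod[of y] by (simp add: R_def)
      have "norm (f n y) \<le> h n * measure lborel (I n)"
        unfolding f_def I_def
      proof (rule integrable_bound)
        show "(\<lambda>t. of_real t powr (y - 1) * G t) integrable_on cbox (\<delta> + real n) (\<delta> + real n + 1)"
          using integrable_continuous[of "\<delta> + real n" "\<delta> + real n + 1", OF cont1[of n y, unfolded I_def]] .
        fix t assume "t \<in> cbox (\<delta> + real n) (\<delta> + real n + 1)"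
        then have t: "t \<ge> \<delta>" "t > 0" "t \<le> real n + 2" "real n \<le> t" using \<delta> by auto
        have "norm (of_real t powr (y - 1) :: complex) = t powr (Re y - 1)" using t by (simp add: norm_powr_real_powr)
        also have "\<dots> = \<delta> powr (Re y - 1) * (t / \<delta>) powr (Re y - 1)" using t \<delta> by (simp add: powr_divide)
        also have "\<dots> \<le> \<delta> powr (- R) * (t / \<delta>) powr R"
          using y' t \<delta> by (intro mult_mono powr_mono powr_mono') auto
        also have "\<dots> = \<delta> powr (- 2 * R) * t powr R" using t \<delta> 
          by (simp add: powr_divide powr_minus field_simps powr_add[symmetric])
        also have "\<dots> \<le> \<delta> powr (- 2 * R) * (real n + 2) powr R"
          using t R by (intro mult_left_mono powr_mono2) auto
        finally have 1: "norm (of_real t powr (y - 1) :: complex) \<le> \<delta> powr (- 2 * R) * (real n + 2) powr R" .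
        have "norm (G t) \<le> C * exp (- c * t)" using bd t by auto
        also have "\<dots> \<le> C * exp (- c * real n)" using C c t by (intro mult_left_mono) auto
        finally have 2: "norm (G t) \<le> C * exp (- c * real n)" .
        show "norm (of_real t powr (y - 1) * G t) \<le> h n"
          using mult_mono[OF 1 2] by (simp add: norm_mult h_def mult_ac)
      qed (rule h0)
      also have "measure lborel (I n) = 1" by (simp add: I_def)
      finally show ?thesis by simp
    qed
    ultimately show ?thesis using h0
      by (intro exI[of _ 1] exI[of _ "\<lambda>n. of_real (h n)"] conjI always_eventually allI ballI)
         (auto simp: summable_complex_of_real)
  qed
  have 1: "f n field_differentiable (at x)" for n x
    using hol[of n] holomorphic_on_imp_differentiable_at[of "f n" UNIV x] by simp
  obtain E where E: "\<forall>x \<in> UNIV. ((\<lambda>n. f n x) sums E x) \<and> E field_differentiable (at x)"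
    using series_differentiable_comparison_complex[of UNIV f, OF open_UNIV 1 2] by blast
  have "E holomorphic_on UNIV" using E by (auto simp: holomorphic_on_def)
  moreover have "E s = (LINT t:{\<delta><..}|lborel. of_real t powr (s - 1) * G t)"
    if int: "set_integrable lborel {\<delta><..} (\<lambda>t. of_real t powr (s - 1) * G t)" for s
  proof -
    \<comment> \<open>Half-open intervals, so that they are disjoint; they differ from the compact
      intervals of the Leibniz rule by a null set.\<close>
    define A where "A = (\<lambda>n::nat. {\<delta> + real n<..\<delta> + real n + 1})"
    have UA: "(\<Union>n. A n) = {\<delta><..}"
    proof (intro equalityI subsetI)
      fix t assume t: "t \<in> {\<delta><..}"
      define n where "n = nat (\<lceil>t - \<delta>\<rceil> - 1)"
      have "real n < t - \<delta>" "t - \<delta> \<le> real n + 1" using t unfolding n_def by (simp_all, linarith+)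
      then show "t \<in> (\<Union>n. A n)" by (auto simp: A_def intro!: exI[of _ n])
    qed (auto simp: A_def)
    have disj: "A i \<inter> A j = {}" if "i \<noteq> j" for i j
    proof -
      have "real i + 1 \<le> real j \<or> real j + 1 \<le> real i" using that by linarith
      then show ?thesis by (auto simp: A_def)
    qed
    have "(LINT t:(\<Union>n. A n)|lborel. of_real t powr (s - 1) * G t) = (\<Sum>n. (LINT t:A n|lborel. of_real t powr (s - 1) * G t))"
      by (rule lebesgue_integral_countable_add) (use int UA disj in \<open>auto simp: A_def\<close>)
    moreover have "(LINT t:A n|lborel. of_real t powr (s - 1) * G t) = f n s" for n
    proof -
      have "set_integrable lborel (A n) (\<lambda>t. of_real t powr (s - 1) * G t)"
        by (rule set_integrable_subset[OF int]) (auto simp: A_def)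
      then have "(LINT t:A n|lborel. of_real t powr (s - 1) * G t) = integral (A n) (\<lambda>t. of_real t powr (s - 1) * G t)"
        by (rule set_borel_integral_eq_integral(2))
      also have "\<dots> = f n s" unfolding f_def
        by (rule integral_spike_set; rule negligible_subset[of "{\<delta> + real n}"]) (auto simp: A_def I_def)
      finally show ?thesis .
    qed
    ultimately show ?thesis using E unfolding UA by (simp add: sums_iff)
  qed
  ultimately show ?thesis by blast
qed

text \<open>The integral up to \<delta> becomes a series with at most simple poles at the points d -
  j, the rest is entire. The pole at s = 0 comes from j = d and is cancelled by the zero of
  \<open>rGamma\<close>, which leaves the coefficient a d.\<close>

lemma Mellin_continuation:
  assumes \<delta>: "0 < \<delta>" "\<delta> \<le> 1" and sum: "summable (\<lambda>j. norm (a j) * \<delta> ^ j)"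
    and G: "\<And>t. 0 < t \<Longrightarrow> t \<le> \<delta> \<Longrightarrow> (\<lambda>j. a j * of_real t ^ j) sums (of_real t ^ d * G t)"
    and cont: "continuous_on {\<delta>..} G" and bd: "\<And>t. t \<ge> \<delta> \<Longrightarrow> norm (G t :: complex) \<le> C * exp (- c * t)" and c: "c > 0"
    and int: "\<And>s. Re s > real d \<Longrightarrow> set_integrable lborel {0<..} (\<lambda>t. of_real t powr (s - 1) * G t)"
  shows "\<exists>Z. Z nicely_meromorphic_on UNIV \<and> Z analytic_on {0} \<and> Z 0 = a d \<and>
     (\<forall>s. Re s > real d \<longrightarrow> Z s = rGamma s * (LINT t:{0<..}|lborel. of_real t powr (s - 1) * G t))"
proof -
  obtain E where E: "E holomorphic_on UNIV"
    "\<And>s. set_integrable lborel {\<delta><..} (\<lambda>t. of_real t powr (s - 1) * G t) \<Longrightarrow>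
      E s = (LINT t:{\<delta><..}|lborel. of_real t powr (s - 1) * G t)"
    using tail_integral_entire[OF \<delta> cont bd c] by blast
  let ?T = "head_term a \<delta> d"
  \<comment> \<open>At s = d - j the division by zero gives a term the value 0, so \<open>Z0\<close>
    has the wrong value where a singularity is removable; \<open>remove_sings\<close> repairs this
    below.\<close>
  define Z0 where "Z0 = (\<lambda>s. rGamma s * ((\<Sum>j. ?T j s) + E s))"
  note tail = head_tail_analytic[OF \<delta> sum, of d]
  have anE: "E analytic_on A" for A
    using E(1) analytic_on_holomorphic by blast
  have split: "(\<Sum>j. ?T j s) = (\<Sum>n. ?T (n + N) s) + (\<Sum>j<N. ?T j s)" if "Re s > real d - real N" for s N
  proof -
    have "summable (\<lambda>n. ?T (n + N) s)" using tail(1)[of N] that by blast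
    then have "summable (\<lambda>j. ?T j s)" by (rule summable_iff_shift[THEN iffD1])
    then show ?thesis by (rule suminf_split_initial_segment)
  qed
  have ev: "eventually (\<lambda>s. Z0 s = rGamma s * ((\<Sum>n. ?T (n + N) s) + (\<Sum>j<N. ?T j s) + E s)) (nhds x)"
    if "Re x > real d - real N" for x N
  proof -
    have "eventually (\<lambda>s. s \<in> {s. Re s > real d - real N}) (nhds x)"
      using that by (intro eventually_nhds_in_open open_halfspace_Re_gt) auto
    then show ?thesis by eventually_elim (simp add: Z0_def split)
  qed
  have an_tail: "(\<lambda>s. \<Sum>n. ?T (n + N) s) analytic_on {x}" if "Re x > real d - real N" for x N
    using tail(2)[of N] that open_halfspace_Re_gt[of "real d - real N"]
    by (auto simp: analytic_at)
  have mero: "Z0 meromorphic_on UNIV"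
  proof (subst meromorphic_on_meromorphic_at, intro ballI)
    fix x :: complex
    obtain N :: nat where "real N > real d - Re x" using reals_Archimedean2 by blast
    then have N: "Re x > real d - real N" by linarith
    have "(\<lambda>s. rGamma s * ((\<Sum>n. ?T (n + N) s) + (\<Sum>j<N. ?T j s) + E s)) meromorphic_on {x}"
      unfolding head_term_def
      by (intro meromorphic_intros analytic_on_imp_meromorphic_on[OF analytic_rGamma]
        analytic_on_imp_meromorphic_on[OF an_tail[OF N, unfolded head_term_def]] analytic_on_imp_meromorphic_on[OF anE]
        analytic_on_imp_meromorphic_on)
        (use \<delta> in \<open>auto intro!: analytic_intros\<close>)
    then show "Z0 meromorphic_on {x}"
      by (subst meromorphic_on_cong[where g = "\<lambda>s. rGamma s * ((\<Sum>n. ?T (n + N) s) + (\<Sum>j<N. ?T j s) + E s)" and B = "{x}"])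
        (use ev[OF N] in \<open>auto intro: eventually_nhds_conv_at[THEN iffD1, THEN conjunct1]\<close>)
  qed
  define Z where "Z = remove_sings Z0"
  have "Z nicely_meromorphic_on UNIV" unfolding Z_def by (rule remove_sings_nicely_meromorphic[OF mero])
  moreover have "Z analytic_on {0} \<and> Z 0 = a d"
  proof -
    have N: "Re 0 > real d - real (Suc d)" by simp
    \<comment> \<open>Near 0 only the term j = d is singular, and rGamma s / s = rGamma (s + 1)
      absorbs its denominator. At s = 0 the other summands are killed by rGamma 0 = 0.\<close>
    define W where "W = (\<lambda>s. rGamma (s + 1) * (a d * of_real \<delta> powr s) + rGamma s * ((\<Sum>n. ?T (n + Suc d) s) + (\<Sum>j<d. ?T j s) + E s))"
    have hs: "(\<lambda>s. \<Sum>j<d. ?T j s) analytic_on {0}"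
      unfolding head_term_def using \<delta> by (intro analytic_intros) auto
    then have W: "W analytic_on {0}" unfolding W_def
      using \<delta> by (intro analytic_on_add[OF analytic_on_mult analytic_on_mult] analytic_on_add[OF analytic_on_add[OF an_tail[OF N] hs] anE] analytic_intros analytic_rGamma analytic_on_compose_gen[OF _ analytic_rGamma, unfolded o_def]) auto
    have "eventually (\<lambda>s::complex. s \<noteq> 0) (at 0)" by (simp add: eventually_at_filter)
    moreover have "eventually (\<lambda>s. Z0 s = rGamma s * ((\<Sum>n. ?T (n + Suc d) s) + (\<Sum>j<Suc d. ?T j s) + E s)) (at 0)"
      using ev[OF N] by (simp add: eventually_nhds_conv_at)
    ultimately have evW: "eventually (\<lambda>s. Z0 s = W s) (at 0)"
    proof eventually_elim
      case (elim s)
      have "rGamma s * ?T d s = rGamma (s + 1) * (a d * of_real \<delta> powr s)"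
        using elim(1) by (simp add: head_term_def rGamma_plus1[of s, symmetric])
      then show ?case unfolding elim(2) W_def by (simp add: ring_distribs)
    qed
    have lim: "Z0 \<midarrow>0\<rightarrow> W 0"
      using analytic_at_imp_isCont[OF W] evW by (simp add: isCont_def cong: tendsto_cong)
    have iso: "isolated_singularity_at Z0 0"
      using meromorphic_on_isolated_singularity[OF meromorphic_on_subset[OF mero]] by blast
    have "Z analytic_on {0}" unfolding Z_def by (rule remove_sings_analytic_at[OF iso lim])
    moreover have "Z 0 = W 0" unfolding Z_def by (rule remove_sings_eqI[OF lim])
    moreover have "W 0 = a d" using \<delta> by (simp add: W_def)
    ultimately show ?thesis by simp
  qed
  moreover have "Z s = rGamma s * (LINT t:{0<..}|lborel. of_real t powr (s - 1) * G t)" if s: "Re s > real d" for s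
  proof -
    have "Re s > real d - real 0" using s by simp
    note ev0 = ev[OF this] an_tail[OF this]
    have "(\<lambda>s. rGamma s * ((\<Sum>n. ?T (n + 0) s) + (\<Sum>j<0. ?T j s) + E s)) analytic_on {s}"
      by (intro analytic_intros ev0(2) anE analytic_rGamma) auto
    then have "Z0 analytic_on {s}" using analytic_at_cong[OF ev0(1) refl] by simp
    then have "Z s = Z0 s" unfolding Z_def by (rule remove_sings_at_analytic)
    also have "Z0 s = rGamma s * ((LINT t:{0<..\<delta>}|lborel. of_real t powr (s - 1) * G t) + (LINT t:{\<delta><..}|lborel. of_real t powr (s - 1) * G t))"
      unfolding Z0_def using head_integral[OF \<delta> sum G s] E(2)[OF set_integrable_subset[OF int[OF s]]] \<delta> by auto
    also have "(LINT t:{0<..\<delta>}|lborel. of_real t powr (s - 1) * G t) + (LINT t:{\<delta><..}|lborel. of_real t powr (s - 1) * G t)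
        = (LINT t:{0<..\<delta>} \<union> {\<delta><..}|lborel. of_real t powr (s - 1) * G t)"
      by (rule set_integral_Un[symmetric]) (use \<delta> in \<open>auto intro!: set_integrable_subset[OF int[OF s]]\<close>)
    also have "{0<..\<delta>} \<union> {\<delta><..} = {0<..}" using \<delta> by auto
    finally show ?thesis .
  qed
  ultimately show ?thesis by blast
qed

section \<open>The generating function in a complex variable and its reflection\<close>

definition todd_den :: "real \<Rightarrow> complex \<Rightarrow> complex" where
  "todd_den \<omega> t = (if t = 0 then of_real \<omega> else (1 - exp (- of_real \<omega> * t)) / t)"

text \<open>This is t^d times the generating function \<open>barnes_gf\<close>: the pole at 0 is
  removed, and negative arguments become accessible by continuation.\<close>

definition todd_gf :: "real \<Rightarrow> real list \<Rightarrow> complex \<Rightarrow> complex" where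
  "todd_gf w ws t = exp (- of_real w * t) * (\<Prod>\<omega>\<leftarrow>ws. 1 / todd_den \<omega> t)"

lemma todd_den_holomorphic: "todd_den \<omega> holomorphic_on UNIV"
proof -
  have "((\<lambda>t::complex. 1 - exp (- of_real \<omega> * t)) has_field_derivative of_real \<omega>) (at 0)"
    by (auto intro!: derivative_eq_intros)
  then have lim: "(\<lambda>t. (1 - exp (- of_real \<omega> * t)) / t) \<midarrow>0\<rightarrow> (of_real \<omega> :: complex)"
    by (simp add: DERIV_def)
  show ?thesis
  proof (rule no_isolated_singularity[of _ _ "{0}"])
    have "(\<lambda>t. (1 - exp (- of_real \<omega> * t)) / t) holomorphic_on (UNIV - {0})"
      by (intro holomorphic_intros) auto
    then show "todd_den \<omega> holomorphic_on (UNIV - {0})"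
      by (rule holomorphic_transform) (auto simp: todd_den_def)
    show "continuous_on UNIV (todd_den \<omega>)"
    proof (clarsimp simp: continuous_on_eq_continuous_at)
      fix x :: complex
      show "isCont (todd_den \<omega>) x"
      proof (cases "x = 0")
        case True
        have "eventually (\<lambda>t. (1 - exp (- of_real \<omega> * t)) / t = todd_den \<omega> t) (at 0)"
          by (auto simp: eventually_at_filter todd_den_def)
        with lim have "todd_den \<omega> \<midarrow>0\<rightarrow> of_real \<omega>" by (rule Lim_transform_eventually)
        then show ?thesis using True by (simp add: isCont_def todd_den_def[of \<omega> 0])
      next
        case False
        have "open (UNIV - {0::complex})" by auto
        then show ?thesis using \<open>todd_den \<omega> holomorphic_on (UNIV - {0})\<close> False
          by (meson DiffI UNIV_I continuous_on_eq_continuous_at holomorphic_on_imp_continuous_on singletonD)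
      qed
    qed
  qed auto
qed

lemma todd_den_minus: "todd_den \<omega> (- t) = exp (of_real \<omega> * t) * todd_den \<omega> t"
  by (simp add: todd_den_def divide_simps ring_distribs exp_add[symmetric])

text \<open>Each denominator satisfies \<open>todd_den \<omega> (- t) = exp (\<omega> t) * todd_den
  \<omega> t\<close>. This is why |\<omega>| - w and the sign (-1)^d occur in \<xi>: together they
  turn the generating function at t into the one at - t.\<close>

lemma todd_gf_reflect: "todd_gf (sum_list ws - w) ws t = todd_gf w ws (- t)"
proof -
  have "(\<Prod>\<omega>\<leftarrow>ws. 1 / todd_den \<omega> (- t)) = exp (- of_real (sum_list ws) * t) * (\<Prod>\<omega>\<leftarrow>ws. 1 / todd_den \<omega> t)"
  proof (induction ws)
    case (Cons \<omega> ws)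
    have "1 / todd_den \<omega> (- t) = exp (- of_real \<omega> * t) * (1 / todd_den \<omega> t)"
      by (simp add: todd_den_minus exp_minus divide_inverse)
    moreover have "exp (- complex_of_real (sum_list (\<omega> # ws)) * t) = exp (- of_real \<omega> * t) * exp (- of_real (sum_list ws) * t)"
      by (simp add: exp_add[symmetric] ring_distribs)
    ultimately show ?case unfolding list.map prod_list.Cons Cons.IH by (simp only: mult_ac)
  qed simp
  then show ?thesis by (simp add: todd_gf_def mult.assoc[symmetric] exp_add[symmetric] algebra_simps)
qed

lemma todd_gf_eq:
  assumes "t > 0"
  shows "todd_gf w ws (of_real t) = of_real t ^ length ws * of_real (barnes_gf w ws t)"
proof -
  have "(\<Prod>\<omega>\<leftarrow>ws. 1 / todd_den \<omega> (of_real t)) = of_real t ^ length ws * of_real (\<Prod>\<omega>\<leftarrow>ws. 1 / (1 - exp (- \<omega> * t)))"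
    by (induction ws) (use assms in \<open>simp_all add: todd_den_def exp_of_real[symmetric]\<close>)
  then show ?thesis by (simp add: todd_gf_def barnes_gf_def exp_of_real[symmetric])
qed

lemma todd_gf_holomorphic_near_0:
  assumes pos: "\<And>\<omega>. \<omega> \<in> set ws \<Longrightarrow> \<omega> > 0"
  shows "\<exists>r>0. todd_gf w ws holomorphic_on ball 0 r"
proof -
  have "todd_gf w ws analytic_on {0}"
  proof -
    have an: "todd_den \<omega> analytic_on {0}" for \<omega>
      using todd_den_holomorphic analytic_on_holomorphic by blast
    have "(\<lambda>t. (\<Prod>\<omega>\<leftarrow>ws. 1 / todd_den \<omega> t)) analytic_on {0}"
      using pos
    proof (induction ws)
      case (Cons \<omega> ws)
      have "todd_den \<omega> 0 \<noteq> 0" using Cons.prems[of \<omega>] by (simp add: todd_den_def)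
      then show ?case using Cons unfolding list.map prod_list.Cons by (intro analytic_intros an) auto
    qed simp
    then show ?thesis unfolding todd_gf_def by (intro analytic_intros) auto
  qed
  then show ?thesis unfolding analytic_on_def by auto
qed

text \<open>The continuation of Mellin transforms is fed with the Taylor coefficients of
  \<open>todd_gf\<close>; uniqueness of nicely meromorphic continuations then identifies the result
  with the function chosen by \<open>THE\<close>.\<close>

lemma barnes_zeta_continuation:
  assumes pos: "\<And>\<omega>. \<omega> \<in> set ws \<Longrightarrow> \<omega> > 0" and w: "w > 0" and ne: "ws \<noteq> []"
  shows "barnes_zeta w ws nicely_meromorphic_on UNIV" "barnes_zeta w ws analytic_on {0}"
    "barnes_zeta w ws 0 = (deriv ^^ length ws) (todd_gf w ws) 0 / fact (length ws)"
    "\<And>s. Re s > real (length ws) \<Longrightarrow>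
       barnes_zeta w ws s = rGamma s * (LINT t:{0<..}|lborel. of_real t powr (s - 1) * of_real (barnes_gf w ws t))"
proof -
  define d where "d = length ws"
  obtain r where r: "r > 0" "todd_gf w ws holomorphic_on ball 0 r"
    using todd_gf_holomorphic_near_0[OF pos] by blast
  \<comment> \<open>Strictly inside the disc of holomorphy, for absolute convergence of the
    expansion at \<delta>, and at most 1, as the continuation lemma requires.\<close>
  define \<delta> where "\<delta> = min 1 (r / 2)"
  have \<delta>: "0 < \<delta>" "\<delta> \<le> 1" "\<delta> < r" using r by (auto simp: \<delta>_def)
  define a where "a = (\<lambda>j. (deriv ^^ j) (todd_gf w ws) 0 / fact j)"
  have ps: "(\<lambda>j. a j * z ^ j) sums todd_gf w ws z" if "norm z < r" for z
    using holomorphic_power_series[OF r(2), of z] that by (simp add: a_def)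
  have sum: "summable (\<lambda>j. norm (a j) * \<delta> ^ j)"
  proof -
    \<comment> \<open>Absolute convergence at \<delta> follows from convergence at the larger radius
      (\<delta> + r) / 2.\<close>
    have "summable (\<lambda>j. norm (a j * of_real \<delta> ^ j))"
    proof (rule powser_insidea)
      show "summable (\<lambda>j. a j * of_real ((\<delta> + r) / 2) ^ j)"
        using ps[of "of_real ((\<delta> + r) / 2)"] \<delta> r by (auto simp: sums_iff simp del: of_real_add of_real_divide)
      show "norm (of_real \<delta> :: complex) < norm (of_real ((\<delta> + r) / 2) :: complex)"
        using \<delta> r by (simp del: of_real_add of_real_divide)
    qed
    then show ?thesis using \<delta> by (simp add: norm_mult norm_power)
  qed
  have Gs: "(\<lambda>j. a j * of_real t ^ j) sums (of_real t ^ d * of_real (barnes_gf w ws t))" if "0 < t" "t \<le> \<delta>" for t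
    using ps[of "of_real t"] that \<delta> todd_gf_eq[OF that(1), of w ws] by (simp add: d_def)
  have q: "exp (- \<omega> * t) < 1" if "\<omega> \<in> set ws" "t > 0" for \<omega> t
    using pos[OF that(1)] that(2) by simp
  have cont: "continuous_on {\<delta>..} (\<lambda>t. complex_of_real (barnes_gf w ws t))"
  proof -
    have "continuous_on {\<delta>..} (\<lambda>t. (\<Prod>\<omega>\<leftarrow>ws. 1 / (1 - exp (- \<omega> * t))))"
      using q
    proof (induction ws)
      case (Cons \<omega> ws)
      have "1 - exp (- \<omega> * t) \<noteq> 0" if "t \<ge> \<delta>" for t
        using Cons.prems[of \<omega> t] that \<delta> by auto
      then show ?case using Cons by (auto intro!: continuous_intros)
    qed auto
    then show ?thesis unfolding barnes_gf_def by (intro continuous_intros)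
  qed
  \<comment> \<open>The factors 1 / (1 - exp (- \<omega> t)) decrease in t, so their values at
    \<delta> bound them on the whole tail.\<close>
  define C where "C = (\<Prod>\<omega>\<leftarrow>ws. 1 / (1 - exp (- \<omega> * \<delta>)))"
  have bd: "norm (complex_of_real (barnes_gf w ws t)) \<le> C * exp (- w * t)" if t: "t \<ge> \<delta>" for t
  proof -
    have "0 \<le> (\<Prod>\<omega>\<leftarrow>ws. 1 / (1 - exp (- \<omega> * t))) \<and> (\<Prod>\<omega>\<leftarrow>ws. 1 / (1 - exp (- \<omega> * t))) \<le> (\<Prod>\<omega>\<leftarrow>ws. 1 / (1 - exp (- \<omega> * \<delta>)))"
      using q pos
    proof (induction ws)
      case (Cons \<omega> ws)
      have IH: "0 \<le> (\<Prod>\<omega>\<leftarrow>ws. 1 / (1 - exp (- \<omega> * t)))" "(\<Prod>\<omega>\<leftarrow>ws. 1 / (1 - exp (- \<omega> * t))) \<le> (\<Prod>\<omega>\<leftarrow>ws. 1 / (1 - exp (- \<omega> * \<delta>)))"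
        using Cons by auto
      have "exp (- \<omega> * \<delta>) < 1" "exp (- \<omega> * t) < 1" using Cons.prems(1)[of \<omega>] t \<delta> by auto
      moreover have "exp (- \<omega> * t) \<le> exp (- \<omega> * \<delta>)" using Cons.prems(2)[of \<omega>] t by simp
      ultimately have "0 \<le> 1 / (1 - exp (- \<omega> * t))" "1 / (1 - exp (- \<omega> * t)) \<le> 1 / (1 - exp (- \<omega> * \<delta>))"
        by (auto intro!: divide_left_mono)
      moreover have "\<omega> * \<delta> \<ge> 0" using Cons.prems(2)[of \<omega>] \<delta> by simp
      ultimately show ?case using IH unfolding list.map prod_list.Cons by (intro conjI mult_nonneg_nonneg mult_mono) auto
    qed auto
    then show ?thesis unfolding C_def barnes_gf_def norm_of_real
      by (subst abs_of_nonneg) (auto intro!: mult_nonneg_nonneg mult_right_mono simp: mult.commute)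
  qed
  have int: "set_integrable lborel {0<..} (\<lambda>t. of_real t powr (s - 1) * complex_of_real (barnes_gf w ws t))"
    if "Re s > real d" for s
    by (rule barnes_Mellin(1)[OF pos w that[unfolded d_def] ne])
  obtain Z where Z: "Z nicely_meromorphic_on UNIV" "Z analytic_on {0}" "Z 0 = a d"
     "\<And>s. Re s > real d \<Longrightarrow> Z s = rGamma s * (LINT t:{0<..}|lborel. of_real t powr (s - 1) * of_real (barnes_gf w ws t))"
    using Mellin_continuation[OF \<delta>(1,2) sum Gs cont bd w int] by blast
  have Zs: "Z s = barnes_series w ws s" if "Re s > real d" for s
  proof -
    have "Gamma s \<noteq> 0" using that by (auto simp: Gamma_eq_zero_iff elim!: nonpos_Ints_cases)
    then show ?thesis using Z(4)[OF that] barnes_Mellin(2)[OF pos w that[unfolded d_def] ne]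
      by (simp add: rGamma_inverse_Gamma)
  qed
  have "barnes_zeta w ws = Z" unfolding barnes_zeta_def
  proof (rule the_equality)
    show "Z nicely_meromorphic_on UNIV \<and> (\<forall>s. Re s > real (length ws) \<longrightarrow> Z s = barnes_series w ws s)"
      using Z(1) Zs by (simp add: d_def)
    fix f assume f: "f nicely_meromorphic_on UNIV \<and> (\<forall>s. Re s > real (length ws) \<longrightarrow> f s = barnes_series w ws s)"
    show "f = Z"
    proof (rule nicely_meromorphic_eqI[of _ _ "{s. Re s > real d}"])
      have "of_nat (Suc d) \<in> {s. Re s > real d}" by simp
      then show "{s. Re s > real d} \<noteq> {}" by blast
    qed (use f Z Zs in \<open>auto simp: d_def open_halfspace_Re_gt\<close>)
  qed
  then show "barnes_zeta w ws nicely_meromorphic_on UNIV" "barnes_zeta w ws analytic_on {0}"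
    "barnes_zeta w ws 0 = (deriv ^^ length ws) (todd_gf w ws) 0 / fact (length ws)"
    "\<And>s. Re s > real (length ws) \<Longrightarrow>
       barnes_zeta w ws s = rGamma s * (LINT t:{0<..}|lborel. of_real t powr (s - 1) * of_real (barnes_gf w ws t))"
    using Z by (simp_all add: a_def d_def)
qed

section \<open>The derivative of \<open>\<xi>\<close> at 0\<close>

text \<open>Sums such as \<xi> need not be in the normal form of nicely meromorphic functions. They
  are compared after removal of singularities, which changes nothing near a point of
  analyticity.\<close>

lemma meromorphic_eq_near:
  assumes f: "f meromorphic_on UNIV" and g: "g meromorphic_on UNIV"
    and U: "open U" "U \<noteq> {}" and eq: "\<And>s. s \<in> U \<Longrightarrow> f s = g s"
    and an: "f analytic_on {x}" "g analytic_on {x}"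
  shows "eventually (\<lambda>s. f s = g s) (nhds x)"
proof -
  have "remove_sings f = remove_sings g"
  proof (rule nicely_meromorphic_eqI[OF remove_sings_nicely_meromorphic[OF f] remove_sings_nicely_meromorphic[OF g] U])
    fix s assume s: "s \<in> U"
    show "remove_sings f s = remove_sings g s"
    proof (rule remove_sings_cong)
      show "eventually (\<lambda>w. f w = g w) (at s)"
        using eventually_at_in_open'[OF U(1) s] by eventually_elim (rule eq)
    qed auto
  qed
  then have r: "remove_sings f s = remove_sings g s" for s by simp
  have "eventually (\<lambda>s. remove_sings f s = f s) (nhds x)" "eventually (\<lambda>s. remove_sings g s = g s) (nhds x)"
    using an by (auto intro: eventually_remove_sings_eq_nhds)
  then show ?thesis by eventually_elim (use r in metis)
qed

definition barnes_admissible :: "real \<Rightarrow> real list \<Rightarrow> bool" where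
  "barnes_admissible w ws \<longleftrightarrow> ws \<noteq> [] \<and> (\<forall>\<omega>\<in>set ws. \<omega> > 0) \<and> 0 < w \<and> w < sum_list ws"

lemma barnes_admissible_reflect:
  "barnes_admissible w ws \<Longrightarrow> barnes_admissible (sum_list ws - w) ws"
  by (auto simp: barnes_admissible_def)

lemma barnes_zeta_admissible:
  assumes "barnes_admissible w ws"
  shows "barnes_zeta w ws meromorphic_on UNIV" "barnes_zeta w ws analytic_on {0}"
    "barnes_zeta w ws 0 = (deriv ^^ length ws) (todd_gf w ws) 0 / fact (length ws)"
    "\<And>s. Re s > real (length ws) \<Longrightarrow>
       barnes_zeta w ws s = rGamma s * (LINT t:{0<..}|lborel. of_real t powr (s - 1) * of_real (barnes_gf w ws t))"
    "\<And>s. Re s > real (length ws) \<Longrightarrow>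
       set_integrable lborel {0<..} (\<lambda>t. of_real t powr (s - 1) * complex_of_real (barnes_gf w ws t))"
  using barnes_zeta_continuation[of ws w] barnes_Mellin(1)[of ws w] assms
  by (auto simp: barnes_admissible_def nicely_meromorphic_on_def)

lemma barnes_xi_analytic:
  assumes "barnes_admissible w ws"
  shows "barnes_xi w ws meromorphic_on UNIV" "barnes_xi w ws analytic_on {0}"
  using barnes_zeta_admissible[OF assms] barnes_zeta_admissible[OF barnes_admissible_reflect[OF assms]]
  unfolding barnes_xi_def by (auto intro!: meromorphic_intros analytic_intros)

text \<open>Both zeta values at 0 are Taylor coefficients of index d of \<open>todd_gf\<close>. The
  reflection t to - t multiplies this coefficient by (-1)^d, and the sign in \<xi> undoes this, so
  the two halves cancel.\<close>

lemma barnes_xi_0: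
  assumes a: "barnes_admissible w ws"
  shows "barnes_xi w ws 0 = 0"
proof -
  have pos: "\<And>\<omega>. \<omega> \<in> set ws \<Longrightarrow> \<omega> > 0" using a by (auto simp: barnes_admissible_def)
  obtain r where r: "r > 0" "todd_gf w ws holomorphic_on ball 0 r"
    using todd_gf_holomorphic_near_0[OF pos] by blast
  have "(deriv ^^ length ws) (todd_gf (sum_list ws - w) ws) 0 = (deriv ^^ length ws) (\<lambda>t. todd_gf w ws ((-1) * t)) 0"
    by (rule arg_cong2[where f = "\<lambda>h. (deriv ^^ length ws) h"]) (auto simp: fun_eq_iff todd_gf_reflect)
  also have "\<dots> = (-1) ^ length ws * (deriv ^^ length ws) (todd_gf w ws) ((-1) * 0)"
    by (rule higher_deriv_compose_linear[OF r(2), of "ball 0 r"]) (use r in auto)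
  finally show ?thesis unfolding barnes_xi_def
    using barnes_zeta_admissible(3)[OF a] barnes_zeta_admissible(3)[OF barnes_admissible_reflect[OF a]]
    by (simp add: power_mult_distrib[symmetric] mult.assoc[symmetric])
qed

text \<open>If G is the continued generating function, this is G(- t) - G(t), that is, minus twice
  the odd part of G.\<close>

definition barnes_odd :: "real \<Rightarrow> real list \<Rightarrow> real \<Rightarrow> real" where
  "barnes_odd w ws t = - barnes_gf w ws t + (-1) ^ length ws * barnes_gf (sum_list ws - w) ws t"

lemma barnes_xi_Mellin:
  assumes a: "barnes_admissible w ws" and s: "Re s > real (length ws)"
  shows "barnes_xi w ws s = rGamma s * (LINT t:{0<..}|lborel. of_real t powr (s - 1) * of_real (barnes_odd w ws t))"
    and "set_integrable lborel {0<..} (\<lambda>t. of_real t powr (s - 1) * complex_of_real (barnes_odd w ws t))"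
proof -
  let ?h = "\<lambda>w t. of_real t powr (s - 1) * complex_of_real (barnes_gf w ws t)"
  let ?w' = "sum_list ws - w"
  note 1 = barnes_zeta_admissible(5)[OF a s] barnes_zeta_admissible(5)[OF barnes_admissible_reflect[OF a] s]
  have eq: "of_real t powr (s - 1) * complex_of_real (barnes_odd w ws t) = - ?h w t + (-1) ^ length ws * ?h ?w' t" for t
    by (simp add: barnes_odd_def algebra_simps)
  have 2: "set_integrable lborel {0<..} (\<lambda>t. - ?h w t)" using set_integrable_mult_right[of "-1", OF 1(1)] by simp
  have 3: "set_integrable lborel {0<..} (\<lambda>t. (-1) ^ length ws * ?h ?w' t)" by (rule set_integrable_mult_right[OF 1(2)])
  show "set_integrable lborel {0<..} (\<lambda>t. of_real t powr (s - 1) * complex_of_real (barnes_odd w ws t))"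
    unfolding eq by (rule set_integral_add(1)[OF 2 3])
  have "(LINT t:{0<..}|lborel. of_real t powr (s - 1) * of_real (barnes_odd w ws t)) =
     (LINT t:{0<..}|lborel. - ?h w t) + (LINT t:{0<..}|lborel. (-1) ^ length ws * ?h ?w' t)"
    unfolding eq by (rule set_integral_add(2)[OF 2 3])
  also have "(LINT t:{0<..}|lborel. - ?h w t) = - (LINT t:{0<..}|lborel. ?h w t)"
    using set_integral_mult_right[of lborel "{0<..}" "-1" "?h w"] by simp
  also have "(LINT t:{0<..}|lborel. (-1) ^ length ws * ?h ?w' t) = (-1) ^ length ws * (LINT t:{0<..}|lborel. ?h ?w' t)"
    by (rule set_integral_mult_right)
  finally have I: "(LINT t:{0<..}|lborel. of_real t powr (s - 1) * of_real (barnes_odd w ws t)) =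
    - (LINT t:{0<..}|lborel. ?h w t) + (-1) ^ length ws * (LINT t:{0<..}|lborel. ?h ?w' t)" .
  show "barnes_xi w ws s = rGamma s * (LINT t:{0<..}|lborel. of_real t powr (s - 1) * of_real (barnes_odd w ws t))"
    unfolding barnes_xi_def barnes_zeta_admissible(4)[OF a s] barnes_zeta_admissible(4)[OF barnes_admissible_reflect[OF a] s] I
    by (simp only: ring_distribs mult_minus_right mult.left_commute)
qed

section \<open>Finite families of Barnes data and the dependence of their derivative sum on the
  generating function\<close>

definition barnes_sum :: "(real \<Rightarrow> real list \<Rightarrow> real \<Rightarrow> real) \<Rightarrow> (real \<times> real list) list \<Rightarrow> real \<Rightarrow> real" where
  "barnes_sum h P t = (\<Sum>(w, ws)\<leftarrow>P. h w ws t)"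

text \<open>Families are lists, so that the union of two disjoint sets of field elements corresponds
  to concatenation, with multiplicities kept.\<close>

definition xi_deriv_sum :: "(real \<times> real list) list \<Rightarrow> complex" where
  "xi_deriv_sum P = (\<Sum>(w, ws)\<leftarrow>P. deriv (barnes_xi w ws) 0)"

definition barnes_adm_list :: "(real \<times> real list) list \<Rightarrow> bool" where
  "barnes_adm_list P \<longleftrightarrow> (\<forall>(w, ws)\<in>set P. barnes_admissible w ws)"

lemma xi_sum_Mellin:
  assumes "barnes_adm_list P" and "\<And>w ws. (w, ws) \<in> set P \<Longrightarrow> Re s > real (length ws)"
  shows "(\<Sum>(w, ws)\<leftarrow>P. barnes_xi w ws s) = rGamma s * (LINT t:{0<..}|lborel. of_real t powr (s - 1) * of_real (barnes_sum barnes_odd P t))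
   \<and> set_integrable lborel {0<..} (\<lambda>t. of_real t powr (s - 1) * complex_of_real (barnes_sum barnes_odd P t))"
  using assms
proof (induction P)
  case Nil
  then show ?case by (simp add: barnes_sum_def set_integrable_def)
next
  case (Cons p P)
  obtain w ws where p: "p = (w, ws)" by force
  have a: "barnes_admissible w ws" "Re s > real (length ws)" using Cons.prems p by (auto simp: barnes_adm_list_def)
  have IH: "(\<Sum>(w, ws)\<leftarrow>P. barnes_xi w ws s) = rGamma s * (LINT t:{0<..}|lborel. of_real t powr (s - 1) * of_real (barnes_sum barnes_odd P t))"
   "set_integrable lborel {0<..} (\<lambda>t. of_real t powr (s - 1) * complex_of_real (barnes_sum barnes_odd P t))"
    using Cons by (auto simp: barnes_adm_list_def)
  have eq: "of_real t powr (s - 1) * complex_of_real (barnes_sum barnes_odd (p # P) t) =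
     of_real t powr (s - 1) * complex_of_real (barnes_odd w ws t) + of_real t powr (s - 1) * complex_of_real (barnes_sum barnes_odd P t)" for t
    by (simp add: barnes_sum_def p ring_distribs)
  show ?case unfolding eq set_integral_add(2)[OF barnes_xi_Mellin(2)[OF a] IH(2)]
    using set_integral_add(1)[OF barnes_xi_Mellin(2)[OF a] IH(2)] barnes_xi_Mellin(1)[OF a] IH(1)
    by (simp add: p ring_distribs)
qed

lemma xi_sum_analytic:
  assumes "barnes_adm_list P"
  shows "(\<lambda>s. \<Sum>(w, ws)\<leftarrow>P. barnes_xi w ws s) meromorphic_on UNIV \<and>
    (\<lambda>s. \<Sum>(w, ws)\<leftarrow>P. barnes_xi w ws s) analytic_on {0} \<and>
    deriv (\<lambda>s. \<Sum>(w, ws)\<leftarrow>P. barnes_xi w ws s) 0 = xi_deriv_sum P"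
  using assms
proof (induction P)
  case Nil
  then show ?case by (auto simp: xi_deriv_sum_def intro!: analytic_on_imp_meromorphic_on)
next
  case (Cons p P)
  obtain w ws where p: "p = (w, ws)" by force
  have a: "barnes_admissible w ws" using Cons.prems p by (auto simp: barnes_adm_list_def)
  have IH: "(\<lambda>s. \<Sum>(w, ws)\<leftarrow>P. barnes_xi w ws s) meromorphic_on UNIV"
    "(\<lambda>s. \<Sum>(w, ws)\<leftarrow>P. barnes_xi w ws s) analytic_on {0}"
    "deriv (\<lambda>s. \<Sum>(w, ws)\<leftarrow>P. barnes_xi w ws s) 0 = xi_deriv_sum P"
    using Cons by (auto simp: barnes_adm_list_def)
  note b = barnes_xi_analytic[OF a]
  have "deriv (\<lambda>s. barnes_xi w ws s + (\<Sum>(w, ws)\<leftarrow>P. barnes_xi w ws s)) 0 =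
     deriv (barnes_xi w ws) 0 + deriv (\<lambda>s. \<Sum>(w, ws)\<leftarrow>P. barnes_xi w ws s) 0"
    by (rule deriv_add) (use b(2) IH(2) analytic_on_imp_differentiable_at in auto)
  then show ?case using b IH
    by (auto simp: p xi_deriv_sum_def intro!: meromorphic_intros analytic_intros)
qed

text \<open>Equal integrands have equal Mellin transforms in a right half-plane, and both sides
  continue meromorphically to a neighbourhood of 0, where they are analytic.\<close>

lemma xi_deriv_sum_eqI_odd:
  assumes P: "barnes_adm_list P" and Q: "barnes_adm_list Q"
    and eq: "\<And>t. t > 0 \<Longrightarrow> barnes_sum barnes_odd P t = barnes_sum barnes_odd Q t"
  shows "xi_deriv_sum P = xi_deriv_sum Q"
proof -
  \<comment> \<open>The largest length in either family: beyond real part D all the Mellin integrals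
    converge simultaneously.\<close>
  define D where "D = Max (insert 0 (length ` snd ` (set P \<union> set Q)))"
  have D: "real (length ws) \<le> real D" if "(w, ws) \<in> set P \<union> set Q" for w ws
    unfolding D_def of_nat_le_iff by (rule Max_ge) (use that in \<open>auto simp: image_iff intro!: bexI[of _ "(w, ws)"]\<close>)
  let ?f = "\<lambda>P s. \<Sum>(w, ws)\<leftarrow>P. barnes_xi w ws s"
  have "eventually (\<lambda>s. ?f P s = ?f Q s) (nhds 0)"
  proof (rule meromorphic_eq_near[of _ _ "{s. Re s > real D}"])
    have "of_nat (Suc D) \<in> {s. Re s > real D}" by simp
    then show "{s. Re s > real D} \<noteq> {}" by blast
    fix s assume "s \<in> {s. Re s > real D}"
    then have s: "Re s > real D" by simp
    have "(LINT t:{0<..}|lborel. of_real t powr (s - 1) * complex_of_real (barnes_sum barnes_odd P t)) =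
       (LINT t:{0<..}|lborel. of_real t powr (s - 1) * of_real (barnes_sum barnes_odd Q t))"
      by (rule set_lebesgue_integral_cong) (auto simp: eq)
    moreover have "?f P s = rGamma s * (LINT t:{0<..}|lborel. of_real t powr (s - 1) * of_real (barnes_sum barnes_odd P t))"
      using D s by (intro xi_sum_Mellin[OF P, THEN conjunct1]) force
    moreover have "?f Q s = rGamma s * (LINT t:{0<..}|lborel. of_real t powr (s - 1) * of_real (barnes_sum barnes_odd Q t))"
      using D s by (intro xi_sum_Mellin[OF Q, THEN conjunct1]) force
    ultimately show "?f P s = ?f Q s" by simp
  qed (use xi_sum_analytic[OF P] xi_sum_analytic[OF Q] in \<open>auto simp: open_halfspace_Re_gt\<close>)
  then have "deriv (?f P) 0 = deriv (?f Q) 0" by (rule deriv_cong_ev) simp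
  then show ?thesis using xi_sum_analytic[OF P] xi_sum_analytic[OF Q] by simp
qed

text \<open>The zeros of 1 - exp (- \<omega> t) are the multiples of 2 pi i / \<omega>, and the one
  at t = 0 has been divided out.\<close>

lemma todd_den_nonzero:
  assumes "\<omega> > 0" "\<bar>Im t\<bar> < 2 * pi / \<omega>"
  shows "todd_den \<omega> t \<noteq> 0"
proof (cases "t = 0")
  case False
  have "exp (- of_real \<omega> * t) \<noteq> 1"
  proof
    assume "exp (- of_real \<omega> * t) = 1"
    then obtain n :: int where n: "Re (- of_real \<omega> * t) = 0" "Im (- of_real \<omega> * t) = of_int (2 * n) * pi"
      unfolding exp_eq_1 by auto
    have "\<bar>Im (- of_real \<omega> * t)\<bar> < 2 * pi" using assms by (simp add: abs_mult field_simps)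
    then have "\<bar>of_int n :: real\<bar> < 1" unfolding n(2) by (simp add: abs_mult)
    then have "n = 0" by linarith
    then have "Re t = 0" "Im t = 0" using n assms by auto
    then show False using False by (simp add: complex_eq_iff)
  qed
  then show ?thesis using False by (simp add: todd_den_def)
qed (use assms in \<open>simp add: todd_den_def\<close>)

text \<open>The generating functions are meromorphic in a strip around the real axis with a pole only
  at \<open>0\<close>, so an identity on the positive axis extends to the negative axis.\<close>
lemma barnes_sum_odd_cong:
  assumes P: "barnes_adm_list P" and Q: "barnes_adm_list Q"
    and eq: "\<And>t. t > 0 \<Longrightarrow> barnes_sum barnes_gf P t = barnes_sum barnes_gf Q t" and t: "t > 0"
  shows "barnes_sum barnes_odd P t = barnes_sum barnes_odd Q t"
proof -
  let ?r = "\<lambda>w ws t. (-1) ^ length ws * barnes_gf (sum_list ws - w) ws t"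
  define D where "D = Max (insert 0 (length ` snd ` (set P \<union> set Q)))"
  have D: "length ws \<le> D" if "(w, ws) \<in> set P \<union> set Q" for w ws
    unfolding D_def by (rule Max_ge) (use that in \<open>auto simp: image_iff intro!: bexI[of _ "(w, ws)"]\<close>)
  define \<Omega> where "\<Omega> = \<Union> (set ` snd ` (set P \<union> set Q))"
  have \<Omega>: "finite \<Omega>" "\<And>\<omega>. \<omega> \<in> \<Omega> \<Longrightarrow> \<omega> > 0" using P Q
    by (auto simp: \<Omega>_def barnes_adm_list_def barnes_admissible_def)
  \<comment> \<open>The strip stays below the first nonzero zero of every denominator; the entry 1
    covers the case without generators.\<close>
  define \<rho> where "\<rho> = Min (insert 1 ((\<lambda>\<omega>. 2 * pi / \<omega>) ` \<Omega>))"
  have \<rho>: "\<rho> > 0" using \<Omega> by (auto simp: \<rho>_def)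
  have \<rho>': "\<rho> \<le> 2 * pi / \<omega>" if "\<omega> \<in> \<Omega>" for \<omega> using \<Omega> that by (auto simp: \<rho>_def)
  define S where "S = {t. \<bar>Im t\<bar> < \<rho>}"
  have S': "S = {t. Im t > - \<rho>} \<inter> {t. Im t < \<rho>}" by (auto simp: S_def)
  have S: "open S" "connected S"
    unfolding S' by (auto intro!: open_Int open_halfspace_Im_gt open_halfspace_Im_lt convex_connected convex_Int
      convex_halfspace_Im_gt convex_halfspace_Im_lt)
  \<comment> \<open>Multiplication by t^D clears the poles at 0 of all members of the families,
    whatever their lengths, so the sums become holomorphic on the whole strip.\<close>
  define \<Phi> where "\<Phi> = (\<lambda>P t. \<Sum>(w, ws)\<leftarrow>P. t ^ (D - length ws) * todd_gf w ws t)"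
  have hol: "\<Phi> R holomorphic_on S" if "\<Union> (set ` snd ` set R) \<subseteq> \<Omega>" for R
    using that
  proof (induction R)
    case (Cons p R)
    obtain w ws where p: "p = (w, ws)" by force
    have "(\<lambda>t. \<Prod>\<omega>\<leftarrow>ws. 1 / todd_den \<omega> t) holomorphic_on S" if "set ws \<subseteq> \<Omega>" for ws
      using that
    proof (induction ws)
      case (Cons \<omega> ws)
      have "todd_den \<omega> t \<noteq> 0" if "t \<in> S" for t
        by (rule todd_den_nonzero) (use Cons.prems that \<Omega> \<rho>'[of \<omega>] in \<open>auto simp: S_def\<close>)
      then show ?case using Cons
        by (auto intro!: holomorphic_intros holomorphic_on_subset[OF todd_den_holomorphic])
    qed simp
    then have "todd_gf w ws holomorphic_on S" using Cons.prems p unfolding todd_gf_def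
      by (auto intro!: holomorphic_intros)
    then show ?case using Cons unfolding \<Phi>_def by (auto simp: p intro!: holomorphic_intros)
  qed (simp add: \<Phi>_def)
  have \<Phi>_pos: "\<Phi> R (of_real t) = of_real (t ^ D * barnes_sum barnes_gf R t)" if "t > 0" "set R \<subseteq> set P \<union> set Q" for R t
    using that(2)
  proof (induction R)
    case (Cons p R)
    obtain w ws where p: "p = (w, ws)" by force
    have "D = (D - length ws) + length ws" using D[of w ws] Cons.prems p by auto
    then have "complex_of_real t ^ D = of_real t ^ (D - length ws) * of_real t ^ length ws"
      by (metis power_add)
    then show ?case using Cons that(1) unfolding \<Phi>_def barnes_sum_def by (simp add: p todd_gf_eq ring_distribs)
  qed (simp add: \<Phi>_def barnes_sum_def)
  have \<Phi>_neg: "\<Phi> R (- of_real t) = of_real ((-t) ^ D * barnes_sum ?r R t)" if "t > 0" "set R \<subseteq> set P \<union> set Q" for R t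
    using that(2)
  proof (induction R)
    case (Cons p R)
    obtain w ws where p: "p = (w, ws)" by force
    have "D = (D - length ws) + length ws" using D[of w ws] Cons.prems p by auto
    then have "(- complex_of_real t) ^ D = (- of_real t) ^ (D - length ws) * ((- 1) ^ length ws * of_real t ^ length ws)"
      by (metis power_add power_minus)
    moreover have "(- 1) ^ length ws * (- 1) ^ length ws = (1 :: complex)" by (simp add: power_mult_distrib[symmetric])
    ultimately have "(- of_real t) ^ (D - length ws) * of_real t ^ length ws = (- complex_of_real t) ^ D * (- 1) ^ length ws"
      by (simp add: mult_ac)
    then have "(- of_real t) ^ (D - length ws) * todd_gf w ws (- of_real t) = (- complex_of_real t) ^ D * ((-1) ^ length ws * of_real (barnes_gf (sum_list ws - w) ws t))"
      unfolding todd_gf_reflect[symmetric] todd_gf_eq[OF that(1)] by (simp add: mult.assoc[symmetric])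
    then show ?case using Cons that(1) unfolding \<Phi>_def barnes_sum_def by (simp add: p ring_distribs)
  qed (simp add: \<Phi>_def barnes_sum_def)
  \<comment> \<open>Identity theorem on the connected strip: the functions agree on the positive
    axis, which accumulates at 1. The conclusion is then used at - t.\<close>
  have "\<Phi> P z - \<Phi> Q z = 0" if "z \<in> S" for z
  proof (rule analytic_continuation[of "\<lambda>z. \<Phi> P z - \<Phi> Q z" S "of_real ` {0<..}" 1])
    show "(\<lambda>z. \<Phi> P z - \<Phi> Q z) holomorphic_on S"
      by (intro holomorphic_on_diff hol) (auto simp: \<Omega>_def)
    show "of_real ` {0<..} \<subseteq> S" "1 \<in> S" using \<rho> by (auto simp: S_def)
    show "(1 :: complex) islimpt of_real ` {0<..}"
    proof (rule islimptI)
      fix T :: "complex set" assume T: "1 \<in> T" "open T"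
      then obtain e where e: "e > 0" "ball 1 e \<subseteq> T" by (meson openE)
      have "dist 1 (complex_of_real (1 + e / 2)) = e / 2" using e by (simp add: dist_norm)
      then have "complex_of_real (1 + e / 2) \<in> T" using e by (intro subsetD[OF e(2)]) simp
      then show "\<exists>y\<in>of_real ` {0<..}. y \<in> T \<and> y \<noteq> (1 :: complex)"
        using e(1) by (intro bexI[of _ "complex_of_real (1 + e / 2)"] image_eqI[of _ _ "1 + e / 2"] conjI) auto
    qed
    fix z :: complex assume "z \<in> of_real ` {0<..}"
    then show "\<Phi> P z - \<Phi> Q z = 0" using \<Phi>_pos[of _ P] \<Phi>_pos[of _ Q] eq by auto
  qed (use S that in auto)
  then have "\<Phi> P (- of_real t) - \<Phi> Q (- of_real t) = 0" using \<rho> by (auto simp: S_def)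
  then have "(-t) ^ D * barnes_sum ?r P t = (-t) ^ D * barnes_sum ?r Q t"
    unfolding \<Phi>_neg[OF t Un_upper1] \<Phi>_neg[OF t Un_upper2] right_minus_eq of_real_eq_iff .
  then have "barnes_sum ?r P t = barnes_sum ?r Q t"
    using t by simp
  moreover have "barnes_sum barnes_odd R t = - barnes_sum barnes_gf R t + barnes_sum ?r R t" for R
    by (induction R) (auto simp: barnes_sum_def barnes_odd_def)
  ultimately show ?thesis using eq[OF t] by simp
qed

lemma xi_deriv_sum_eqI:
  assumes "barnes_adm_list P" "barnes_adm_list Q"
    and "\<And>t. t > 0 \<Longrightarrow> barnes_sum barnes_gf P t = barnes_sum barnes_gf Q t"
  shows "xi_deriv_sum P = xi_deriv_sum Q"
  using xi_deriv_sum_eqI_odd barnes_sum_odd_cong assms by metis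

section \<open>Behaviour under scaling of w and the generators\<close>

lemma barnes_admissible_scale:
  "barnes_admissible w ws \<Longrightarrow> c > 0 \<Longrightarrow> barnes_admissible (c * w) (map ((*) c) ws)"
  by (auto simp: barnes_admissible_def sum_list_const_mult)

lemma barnes_series_scale:
  assumes "barnes_admissible w ws" and c: "c > 0"
  shows "barnes_series (c * w) (map ((*) c) ws) s = of_real c powr (- s) * barnes_series w ws s"
proof -
  have "complex_of_real (c * w + (\<Sum>j<length ws. real (ks ! j) * (map ((*) c) ws) ! j)) powr (- s) =
    of_real c powr (- s) * complex_of_real (w + (\<Sum>j<length ws. real (ks ! j) * ws ! j)) powr (- s)" for ks
  proof -
    have "c * w + (\<Sum>j<length ws. real (ks ! j) * (map ((*) c) ws) ! j) = c * (w + (\<Sum>j<length ws. real (ks ! j) * ws ! j))"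
      by (simp add: sum_distrib_left ring_distribs mult_ac)
    moreover have "w + (\<Sum>j<length ws. real (ks ! j) * ws ! j) \<ge> 0"
      using assms by (intro add_nonneg_nonneg sum_nonneg mult_nonneg_nonneg) (auto simp: barnes_admissible_def less_imp_le)
    ultimately show ?thesis using c by (simp add: powr_times_real del: of_real_add of_real_sum)
  qed
  then show ?thesis unfolding barnes_series_def by (simp add: infsum_cmult_right')
qed

lemma barnes_zeta_eq_series:
  assumes "barnes_admissible w ws" "Re s > real (length ws)"
  shows "barnes_zeta w ws s = barnes_series w ws s"
proof -
  have "Gamma s \<noteq> 0" using assms(2) by (auto simp: Gamma_eq_zero_iff elim!: nonpos_Ints_cases)
  then show ?thesis using barnes_zeta_admissible(4)[OF assms] barnes_Mellin(2)[of ws w s] assms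
    by (simp add: rGamma_inverse_Gamma barnes_admissible_def)
qed

text \<open>Scaling by c multiplies \<xi>(s) by c powr (- s), first in the half-plane of convergence
  and then near 0. In the product rule the derivative of this factor meets \<xi>(0) = 0.\<close>

lemma deriv_barnes_xi_scale:
  assumes a: "barnes_admissible w ws" and c: "c > 0"
  shows "deriv (barnes_xi (c * w) (map ((*) c) ws)) 0 = deriv (barnes_xi w ws) 0"
proof -
  let ?d = "length ws"
  let ?g = "\<lambda>s. of_real c powr (- s) * barnes_xi w ws s"
  note a' = barnes_admissible_scale[OF a c]
  have pw: "(\<lambda>s. of_real c powr (- s)) analytic_on A" for A using c by (intro analytic_intros) auto
  have "eventually (\<lambda>s. barnes_xi (c * w) (map ((*) c) ws) s = ?g s) (nhds 0)"
  proof (rule meromorphic_eq_near[of _ _ "{s. Re s > real ?d}"])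
    have "of_nat (Suc ?d) \<in> {s. Re s > real ?d}" by simp
    then show "{s. Re s > real ?d} \<noteq> {}" by blast
    show "?g meromorphic_on UNIV"
      by (intro meromorphic_intros analytic_on_imp_meromorphic_on[OF pw] barnes_xi_analytic(1)[OF a])
    show "?g analytic_on {0}"
      by (intro analytic_intros pw barnes_xi_analytic(2)[OF a])
    fix s assume "s \<in> {s. Re s > real ?d}"
    then have s: "Re s > real ?d" by simp
    have e: "sum_list (map ((*) c) ws) - c * w = c * (sum_list ws - w)"
      by (simp add: sum_list_const_mult ring_distribs)
    note r = barnes_admissible_reflect[OF a]
    show "barnes_xi (c * w) (map ((*) c) ws) s = ?g s"
      unfolding barnes_xi_def e
      using s barnes_zeta_eq_series[OF a s] barnes_zeta_eq_series[OF a', of s]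
        barnes_zeta_eq_series[OF r s] barnes_zeta_eq_series[OF barnes_admissible_scale[OF r c], of s]
        barnes_series_scale[OF a c, of s] barnes_series_scale[OF r c, of s]
      by (simp add: algebra_simps)
  qed (use barnes_xi_analytic[OF a'] in \<open>auto simp: open_halfspace_Re_gt\<close>)
  then have "deriv (barnes_xi (c * w) (map ((*) c) ws)) 0 = deriv ?g 0" by (rule deriv_cong_ev) simp
  also have "\<dots> = of_real c powr (- 0) * deriv (barnes_xi w ws) 0 + deriv (\<lambda>s. of_real c powr (- s)) 0 * barnes_xi w ws 0"
    by (rule deriv_mult) (use pw barnes_xi_analytic(2)[OF a] analytic_on_imp_differentiable_at in auto)
  finally show ?thesis using c by (simp add: barnes_xi_0[OF a])
qed

section \<open>Rational cones in the number field\<close>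

interpretation Q: vector_space "rat_scale :: rat \<Rightarrow> 'a::field_char_0 \<Rightarrow> 'a"
  by unfold_locales (auto simp: rat_scale_def of_rat_add of_rat_mult ring_distribs)

text \<open>For generators whose real images are independent, these are exactly the field elements
  of the open real cone. Only they enter the sums, so the geometry of cones is carried out with
  rational coefficients.\<close>

definition qcone :: "'a::field_char_0 set \<Rightarrow> 'a set" where
  "qcone W = {\<Sum>w\<in>W. of_rat (q w) * w | q. \<forall>w\<in>W. 0 < q w}"

lemma qcone_insert:
  assumes "finite W" "u \<notin> W"
  shows "x \<in> qcone (insert u W) \<longleftrightarrow> (\<exists>a r. a > 0 \<and> r \<in> qcone W \<and> x = of_rat a * u + r)"
proof
  assume "x \<in> qcone (insert u W)"
  then obtain q where q: "\<forall>w\<in>insert u W. 0 < q w" "x = (\<Sum>w\<in>insert u W. of_rat (q w) * w)"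
    by (auto simp: qcone_def)
  then show "\<exists>a r. a > 0 \<and> r \<in> qcone W \<and> x = of_rat a * u + r"
    using assms by (intro exI[of _ "q u"] exI[of _ "\<Sum>w\<in>W. of_rat (q w) * w"]) (auto simp: qcone_def)
next
  assume "\<exists>a r. a > 0 \<and> r \<in> qcone W \<and> x = of_rat a * u + r"
  then obtain a q where a: "a > 0" "\<forall>w\<in>W. 0 < q w" "x = of_rat a * u + (\<Sum>w\<in>W. of_rat (q w) * w)"
    by (auto simp: qcone_def)
  have "(\<Sum>w\<in>insert u W. of_rat ((q(u := a)) w) * w) = of_rat a * u + (\<Sum>w\<in>W. of_rat (q w) * w)"
    using assms by (auto intro!: sum.cong)
  then show "x \<in> qcone (insert u W)"
    unfolding qcone_def using a assms by (intro CollectI exI[of _ "q(u := a)"]) auto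
qed

lemma qcone_subset_span: "qcone W \<subseteq> Q.span W"
proof
  fix x assume "x \<in> qcone W"
  then obtain q where "x = (\<Sum>w\<in>W. rat_scale (q w) w)" by (auto simp: qcone_def rat_scale_def)
  then show "x \<in> Q.span W" by (simp only:) (intro Q.span_sum Q.span_scale Q.span_base)
qed

lemma rat_span_coeff_unique:
  assumes "u \<notin> Q.span V" "r \<in> Q.span V" "s \<in> Q.span V" "of_rat a * u + r = of_rat b * u + s"
  shows "a = b"
proof (rule ccontr)
  assume "a \<noteq> b"
  have "s - r = rat_scale (a - b) u" using assms(4) by (simp add: rat_scale_def of_rat_diff algebra_simps)
  moreover have "s - r \<in> Q.span V" using assms by (intro Q.span_diff)
  ultimately have "rat_scale (a - b) u \<in> Q.span V" by metis
  then have "rat_scale (inverse (a - b)) (rat_scale (a - b) u) \<in> Q.span V"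
    by (rule Q.span_scale)
  moreover have "rat_scale (inverse (a - b)) (rat_scale (a - b) u) = u" using \<open>a \<noteq> b\<close> by simp
  ultimately show False using assms(1) by metis
qed

text \<open>Stellar subdivision at a point \<open>p\<close> of the face generated by \<open>u\<close> and \<open>v\<close>.\<close>
lemma qcone_subdivide:
  fixes u v :: "'a::field_char_0"
  assumes W: "finite W" "u \<notin> W" "v \<notin> W" "u \<noteq> v" and ind: "Q.independent (insert u (insert v W))"
    and ab: "a > 0" "b > 0" and p: "p = of_rat a * u + of_rat b * v"
  shows "p \<notin> insert u W" "p \<notin> insert v W"
    "Q.independent (insert p (insert u W))" "Q.independent (insert p (insert v W))" "Q.independent (insert p W)"
    "qcone (insert u (insert v W)) = qcone (insert p (insert u W)) \<union> (qcone (insert p (insert v W)) \<union> qcone (insert p W))"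
    "qcone (insert p (insert u W)) \<inter> (qcone (insert p (insert v W)) \<union> qcone (insert p W)) = {}"
    "qcone (insert p (insert v W)) \<inter> qcone (insert p W) = {}"
proof -
  have iu: "u \<notin> Q.span (insert v W)" using ind W by (auto simp: Q.independent_insert)
  have iv: "v \<notin> Q.span (insert u W)" using ind W by (subst (asm) insert_commute) (auto simp: Q.independent_insert)
  have indv: "Q.independent (insert v W)" "Q.independent (insert u W)"
    using Q.independent_mono[OF ind, of "insert v W"] Q.independent_mono[OF ind, of "insert u W"] by auto
  have pu: "p \<notin> Q.span (insert u W)"
  proof
    assume "p \<in> Q.span (insert u W)"
    then have "rat_scale (inverse b) (p - rat_scale a u) \<in> Q.span (insert u W)"
      by (intro Q.span_scale Q.span_diff) (auto intro: Q.span_base)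
    also have "p - rat_scale a u = rat_scale b v" by (simp add: p rat_scale_def)
    finally show False using iv ab by simp
  qed
  have pv: "p \<notin> Q.span (insert v W)"
  proof
    assume "p \<in> Q.span (insert v W)"
    then have "rat_scale (inverse a) (p - rat_scale b v) \<in> Q.span (insert v W)"
      by (intro Q.span_scale Q.span_diff) (auto intro: Q.span_base)
    also have "p - rat_scale b v = rat_scale a u" by (simp add: p rat_scale_def)
    finally show False using iu ab by simp
  qed
  show pn: "p \<notin> insert u W" "p \<notin> insert v W" using pu pv Q.span_base by blast+
  show "Q.independent (insert p (insert u W))" "Q.independent (insert p (insert v W))"
    using pu pv indv pn by (auto simp: Q.independent_insert)
  then show "Q.independent (insert p W)" using Q.independent_mono[of "insert p (insert u W)" "insert p W"] by auto
  have C0: "x \<in> qcone (insert u (insert v W)) \<longleftrightarrow> (\<exists>c e r. c > 0 \<and> e > 0 \<and> r \<in> qcone W \<and> x = of_rat c * u + (of_rat e * v + r))" for x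
    using W by (simp add: qcone_insert) blast
  \<comment> \<open>With c and e the coordinates along the two old generators, the ray of p is given
    by c / a = e / b. The three pieces are distinguished by the comparison of these ratios; this
    fact serves both full-dimensional pieces by symmetry.\<close>
  have part: "x \<in> qcone (insert p (insert u' W)) \<longleftrightarrow>
      (\<exists>c e r. c > 0 \<and> e > 0 \<and> r \<in> qcone W \<and> c / a' > e / b' \<and> x = of_rat c * u' + (of_rat e * v' + r))"
    if h0: "u' \<notin> W" "p \<notin> insert u' W" "a' > 0" "b' > 0" "p = of_rat a' * u' + of_rat b' * v'" for x u' v' a' b'
  proof -
    have "x \<in> qcone (insert p (insert u' W)) \<longleftrightarrow> (\<exists>c e r. c > 0 \<and> e > 0 \<and> r \<in> qcone W \<and> x = of_rat c * p + (of_rat e * u' + r))"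
      using W(1) h0(1,2) by (simp add: qcone_insert) blast
    also have "\<dots> \<longleftrightarrow> (\<exists>c e r. c > 0 \<and> e > 0 \<and> r \<in> qcone W \<and> c / a' > e / b' \<and> x = of_rat c * u' + (of_rat e * v' + r))"
    proof (intro iffI; elim exE conjE)
      fix c e r assume h: "c > 0" "e > 0" "r \<in> qcone W" "x = of_rat c * p + (of_rat e * u' + r)"
      have "x = of_rat (c * a' + e) * u' + (of_rat (c * b') * v' + r)"
        unfolding h(4) h0(5) by (simp add: of_rat_add of_rat_mult algebra_simps)
      moreover have "c * a' + e > 0" "c * b' > 0" "(c * a' + e) / a' > (c * b') / b'"
        using h h0 by (auto simp: field_simps add_pos_pos)
      ultimately show "\<exists>c e r. c > 0 \<and> e > 0 \<and> r \<in> qcone W \<and> c / a' > e / b' \<and> x = of_rat c * u' + (of_rat e * v' + r)"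
        using h(3) by blast
    next
      fix c e r assume h: "c > 0" "e > 0" "r \<in> qcone W" "c / a' > e / b'" "x = of_rat c * u' + (of_rat e * v' + r)"
      define k where "k = e / b'"
      have eb: "e = k * b'" using h0(4) by (simp add: k_def)
      have "x = of_rat k * p + (of_rat (c - k * a') * u' + r)"
        unfolding h(5) h0(5) eb by (simp add: of_rat_diff of_rat_mult algebra_simps)
      moreover have "k > 0" "c - k * a' > 0" unfolding k_def using h h0 by (auto simp: field_simps)
      ultimately show "\<exists>c e r. c > 0 \<and> e > 0 \<and> r \<in> qcone W \<and> x = of_rat c * p + (of_rat e * u' + r)"
        using h(3) by blast
    qed
    finally show ?thesis .
  qed
  have Cu: "x \<in> qcone (insert p (insert u W)) \<longleftrightarrow> (\<exists>c e r. c > 0 \<and> e > 0 \<and> r \<in> qcone W \<and> c / a > e / b \<and> x = of_rat c * u + (of_rat e * v + r))" for x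
    by (rule part[OF W(2) pn(1) ab p])
  have Cv: "x \<in> qcone (insert p (insert v W)) \<longleftrightarrow> (\<exists>c e r. c > 0 \<and> e > 0 \<and> r \<in> qcone W \<and> c / a < e / b \<and> x = of_rat c * u + (of_rat e * v + r))" for x
  proof -
    have "p = of_rat b * v + of_rat a * u" by (simp add: p)
    note part[OF W(3) pn(2) ab(2,1) this, of x]
    also have "(\<exists>c e r. c > 0 \<and> e > 0 \<and> r \<in> qcone W \<and> c / b > e / a \<and> x = of_rat c * v + (of_rat e * u + r)) \<longleftrightarrow>
      (\<exists>c e r. c > 0 \<and> e > 0 \<and> r \<in> qcone W \<and> c / a < e / b \<and> x = of_rat c * u + (of_rat e * v + r))"
    proof (intro iffI; elim exE conjE)
      fix c e r assume "c > 0" "e > 0" "r \<in> qcone W" "c / b > e / a" "x = of_rat c * v + (of_rat e * u + r)"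
      then show "\<exists>c e r. c > 0 \<and> e > 0 \<and> r \<in> qcone W \<and> c / a < e / b \<and> x = of_rat c * u + (of_rat e * v + r)"
        by (intro exI[of _ e] exI[of _ c] exI[of _ r] conjI) (simp_all only: add.left_commute)
    next
      fix c e r assume "c > 0" "e > 0" "r \<in> qcone W" "c / a < e / b" "x = of_rat c * u + (of_rat e * v + r)"
      then show "\<exists>c e r. c > 0 \<and> e > 0 \<and> r \<in> qcone W \<and> c / b > e / a \<and> x = of_rat c * v + (of_rat e * u + r)"
        by (intro exI[of _ e] exI[of _ c] exI[of _ r] conjI) (simp_all only: add.left_commute)
    qed
    finally show ?thesis .
  qed
  have Cp: "x \<in> qcone (insert p W) \<longleftrightarrow> (\<exists>c e r. c > 0 \<and> e > 0 \<and> r \<in> qcone W \<and> c / a = e / b \<and> x = of_rat c * u + (of_rat e * v + r))" for x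
  proof -
    have "x \<in> qcone (insert p W) \<longleftrightarrow> (\<exists>c r. c > 0 \<and> r \<in> qcone W \<and> x = of_rat c * p + r)"
      using W pn by (simp add: qcone_insert)
    also have "\<dots> \<longleftrightarrow> (\<exists>c e r. c > 0 \<and> e > 0 \<and> r \<in> qcone W \<and> c / a = e / b \<and> x = of_rat c * u + (of_rat e * v + r))"
    proof (intro iffI; elim exE conjE)
      fix c r assume h: "c > 0" "r \<in> qcone W" "x = of_rat c * p + r"
      have "x = of_rat (c * a) * u + (of_rat (c * b) * v + r)"
        unfolding h(3) p by (simp add: of_rat_mult algebra_simps)
      moreover have "c * a > 0" "c * b > 0" "(c * a) / a = (c * b) / b" using h ab by auto
      ultimately show "\<exists>c e r. c > 0 \<and> e > 0 \<and> r \<in> qcone W \<and> c / a = e / b \<and> x = of_rat c * u + (of_rat e * v + r)"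
        using h(2) by blast
    next
      fix c e r assume h: "c > 0" "e > 0" "r \<in> qcone W" "c / a = e / b" "x = of_rat c * u + (of_rat e * v + r)"
      define k where "k = c / a"
      have k: "k = e / b" using h(4) by (simp add: k_def)
      have ca: "c = k * a" using ab by (simp add: k_def)
      have cb: "e = k * b" using ab by (simp add: k)
      have "x = of_rat k * p + r"
        unfolding h(5) p ca cb by (simp add: of_rat_mult algebra_simps)
      then have "x = of_rat (c / a) * p + r" by (simp only: k_def)
      moreover have "c / a > 0" using h ab by auto
      ultimately show "\<exists>c r. c > 0 \<and> r \<in> qcone W \<and> x = of_rat c * p + r"
        using h(3) by blast
    qed
    finally show ?thesis .
  qed
  \<comment> \<open>Coordinates are unique, so the three cases of the comparison exclude each other
    as statements about the point.\<close>
  have uniq: "c = c' \<and> e = e'" if "r \<in> qcone W" "r' \<in> qcone W" "of_rat c * u + (of_rat e * v + r) = of_rat c' * u + (of_rat e' * v + r')"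
    for c e c' e' r r'
  proof
    have sp: "r \<in> Q.span (insert v W)" "r' \<in> Q.span (insert v W)" "r \<in> Q.span (insert u W)" "r' \<in> Q.span (insert u W)"
      using that qcone_subset_span[of W] Q.span_mono[of W "insert v W"] Q.span_mono[of W "insert u W"] by auto
    have m: "of_rat q * w \<in> Q.span (insert w W)" for q w
      using Q.span_scale[OF Q.span_base, of w "insert w W" q] by (simp add: rat_scale_def)
    show "c = c'" by (rule rat_span_coeff_unique[OF iu _ _ that(3)]) (use sp m in \<open>auto intro!: Q.span_add\<close>)
    have "of_rat e * v + (of_rat c * u + r) = of_rat e' * v + (of_rat c' * u + r')" using that(3) by (simp add: algebra_simps)
    then show "e = e'" by (rule rat_span_coeff_unique[OF iv, rotated 2]) (use sp m in \<open>auto intro!: Q.span_add\<close>)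
  qed
  show "qcone (insert u (insert v W)) = qcone (insert p (insert u W)) \<union> (qcone (insert p (insert v W)) \<union> qcone (insert p W))"
  proof (rule Set.set_eqI)
    fix x
    have "(\<exists>c e r. P c e r) \<longleftrightarrow> (\<exists>c e r. P c e r \<and> c / a > e / b) \<or> (\<exists>c e r. P c e r \<and> c / a < e / b) \<or> (\<exists>c e r. P c e r \<and> c / a = e / b)"
      for P :: "rat \<Rightarrow> rat \<Rightarrow> 'a \<Rightarrow> bool"
      by (metis linorder_less_linear)
    from this[of "\<lambda>c e r. c > 0 \<and> e > 0 \<and> r \<in> qcone W \<and> x = of_rat c * u + (of_rat e * v + r)"]
    show "x \<in> qcone (insert u (insert v W)) \<longleftrightarrow> x \<in> qcone (insert p (insert u W)) \<union> (qcone (insert p (insert v W)) \<union> qcone (insert p W))"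
      unfolding Un_iff C0 Cu Cv Cp by (simp only: conj_ac)
  qed
  have "False" if "x \<in> qcone (insert p (insert u W))" "x \<in> qcone (insert p (insert v W)) \<or> x \<in> qcone (insert p W)" for x
    using that unfolding Cu Cv Cp by (metis uniq less_irrefl less_asym)
  then show "qcone (insert p (insert u W)) \<inter> (qcone (insert p (insert v W)) \<union> qcone (insert p W)) = {}" by blast
  have "False" if "x \<in> qcone (insert p (insert v W))" "x \<in> qcone (insert p W)" for x
    using that unfolding Cu Cv Cp by (metis uniq less_irrefl)
  then show "qcone (insert p (insert v W)) \<inter> qcone (insert p W) = {}" by blast
qed

text \<open>The sets that can be assembled disjointly from simplicial cones. The predicate T on
  generators will be total positivity, and W nonempty keeps the cone {0} out.\<close>

inductive conic :: "('a::field_char_0 \<Rightarrow> bool) \<Rightarrow> 'a set \<Rightarrow> bool" for T where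
  conic_qcone: "finite W \<Longrightarrow> W \<noteq> {} \<Longrightarrow> Q.independent W \<Longrightarrow> (\<And>w. w \<in> W \<Longrightarrow> T w) \<Longrightarrow> conic T (qcone W)"
| conic_empty: "conic T {}"
| conic_Un: "conic T A \<Longrightarrow> conic T B \<Longrightarrow> A \<inter> B = {} \<Longrightarrow> conic T (A \<union> B)"

definition rat_functional :: "('a::field_char_0 \<Rightarrow> rat) \<Rightarrow> bool" where
  "rat_functional l \<longleftrightarrow> (\<forall>x y. l (x + y) = l x + l y) \<and> (\<forall>q x. l (of_rat q * x) = q * l x)"

lemma rat_functional_sum:
  assumes "rat_functional l"
  shows "l (\<Sum>w\<in>W. of_rat (q w) * w) = (\<Sum>w\<in>W. q w * l w)"
proof -
  have "l 0 = 0" using assms unfolding rat_functional_def by (metis add_cancel_left_left add.left_neutral)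
  then show ?thesis
    by (induction W rule: infinite_finite_induct) (use assms in \<open>auto simp: rat_functional_def\<close>)
qed

text \<open>Induction on the number of generators off the hyperplane l = 0. If two of them lie on
  opposite sides, subdivide at the point p where their segment, up to scaling, meets the hyperplane:
  each piece loses one of the two and gains only p. Otherwise l has one strict sign, or vanishes, on
  the whole open cone, since all coefficients are positive.\<close>

lemma conic_cut_qcone:
  assumes T: "\<And>u v a b. T u \<Longrightarrow> T v \<Longrightarrow> 0 < a \<Longrightarrow> 0 < b \<Longrightarrow> T (of_rat a * u + of_rat b * v)"
    and l: "rat_functional l"
    and "finite W" "W \<noteq> {}" "Q.independent W" "\<And>w. w \<in> W \<Longrightarrow> T w"
    and S: "S = {x. l x > 0} \<or> S = {x. l x = 0} \<or> S = {x. l x < 0}"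
  shows "conic T (qcone W \<inter> S)"
  using assms(3-6)
proof (induction "card {w \<in> W. l w \<noteq> 0}" arbitrary: W rule: less_induct)
  case less
  show ?case
  proof (cases "\<exists>u\<in>W. \<exists>v\<in>W. l u > 0 \<and> l v < 0")
    case True
    then obtain u v where uv: "u \<in> W" "v \<in> W" "l u > 0" "l v < 0" by auto
    define W0 where "W0 = W - {u, v}"
    have W: "W = insert u (insert v W0)" "u \<notin> W0" "v \<notin> W0" "u \<noteq> v" "finite W0"
      using uv less.prems by (auto simp: W0_def)
    \<comment> \<open>Both coefficients are positive, and they are chosen to make l p = 0.\<close>
    define p where "p = of_rat (- l v) * u + of_rat (l u) * v"
    have lp: "l p = 0" using l unfolding p_def rat_functional_def by simp
    have Tp: "T p" unfolding p_def by (rule T) (use uv less.prems in auto)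
    note sub = qcone_subdivide[OF W(5,2-4) less.prems(3)[unfolded W(1)] _ uv(3) p_def]
    have lv: "- l v > 0" using uv by simp
    note sub = sub[OF lv]
    let ?nz = "\<lambda>W. {w \<in> W. l w \<noteq> 0}"
    have lt: "card (?nz V) < card (?nz W)" if "V \<subseteq> insert p W" "u \<notin> V \<or> v \<notin> V" for V
    proof (rule psubset_card_mono)
      show "finite (?nz W)" using less.prems by simp
      show "?nz V \<subset> ?nz W" using that lp uv by auto
    qed
    have up: "u \<noteq> p" "v \<noteq> p" using lp uv by auto
    have 1: "conic T (qcone (insert p (insert u W0)) \<inter> S)"
      by (rule less.hyps[OF lt]) (use W less.prems sub Tp up in auto)
    have 2: "conic T (qcone (insert p (insert v W0)) \<inter> S)"
      by (rule less.hyps[OF lt]) (use W less.prems sub Tp up in auto)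
    have 3: "conic T (qcone (insert p W0) \<inter> S)"
      by (rule less.hyps[OF lt]) (use W less.prems sub Tp up in auto)
    have "qcone W \<inter> S = (qcone (insert p (insert u W0)) \<inter> S) \<union> ((qcone (insert p (insert v W0)) \<inter> S) \<union> (qcone (insert p W0) \<inter> S))"
      unfolding W(1) sub(6) by blast
    also have "conic T \<dots>"
      by (intro conic_Un 1 2 3) (use sub(7,8) in blast)+
    finally show ?thesis .
  next
    case False
    have "qcone W \<subseteq> {x. l x > 0} \<or> qcone W \<subseteq> {x. l x = 0} \<or> qcone W \<subseteq> {x. l x < 0}"
    proof (cases "\<exists>u\<in>W. l u > 0")
      case True
      then obtain u where u: "u \<in> W" "l u > 0" by auto
      have nn: "l w \<ge> 0" if "w \<in> W" for w using False u that by force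
      have "l x > 0" if mem: "x \<in> qcone W" for x
      proof -
        obtain q where q: "\<forall>w\<in>W. 0 < q w" "x = (\<Sum>w\<in>W. of_rat (q w) * w)" using mem unfolding qcone_def by blast
        show ?thesis unfolding q(2) rat_functional_sum[OF l]
          by (rule sum_pos2[OF less.prems(1) u(1)]) (use q nn u in \<open>auto intro!: mult_nonneg_nonneg simp: less_imp_le\<close>)
      qed
      then show ?thesis by auto
    next
      case no: False
      show ?thesis
      proof (cases "\<exists>v\<in>W. l v < 0")
        case True
        then obtain u where u: "u \<in> W" "l u < 0" by auto
        have nn: "l w \<le> 0" if "w \<in> W" for w using no that by force
        have "l x < 0" if mem: "x \<in> qcone W" for x
        proof -
          obtain q where q: "\<forall>w\<in>W. 0 < q w" "x = (\<Sum>w\<in>W. of_rat (q w) * w)" using mem unfolding qcone_def by blast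
          have "(\<Sum>w\<in>W. q w * (- l w)) > 0"
            by (rule sum_pos2[OF less.prems(1) u(1)]) (use q nn u in \<open>auto intro!: mult_nonneg_nonneg mult_pos_neg mult_nonneg_nonpos simp: less_imp_le\<close>)
          then show ?thesis unfolding q(2) rat_functional_sum[OF l] by (simp add: sum_negf)
        qed
        then show ?thesis by auto
      next
        case False
        then have "l w = 0" if "w \<in> W" for w using no that by force
        then have "qcone W \<subseteq> {x. l x = 0}" by (auto simp: qcone_def rat_functional_sum[OF l])
        then show ?thesis by blast
      qed
    qed
    then have "qcone W \<inter> S = qcone W \<or> qcone W \<inter> S = {}" using S by force
    then show ?thesis using conic_qcone[of W T, OF less.prems] conic_empty by metis
  qed
qed

lemma conic_cut:
  assumes T: "\<And>u v a b. T u \<Longrightarrow> T v \<Longrightarrow> 0 < a \<Longrightarrow> 0 < b \<Longrightarrow> T (of_rat a * u + of_rat b * v)"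
    and l: "rat_functional l" and A: "conic T A"
    and S: "S = {x. l x > 0} \<or> S = {x. l x = 0} \<or> S = {x. l x < 0}"
  shows "conic T (A \<inter> S)"
  using A
proof induction
  case (conic_qcone W)
  show ?case by (rule conic_cut_qcone[where T = T and l = l]) (use conic_qcone T l S in auto)
next
  case conic_empty
  then show ?case by (simp add: conic.conic_empty)
next
  case (conic_Un A B)
  have "(A \<union> B) \<inter> S = (A \<inter> S) \<union> (B \<inter> S)" by blast
  then show ?case using conic_Un by (auto intro!: conic.conic_Un)
qed

section \<open>Totally real fields\<close>

text \<open>\<open>ring_int\<close> supplies closure of the algebraic integers under addition and
  multiplication. In the theorem it comes from \<ff>, since being an ideal of
  \<open>ring_of_integers\<close> includes that this structure is a ring.\<close>

locale totally_real_field =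
  fixes emb :: "'n::finite \<Rightarrow> 'a::field_char_0 \<Rightarrow> real"
  assumes field: "totally_real_number_field TYPE('a) CARD('n)"
    and real_emb: "real_embeddings emb"
    and ring_int: "ring (ring_of_integers :: 'a ring)"
begin

lemma emb_hom: "field_embedding (emb i)"
  using real_emb unfolding real_embeddings_def bij_betw_def by blast

lemma emb_1 [simp]: "emb i 1 = 1"
  and emb_add [simp]: "emb i (x + y) = emb i x + emb i y"
  and emb_mult [simp]: "emb i (x * y) = emb i x * emb i y"
  using emb_hom[of i] by (auto simp: field_embedding_def)

lemma emb_0 [simp]: "emb i 0 = 0"
  using emb_add[of i 0 0] by simp

lemma emb_minus [simp]: "emb i (- x) = - emb i x"
  using emb_add[of i x "-x"] by simp

lemma emb_diff [simp]: "emb i (x - y) = emb i x - emb i y"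
  using emb_add[of i x "-y"] by simp

lemma emb_eq_0_iff [simp]: "emb i x = 0 \<longleftrightarrow> x = 0"
proof
  assume "emb i x = 0"
  then have "x \<noteq> 0 \<Longrightarrow> False" using emb_mult[of i x "1 / x"] by simp
  then show "x = 0" by blast
qed simp

lemma emb_eq_iff [simp]: "emb i x = emb i y \<longleftrightarrow> x = y"
  using emb_eq_0_iff[of i "x - y"] by simp

lemma emb_inverse [simp]: "emb i (inverse x) = inverse (emb i x)"
proof (cases "x = 0")
  case False
  then have "emb i x * emb i (inverse x) = 1" using emb_mult[of i x "inverse x"] by simp
  then show ?thesis by (metis inverse_unique)
qed simp

lemma emb_divide [simp]: "emb i (x / y) = emb i x / emb i y"
  by (simp add: divide_inverse)

lemma emb_power [simp]: "emb i (x ^ k) = emb i x ^ k"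
  by (induction k) auto

lemma emb_sum [simp]: "emb i (sum f A) = (\<Sum>x\<in>A. emb i (f x))"
  by (induction A rule: infinite_finite_induct) auto

lemma emb_of_nat [simp]: "emb i (of_nat k) = of_nat k"
  by (induction k) auto

lemma emb_of_int [simp]: "emb i (of_int k) = of_int k"
  by (cases k rule: int_cases2) auto

lemma emb_of_rat [simp]: "emb i (of_rat q) = of_rat q"
proof (cases q)
  case (Fract a b)
  then show ?thesis by (simp add: of_rat_rat)
qed

lemma emb_vec_nth [simp]: "emb_vec emb x $ i = emb i x"
  by (simp add: emb_vec_def)

lemma emb_vec_add: "emb_vec emb (x + y) = emb_vec emb x + emb_vec emb y"
  by (simp add: vec_eq_iff)

lemma emb_vec_scale: "emb_vec emb (of_rat q * x) = of_rat q *\<^sub>R emb_vec emb x"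
  by (simp add: vec_eq_iff)

lemma emb_vec_sum: "emb_vec emb (sum f A) = (\<Sum>x\<in>A. emb_vec emb (f x))"
  by (simp add: vec_eq_iff)

lemma emb_vec_inj [simp]: "inj_on (emb_vec emb) A"
  by (auto simp: inj_on_def vec_eq_iff)

lemma emb_vec_eq_0_iff [simp]: "emb_vec emb x = 0 \<longleftrightarrow> x = 0"
  by (auto simp: vec_eq_iff)

lemma totally_positive_combination:
  "totally_positive emb u \<Longrightarrow> totally_positive emb v \<Longrightarrow> 0 < a \<Longrightarrow> 0 < b \<Longrightarrow>
    totally_positive emb (of_rat a * u + of_rat b * v)"
  by (auto simp: totally_positive_def intro!: add_pos_pos)

text \<open>Dedekind's argument: evaluate a relation at y x and subtract \<open>emb k y\<close>
  times the relation at x. The embedding k disappears, and the coefficient of j is multiplied by a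
  nonzero number if y separates j from k.\<close>

lemma embeddings_independent:
  assumes "finite S" "\<And>x. (\<Sum>i\<in>S. c i * emb i x) = 0" "i \<in> S"
  shows "c i = 0"
  using assms
proof (induction S arbitrary: c i rule: finite_induct)
  case (insert k S)
  have "c j = 0" if j: "j \<in> S" for j
  proof -
    obtain y where y: "emb j y \<noteq> emb k y"
    proof -
      have "emb j \<noteq> emb k" using real_emb j insert.hyps(2)
        unfolding real_embeddings_def bij_betw_def inj_def by blast
      then show ?thesis using that by (auto simp: fun_eq_iff)
    qed
    have "(\<Sum>i\<in>S. (c i * (emb i y - emb k y)) * emb i x) = 0" for x
    proof -
      have "(\<Sum>i\<in>S. (c i * (emb i y - emb k y)) * emb i x) = (\<Sum>i\<in>insert k S. (c i * (emb i y - emb k y)) * emb i x)"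
        using insert.hyps by simp
      also have "\<dots> = (\<Sum>i\<in>insert k S. c i * emb i (y * x)) - emb k y * (\<Sum>i\<in>insert k S. c i * emb i x)"
        by (simp only: sum_distrib_left sum_subtractf[symmetric] emb_mult) (simp only: algebra_simps)
      also have "\<dots> = 0" unfolding insert.prems(1) by simp
      finally show ?thesis .
    qed
    from insert.IH[OF this j] show ?thesis using y by simp
  qed
  moreover from this have "c k = 0" using insert.prems(1)[of 1] insert.hyps by simp
  ultimately show ?case using insert.prems(2) by auto
qed auto

text \<open>A vector orthogonal to the images of a spanning set would be a linear relation between
  the embeddings.\<close>

lemma span_emb_basis:
  assumes "Q.span B = UNIV"
  shows "span (emb_vec emb ` B) = UNIV"
proof (rule ccontr)
  assume "span (emb_vec emb ` B) \<noteq> UNIV"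
  then obtain a where a: "a \<noteq> 0" "\<And>v. v \<in> span (emb_vec emb ` B) \<Longrightarrow> a \<bullet> v = 0"
    using span_not_UNIV_orthogonal by blast
  have sp: "emb_vec emb x \<in> span (emb_vec emb ` B)" for x
  proof -
    have "x \<in> Q.span B" using assms by simp
    then show ?thesis
    proof (induction rule: Q.span_induct_alt)
      case base
      have "emb_vec emb (0 :: 'a) = 0" by simp
      then show ?case by (metis span_zero)
    next
      case (step q x y)
      then show ?case
        unfolding rat_scale_def emb_vec_add emb_vec_scale
        by (intro span_add span_scale) (auto intro: span_base)
    qed
  qed
  have "(\<Sum>i\<in>UNIV. a $ i * emb i x) = 0" for x
    using a(2)[OF sp[of x]] by (simp add: inner_vec_def)
  then have "a $ i = 0" for i using embeddings_independent[of UNIV "($) a" i] by simp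
  then show False using a(1) by (simp add: vec_eq_iff)
qed

text \<open>A rational basis has n elements and its image spans a real space of dimension n, so this
  image is a real basis. All comparison of rational with real coordinates rests on this.\<close>

lemma rat_basis_extend:
  assumes "Q.independent W"
  obtains B where "W \<subseteq> B" "finite B" "Q.independent B" "Q.span B = UNIV" "independent (emb_vec emb ` B)"
proof -
  obtain B where B: "W \<subseteq> B" "Q.independent B" "UNIV \<subseteq> Q.span B"
    using Q.maximal_independent_subset_extend[OF subset_UNIV assms] by metis
  obtain B0 :: "'a set" where B0: "finite B0" "Q.span B0 = UNIV"
    using field unfolding totally_real_number_field_def by blast
  have fin: "finite B" using Q.independent_span_bound[OF B0(1) B(2)] B0 by simp
  have "card B = Q.dim (UNIV :: 'a set)" by (rule Q.basis_card_eq_dim[OF subset_UNIV B(3,2)])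
  then have card: "card B = CARD('n)" using field unfolding totally_real_number_field_def by simp
  have sp: "Q.span B = UNIV" using B by auto
  have "independent (emb_vec emb ` B)"
  proof (rule card_le_dim_spanning[of _ UNIV])
    show "UNIV \<subseteq> span (emb_vec emb ` B)" using span_emb_basis[OF sp] by simp
    show "card (emb_vec emb ` B) \<le> dim (UNIV :: (real ^ 'n) set)"
      using card by (simp add: card_image)
  qed (use fin in auto)
  then show ?thesis using that B fin sp by blast
qed

lemma rat_independent_if_real_independent:
  assumes "finite W" "independent (emb_vec emb ` W)"
  shows "Q.independent W"
proof
  assume "Q.dependent W"
  then obtain u where u: "\<exists>v\<in>W. u v \<noteq> 0" "(\<Sum>v\<in>W. rat_scale (u v) v) = 0"
    using Q.dependent_finite[OF assms(1)] by auto
  define u' where "u' = (\<lambda>y. of_rat (u (inv_into W (emb_vec emb) y)) :: real)"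
  have u': "u' (emb_vec emb v) = of_rat (u v)" if "v \<in> W" for v
    using that by (simp add: u'_def inv_into_f_f)
  have "(\<Sum>y\<in>emb_vec emb ` W. u' y *\<^sub>R y) = (\<Sum>v\<in>W. of_rat (u v) *\<^sub>R emb_vec emb v)"
    by (subst sum.reindex) (auto simp: u')
  also have "\<dots> = emb_vec emb (\<Sum>v\<in>W. rat_scale (u v) v)"
    by (simp add: emb_vec_sum emb_vec_scale rat_scale_def)
  also have "\<dots> = 0" unfolding u(2) by simp
  finally have "dependent (emb_vec emb ` W)"
    unfolding dependent_finite[OF finite_imageI[OF assms(1)]] using u(1) u' by (auto intro!: exI[of _ u'])
  then show False using assms by simp
qed

text \<open>After extension of W to a rational basis whose image is a real basis, x has rational
  coordinates, and uniqueness of real coordinates equates them with the given ones.\<close>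

lemma rat_coefficients:
  assumes W: "finite W" "independent (emb_vec emb ` W)"
    and x: "emb_vec emb x = (\<Sum>w\<in>W. r w *\<^sub>R emb_vec emb w)"
  obtains q where "x = (\<Sum>w\<in>W. of_rat (q w) * w)" "\<And>w. w \<in> W \<Longrightarrow> r w = of_rat (q w)"
proof -
  obtain B where B: "W \<subseteq> B" "finite B" "Q.span B = UNIV" "independent (emb_vec emb ` B)"
    using rat_basis_extend[OF rat_independent_if_real_independent[OF W]] by metis
  have "x \<in> Q.span B" using B by simp
  then obtain q where q: "x = (\<Sum>b\<in>B. of_rat (q b) * b)"
    unfolding Q.span_finite[OF B(2)] by (auto simp: rat_scale_def)
  define r' where "r' = (\<lambda>b. if b \<in> W then r b else 0)"
  define c where "c = (\<lambda>y. (\<lambda>b. of_rat (q b) - r' b) (inv_into B (emb_vec emb) y))"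
  have c: "c (emb_vec emb b) = of_rat (q b) - r' b" if "b \<in> B" for b
    using that by (simp add: c_def inv_into_f_f)
  have "(\<Sum>y\<in>emb_vec emb ` B. c y *\<^sub>R y) = (\<Sum>b\<in>B. (of_rat (q b) - r' b) *\<^sub>R emb_vec emb b)"
    by (subst sum.reindex) (auto simp: c)
  also have "\<dots> = (\<Sum>b\<in>B. of_rat (q b) *\<^sub>R emb_vec emb b) - (\<Sum>b\<in>B. r' b *\<^sub>R emb_vec emb b)"
    by (simp add: scaleR_diff_left sum_subtractf)
  also have "(\<Sum>b\<in>B. of_rat (q b) *\<^sub>R emb_vec emb b) = emb_vec emb x"
    unfolding q by (simp add: emb_vec_sum emb_vec_scale)
  also have "(\<Sum>b\<in>B. r' b *\<^sub>R emb_vec emb b) = (\<Sum>b\<in>W. r' b *\<^sub>R emb_vec emb b)"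
    by (rule sum.mono_neutral_right) (use B in \<open>auto simp: r'_def\<close>)
  also have "\<dots> = emb_vec emb x" unfolding x by (simp add: r'_def)
  finally have z: "(\<Sum>y\<in>emb_vec emb ` B. c y *\<^sub>R y) = 0" by simp
  have eq: "of_rat (q b) = r' b" if "b \<in> B" for b
    using independentD[OF B(4) finite_imageI[OF B(2)] order_refl z, of "emb_vec emb b"] c[OF that] that by simp
  have "q b = 0" if "b \<in> B - W" for b using eq[of b] that by (simp add: r'_def)
  then have "x = (\<Sum>b\<in>W. of_rat (q b) * b)"
    unfolding q by (intro sum.mono_neutral_right) (use B in auto)
  moreover have "r w = of_rat (q w)" if "w \<in> W" for w using eq[of w] that B by (auto simp: r'_def)
  ultimately show ?thesis using that by blast
qed

text \<open>The predicate P on coefficients allows one argument for both open cones and half-open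
  boxes.\<close>

lemma emb_rat_combination_iff:
  assumes W: "finite W" "independent (emb_vec emb ` W)"
  shows "(\<exists>r. (\<forall>v\<in>emb_vec emb ` W. P (r v)) \<and> emb_vec emb x = (\<Sum>v\<in>emb_vec emb ` W. r v *\<^sub>R v)) \<longleftrightarrow>
    (\<exists>q. (\<forall>w\<in>W. P (of_rat (q w))) \<and> x = (\<Sum>w\<in>W. of_rat (q w) * w))"
proof
  assume "\<exists>r. (\<forall>v\<in>emb_vec emb ` W. P (r v)) \<and> emb_vec emb x = (\<Sum>v\<in>emb_vec emb ` W. r v *\<^sub>R v)"
  then obtain r where r: "\<forall>w\<in>W. P (r (emb_vec emb w))" "emb_vec emb x = (\<Sum>v\<in>emb_vec emb ` W. r v *\<^sub>R v)"
    by auto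
  have eq: "emb_vec emb x = (\<Sum>w\<in>W. r (emb_vec emb w) *\<^sub>R emb_vec emb w)"
    unfolding r(2) by (subst sum.reindex) auto
  obtain q where q: "x = (\<Sum>w\<in>W. of_rat (q w) * w)" "\<And>w. w \<in> W \<Longrightarrow> r (emb_vec emb w) = of_rat (q w)"
    by (rule rat_coefficients[OF W eq]) blast
  have "\<forall>w\<in>W. P (of_rat (q w))" using r(1) q(2) by simp
  then show "\<exists>q. (\<forall>w\<in>W. P (of_rat (q w))) \<and> x = (\<Sum>w\<in>W. of_rat (q w) * w)" using q(1) by blast
next
  assume "\<exists>q. (\<forall>w\<in>W. P (of_rat (q w))) \<and> x = (\<Sum>w\<in>W. of_rat (q w) * w)"
  then obtain q where q: "\<forall>w\<in>W. P (of_rat (q w))" "x = (\<Sum>w\<in>W. of_rat (q w) * w)" by blast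
  define r where "r = (\<lambda>v. of_rat (q (inv_into W (emb_vec emb) v)) :: real)"
  have r: "r (emb_vec emb w) = of_rat (q w)" if "w \<in> W" for w
    using that by (simp add: r_def inv_into_f_f)
  have "emb_vec emb x = (\<Sum>w\<in>W. r (emb_vec emb w) *\<^sub>R emb_vec emb w)"
    unfolding q(2) by (simp add: emb_vec_sum emb_vec_scale r)
  also have "\<dots> = (\<Sum>v\<in>emb_vec emb ` W. r v *\<^sub>R v)" by (subst sum.reindex) auto
  finally show "\<exists>r. (\<forall>v\<in>emb_vec emb ` W. P (r v)) \<and> emb_vec emb x = (\<Sum>v\<in>emb_vec emb ` W. r v *\<^sub>R v)"
    using q(1) r by (intro exI[of _ r]) auto
qed

lemma emb_open_cone_iff:
  assumes W: "finite W" "independent (emb_vec emb ` W)"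
  shows "emb_vec emb x \<in> open_cone (emb_vec emb ` W) \<longleftrightarrow> x \<in> qcone W"
  using emb_rat_combination_iff[OF W, of "\<lambda>r. 0 < r" x] unfolding open_cone_def qcone_def zero_less_of_rat_iff by blast

definition qbox :: "'a set \<Rightarrow> 'a set" where
  "qbox W = {\<Sum>w\<in>W. of_rat (q w) * w | q. \<forall>w\<in>W. 0 < q w \<and> q w \<le> 1}"

lemma emb_parallelepiped_iff:
  assumes W: "finite W" "independent (emb_vec emb ` W)"
  shows "emb_vec emb x \<in> half_open_parallelepiped (emb_vec emb ` W) \<longleftrightarrow> x \<in> qbox W"
  using emb_rat_combination_iff[OF W, of "\<lambda>r. 0 < r \<and> r \<le> 1" x]
  unfolding half_open_parallelepiped_def qbox_def zero_less_of_rat_iff of_rat_le_1_iff by blast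

section \<open>Discreteness of the algebraic integers under the real embeddings\<close>

abbreviation (input) OF :: "'a set" where "OF \<equiv> carrier ring_of_integers"

lemma OF_iff: "x \<in> OF \<longleftrightarrow> algebraic_int x"
  by (simp add: ring_of_integers_def)

lemma OF_add [intro]: "x \<in> OF \<Longrightarrow> y \<in> OF \<Longrightarrow> x + y \<in> OF"
  and OF_mult [intro]: "x \<in> OF \<Longrightarrow> y \<in> OF \<Longrightarrow> x * y \<in> OF"
proof -
  interpret R: ring "ring_of_integers :: 'a ring" by (rule ring_int)
  show "x \<in> OF \<Longrightarrow> y \<in> OF \<Longrightarrow> x + y \<in> OF" using R.add.m_closed[of x y] by (simp add: ring_of_integers_def)
  show "x \<in> OF \<Longrightarrow> y \<in> OF \<Longrightarrow> x * y \<in> OF" using R.m_closed[of x y] by (simp add: ring_of_integers_def)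
qed

lemma OF_0 [intro, simp]: "0 \<in> OF" and OF_1 [intro, simp]: "1 \<in> OF"
  by (auto simp: OF_iff intro: int_imp_algebraic_int)

lemma OF_minus [intro]: "x \<in> OF \<Longrightarrow> - x \<in> OF"
  by (simp add: OF_iff)

lemma OF_diff [intro]: "x \<in> OF \<Longrightarrow> y \<in> OF \<Longrightarrow> x - y \<in> OF"
  using OF_add[of x "- y"] by auto

lemma common_denominator:
  assumes "finite (S :: rat set)"
  shows "\<exists>N::nat. N > 0 \<and> (\<forall>q\<in>S. of_nat N * q \<in> \<int>)"
  using assms
proof induction
  case (insert q S)
  then obtain N where N: "N > 0" "\<forall>q\<in>S. of_nat N * q \<in> \<int>" by auto
  obtain a b where ab: "q = Fract a b" "b > 0" by (cases q) auto
  have "of_nat (nat b) * q = of_int a" using ab by (simp add: Fract_of_int_quotient)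
  then have "of_nat (nat b * N) * q = of_nat N * of_int a" by (simp add: mult_ac)
  then have "of_nat (nat b * N) * q \<in> \<int>" by (metis Ints_mult Ints_of_int Ints_of_nat)
  moreover have "of_nat (nat b * N) * p \<in> \<int>" if "p \<in> S" for p
    using N(2) that by (simp add: mult.assoc)
  ultimately show ?case using N ab by (intro exI[of _ "nat b * N"]) auto
qed auto

text \<open>The powers of \<open>x\<close> have bounded denominators with respect to a rational basis, so they cannot
  tend to \<open>0\<close> unless they vanish eventually.\<close>
lemma integer_embedding_ge_1:
  assumes x: "x \<in> OF" "x \<noteq> 0"
  shows "\<exists>i. \<bar>emb i x\<bar> \<ge> 1"
proof (rule ccontr)
  assume "\<nexists>i. \<bar>emb i x\<bar> \<ge> 1"
  then have small: "\<bar>emb i x\<bar> < 1" for i by (simp add: not_le)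
  obtain p where p: "lead_coeff p = 1" "\<forall>i. coeff p i \<in> \<int>" "poly p x = 0"
    using x(1) unfolding OF_iff by (auto elim: algebraic_int.cases)
  define m where "m = degree p"
  \<comment> \<open>The monic equation expresses a power by the m preceding ones with integer
    coefficients.\<close>
  have rec: "x ^ (k + m) = - (\<Sum>j<m. coeff p j * x ^ (k + j))" for k
  proof -
    have "0 = x ^ k * (\<Sum>j\<le>m. coeff p j * x ^ j)" using p(3) by (simp add: poly_altdef m_def)
    also have "\<dots> = x ^ k * ((\<Sum>j<m. coeff p j * x ^ j) + x ^ m)"
      using p(1) by (simp add: lessThan_Suc_atMost[symmetric] m_def)
    finally show ?thesis by (simp add: power_add ring_distribs sum_distrib_left mult_ac add_eq_0_iff)
  qed
  obtain B :: "'a set" where B: "finite B" "Q.independent B" "Q.span B = UNIV" "independent (emb_vec emb ` B)"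
    using rat_basis_extend[OF Q.independent_empty] by metis
  define co where "co = (\<lambda>b y. Q.representation B y b)"
  have co_add: "co b (y + z) = co b y + co b z" for b y z
    unfolding co_def using Q.representation_add[OF B(2), of z y] B(3) by simp
  have co_scale: "co b (of_rat q * y) = q * co b y" for b y q
    unfolding co_def using Q.representation_scale[OF B(2), of y q] B(3) by (simp add: rat_scale_def)
  have co_fun: "rat_functional (co b)" for b using co_add co_scale by (simp add: rat_functional_def)
  have co_sum: "co b (\<Sum>j<k. of_rat (q j) * f j) = (\<Sum>j<k. q j * co b (f j))" for b q f and k :: nat
  proof (induction k)
    case 0
    have "co b 0 = 0" using co_scale[of b 0 0] by simp
    then show ?case by simp
  qed (simp add: co_add co_scale)
  have expand: "y = (\<Sum>b\<in>B. of_rat (co b y) * b)" for y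
    using Q.sum_representation_eq[OF B(2) _ B(1), of y] B(3) by (simp add: co_def rat_scale_def)
  obtain N :: nat where N: "N > 0" "\<forall>q\<in>(\<lambda>(b, j). co b (x ^ j)) ` (B \<times> {..<m}). of_nat N * q \<in> \<int>"
    using common_denominator[of "(\<lambda>(b, j). co b (x ^ j)) ` (B \<times> {..<m})"] B(1) by auto
  \<comment> \<open>N clears the denominators of the first m powers; the recursion has integer
    coefficients and therefore needs no further denominator.\<close>
  have int: "of_nat N * co b (x ^ k) \<in> \<int>" if "b \<in> B" for b k
  proof (induction k rule: less_induct)
    case (less k)
    show ?case
    proof (cases "k < m")
      case True
      then show ?thesis using N(2) that by force
    next
      case False
      define l where "l = k - m"
      have k: "k = l + m" using False by (simp add: l_def)
      have "\<forall>j. \<exists>a. coeff p j = of_int a" using p(2) Ints_cases by metis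
      then obtain a where a: "\<And>j. coeff p j = of_int (a j)" by (metis choice_iff)
      have "x ^ k = (\<Sum>j<m. of_rat (- of_int (a j)) * x ^ (l + j))"
        unfolding k rec a by (simp add: sum_negf of_rat_minus)
      then have "of_nat N * co b (x ^ k) = (\<Sum>j<m. - of_int (a j) * (of_nat N * co b (x ^ (l + j))))"
        by (simp only: co_sum) (simp add: sum_distrib_left mult_ac)
      also have "\<dots> \<in> \<int>"
      proof (rule Ints_sum)
        fix j assume "j \<in> {..<m}"
        then have "of_nat N * co b (x ^ (l + j)) \<in> \<int>" by (intro less.IH) (simp add: k)
        then show "- of_int (a j) * (of_nat N * co b (x ^ (l + j))) \<in> \<int>"
          by (rule Ints_mult[OF Ints_minus[OF Ints_of_int]])
      qed
      finally show ?thesis .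
    qed
  qed
  have lim: "(\<lambda>k. emb_vec emb (x ^ k)) \<longlonglongrightarrow> 0"
  proof (rule vec_tendstoI)
    fix i
    have "(\<lambda>k. emb i x ^ k) \<longlonglongrightarrow> 0" using small[of i] by (intro LIMSEQ_power_zero) simp
    then show "(\<lambda>k. emb_vec emb (x ^ k) $ i) \<longlonglongrightarrow> 0 $ i" by simp
  qed
  have "eventually (\<lambda>k. co b (x ^ k) = 0) sequentially" if b: "b \<in> B" for b
  proof -
    \<comment> \<open>The coordinate along b extends to a linear, hence continuous, form on the real
      space. So the coordinates of the powers tend to 0, while N times them are integers.\<close>
    obtain g where g: "linear g" "\<And>v. v \<in> emb_vec emb ` B \<Longrightarrow> g v = (if v = emb_vec emb b then 1 else (0::real))"
      using linear_independent_extend[OF B(4), of "\<lambda>v. if v = emb_vec emb b then 1 else 0"] by auto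
    have gx: "g (emb_vec emb y) = of_rat (co b y)" for y
    proof -
      have "g (emb_vec emb y) = g (\<Sum>c\<in>B. of_rat (co c y) *\<^sub>R emb_vec emb c)"
        by (subst expand[of y]) (simp add: emb_vec_sum emb_vec_scale)
      also have "\<dots> = (\<Sum>c\<in>B. of_rat (co c y) * (if c = b then 1 else 0))"
      proof -
        have "g (of_rat (co c y) *\<^sub>R emb_vec emb c) = of_rat (co c y) * (if c = b then 1 else 0)" if "c \<in> B" for c
        proof -
          have "emb_vec emb c = emb_vec emb b \<longleftrightarrow> c = b" using inj_on_eq_iff[OF emb_vec_inj[of UNIV]] by simp
          then show ?thesis using g(2)[of "emb_vec emb c"] that by (simp add: linear_scale[OF g(1)])
        qed
        then show ?thesis unfolding linear_sum[OF g(1)] by (rule sum.cong[OF refl])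
      qed
      also have "\<dots> = (\<Sum>c\<in>B. if c = b then of_rat (co c y) else 0)" by (rule sum.cong) auto
      also have "\<dots> = of_rat (co b y)" using b B(1) by (subst sum.delta) auto
      finally show ?thesis .
    qed
    have "bounded_linear g" using g(1) by (simp add: linear_conv_bounded_linear)
    from bounded_linear.tendsto[OF this lim] have "(\<lambda>k. of_rat (co b (x ^ k)) :: real) \<longlonglongrightarrow> 0"
      using linear_0[OF g(1)] by (simp add: gx)
    then have "(\<lambda>k. real N * of_rat (co b (x ^ k))) \<longlonglongrightarrow> real N * 0" by (intro tendsto_intros)
    from tendstoD[OF this zero_less_one]
    have "eventually (\<lambda>k. \<bar>real N * of_rat (co b (x ^ k))\<bar> < 1) sequentially"
      by (simp add: dist_real_def)
    then show ?thesis
    proof eventually_elim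
      case (elim k)
      obtain c :: int where c: "of_nat N * co b (x ^ k) = of_int c" using int[OF b, of k] unfolding Ints_def by blast
      have "real_of_int c = of_rat (of_nat N * co b (x ^ k))" unfolding c by simp
      also have "\<dots> = real N * of_rat (co b (x ^ k))" by (simp add: of_rat_mult)
      finally have "real_of_int c = real N * of_rat (co b (x ^ k))" .
      then have "c = 0" using elim by linarith
      then show "co b (x ^ k) = 0" using c N by simp
    qed
  qed
  then have "eventually (\<lambda>k. \<forall>b\<in>B. co b (x ^ k) = 0) sequentially"
    using B(1) by (simp add: eventually_ball_finite)
  then obtain k where k: "\<forall>b\<in>B. co b (x ^ k) = 0" by (auto simp: eventually_sequentially)
  have "x ^ k = (\<Sum>b\<in>B. of_rat (co b (x ^ k)) * b)" by (rule expand)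
  also have "\<dots> = 0" using k by simp
  finally have "x ^ k = 0" .
  then show False using x by simp
qed

text \<open>Pigeonhole: if two elements fall into the same cell of a fine enough grid, their
  difference is c times an integer all of whose embeddings are smaller than 1 in absolute value, so
  it is 0. A bounded region meets finitely many cells.\<close>

lemma finite_bounded_embeddings:
  assumes c: "c \<noteq> 0" and S: "\<And>x y. x \<in> S \<Longrightarrow> y \<in> S \<Longrightarrow> \<exists>a\<in>OF. x - y = c * a"
    and bd: "\<And>x i. x \<in> S \<Longrightarrow> \<bar>emb i x\<bar> \<le> M"
  shows "finite S"
proof -
  \<comment> \<open>The grid has mesh 1 / K, which is at most the absolute value of every embedding
    of c.\<close>
  define K where "K = Max (range (\<lambda>i. 1 / \<bar>emb i c\<bar>))"
  have K: "1 / \<bar>emb i c\<bar> \<le> K" for i unfolding K_def by (intro Max_ge) auto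
  have K0: "K > 0" using K[of undefined] c by (smt (verit) emb_eq_0_iff zero_less_divide_1_iff zero_less_abs_iff)
  define f where "f = (\<lambda>x i. \<lfloor>K * emb i x\<rfloor>)"
  have "inj_on f S"
  proof (rule inj_onI)
    fix x y assume xy: "x \<in> S" "y \<in> S" "f x = f y"
    obtain a where a: "a \<in> OF" "x - y = c * a" using S[OF xy(1,2)] by auto
    have "\<bar>emb i a\<bar> < 1" for i
    proof -
      have "\<lfloor>K * emb i x\<rfloor> = \<lfloor>K * emb i y\<rfloor>" using xy(3) by (simp add: f_def fun_eq_iff)
      then have "\<bar>K * emb i x - K * emb i y\<bar> < 1" by linarith
      also have "K * emb i x - K * emb i y = K * emb i (x - y)" by (simp add: ring_distribs)
      also have "\<dots> = K * (emb i c * emb i a)" unfolding a(2) by simp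
      finally have "K * \<bar>emb i c\<bar> * \<bar>emb i a\<bar> < 1" using K0 by (simp add: abs_mult mult.assoc)
      moreover have "1 \<le> K * \<bar>emb i c\<bar>" using K[of i] c by (simp add: divide_le_eq)
      then have "1 * \<bar>emb i a\<bar> \<le> K * \<bar>emb i c\<bar> * \<bar>emb i a\<bar>" by (intro mult_right_mono) auto
      ultimately show ?thesis by linarith
    qed
    then have "a = 0" using integer_embedding_ge_1[OF a(1)] by (meson not_le)
    then show "x = y" using a(2) by simp
  qed
  moreover define L where "L = \<lceil>K * M\<rceil> + 1"
  have "finite (f ` S)"
  proof (rule finite_subset)
    show "f ` S \<subseteq> PiE UNIV (\<lambda>_. {- L..L})"
    proof (rule subsetI)
      fix g assume "g \<in> f ` S"
      then obtain x where x: "x \<in> S" "g = f x" by blast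
      have "- L \<le> f x i \<and> f x i \<le> L" for i
      proof -
        have "K * \<bar>emb i x\<bar> \<le> K * M" using bd[OF x(1)] K0 by (intro mult_left_mono) auto
        then have "\<bar>K * emb i x\<bar> \<le> K * M" using K0 by (simp add: abs_mult)
        then show ?thesis unfolding f_def L_def by linarith
      qed
      then show "g \<in> PiE UNIV (\<lambda>_. {- L..L})" unfolding x(2) by (simp add: PiE_UNIV_domain)
    qed
    show "finite (PiE UNIV (\<lambda>_::'n. {- L..L}))" by (intro finite_PiE) auto
  qed
  ultimately show ?thesis using finite_imageD by blast
qed

text \<open>Some embedding of the integer \<open>inverse u\<close> is at least 1, so some embedding
  of u is at most 1; the ratio bound then bounds all embeddings of u.\<close>

lemma finite_units_bounded_ratio:
  assumes E: "\<And>u. u \<in> E \<Longrightarrow> u \<in> OF \<and> inverse u \<in> OF \<and> totally_positive emb u"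
    and ratio: "\<And>u i j. u \<in> E \<Longrightarrow> emb i u \<le> C * emb j u"
  shows "finite E"
proof (rule finite_bounded_embeddings[of 1 _ "max C 0"])
  fix u i assume u: "u \<in> E"
  have "u \<noteq> 0" using E[OF u] unfolding totally_positive_def by (metis emb_0 less_irrefl)
  then obtain j where j: "\<bar>emb j (inverse u)\<bar> \<ge> 1"
    using integer_embedding_ge_1[of "inverse u"] E[OF u] by auto
  have pos: "emb k u > 0" for k using E[OF u] by (simp add: totally_positive_def)
  have "emb j u \<le> 1" using j pos[of j] by (simp add: inverse_eq_divide le_divide_eq)
  have "emb i u \<le> C * emb j u" by (rule ratio[OF u])
  moreover have "C > 0" using ratio[OF u, of j j] pos[of j] by (metis less_le_trans zero_less_mult_pos2)
  then have "C * emb j u \<le> C * 1" using \<open>emb j u \<le> 1\<close> by (intro mult_left_mono) auto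
  ultimately show "\<bar>emb i u\<bar> \<le> max C 0" using pos[of i] by simp
qed (use E in auto)

section \<open>The number attached to a set of field elements\<close>

definition has_value :: "'n \<Rightarrow> 'a set \<Rightarrow> complex \<Rightarrow> bool" where
  "has_value i A v \<longleftrightarrow> (\<exists>P. barnes_adm_list P \<and> xi_deriv_sum P = v \<and>
     (\<forall>t>0. ((\<lambda>x. exp (- emb i x * t)) has_sum barnes_sum barnes_gf P t) A))"

text \<open>Two families that describe the same set have the same generating function, because both
  represent the sum over the set. This is what makes the value depend on the set alone and not on
  generators.\<close>

lemma has_value_unique: "has_value i A v \<Longrightarrow> has_value i A v' \<Longrightarrow> v = v'"
  unfolding has_value_def using xi_deriv_sum_eqI has_sum_unique by metis

lemma has_value_empty: "has_value i {} 0"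
  unfolding has_value_def by (intro exI[of _ "[]"]) (auto simp: barnes_adm_list_def xi_deriv_sum_def barnes_sum_def)

lemma has_value_Un:
  assumes "has_value i A v" "has_value i B w" "A \<inter> B = {}"
  shows "has_value i (A \<union> B) (v + w)"
proof -
  obtain P Q where
    "barnes_adm_list P" "xi_deriv_sum P = v" "\<And>t. t > 0 \<Longrightarrow> ((\<lambda>x. exp (- emb i x * t)) has_sum barnes_sum barnes_gf P t) A"
    "barnes_adm_list Q" "xi_deriv_sum Q = w" "\<And>t. t > 0 \<Longrightarrow> ((\<lambda>x. exp (- emb i x * t)) has_sum barnes_sum barnes_gf Q t) B"
    using assms(1,2) unfolding has_value_def by blast
  then show ?thesis unfolding has_value_def
    by (intro exI[of _ "P @ Q"]) (auto simp: barnes_adm_list_def xi_deriv_sum_def barnes_sum_def intro!: has_sum_Un_disjoint assms)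
qed

lemma has_value_UN:
  assumes "finite I" "\<And>k. k \<in> I \<Longrightarrow> has_value i (A k) (v k)" "\<And>k l. k \<in> I \<Longrightarrow> l \<in> I \<Longrightarrow> k \<noteq> l \<Longrightarrow> A k \<inter> A l = {}"
  shows "has_value i (\<Union>k\<in>I. A k) (\<Sum>k\<in>I. v k)"
  using assms
proof (induction I rule: finite_induct)
  case (insert k I)
  have "A k \<inter> (\<Union>l\<in>I. A l) = {}" using insert.prems(2)[of k] insert.hyps(2) by blast
  then show ?case using insert by (simp add: has_value_Un)
qed (simp add: has_value_empty)

text \<open>Multiplication by c replaces t by \<open>emb i c * t\<close> in the generating function.
  The same family, scaled by \<open>emb i c\<close>, describes the new set, and scaling does not
  change the derivatives at 0.\<close>

lemma has_value_scale:
  assumes v: "has_value i A v" and c: "emb i c > 0"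
  shows "has_value i ((\<lambda>x. c * x) ` A) v"
proof -
  obtain P where P: "barnes_adm_list P" "xi_deriv_sum P = v" "\<And>t. t > 0 \<Longrightarrow> ((\<lambda>x. exp (- emb i x * t)) has_sum barnes_sum barnes_gf P t) A"
    using v unfolding has_value_def by blast
  let ?c = "emb i c"
  define P' where "P' = map (\<lambda>(w, ws). (?c * w, map ((*) ?c) ws)) P"
  have "barnes_adm_list P'" using P(1) c
    by (auto simp: P'_def barnes_adm_list_def intro!: barnes_admissible_scale)
  moreover have "xi_deriv_sum P' = v"
    unfolding P(2)[symmetric] xi_deriv_sum_def P'_def map_map
    by (rule arg_cong[where f = sum_list], rule map_cong) (use P(1) c in \<open>auto simp: barnes_adm_list_def deriv_barnes_xi_scale\<close>)
  moreover have "((\<lambda>x. exp (- emb i x * t)) has_sum barnes_sum barnes_gf P' t) ((\<lambda>x. c * x) ` A)" if t: "t > 0" for t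
  proof -
    have "c \<noteq> 0" using c by auto
    then have inj: "inj_on (\<lambda>x. c * x) A" by (auto simp: inj_on_def)
    have gf: "barnes_gf (?c * w) (map ((*) ?c) ws) t = barnes_gf w ws (?c * t)" for w ws
      by (simp add: barnes_gf_def o_def mult_ac)
    have "barnes_sum barnes_gf P' t = barnes_sum barnes_gf P (?c * t)"
      by (simp add: barnes_sum_def P'_def o_def case_prod_unfold gf)
    then show ?thesis unfolding has_sum_reindex[OF inj] using P(3)[of "?c * t"] c t by (simp add: o_def mult_ac)
  qed
  ultimately show ?thesis unfolding has_value_def by blast
qed

lemma rat_independent_list:
  assumes gs: "distinct gs" "Q.independent (set gs)"
    and eq: "(\<Sum>j<length gs. of_rat (a j) * gs ! j) = (\<Sum>j<length gs. of_rat (b j) * gs ! j)" and j: "j < length gs"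
  shows "a j = b j"
proof -
  let ?I = "{..<length gs}"
  have bij: "bij_betw ((!) gs) ?I (set gs)" by (rule bij_betw_nth[OF gs(1)]) auto
  define u where "u = (\<lambda>w. a (the_inv_into ?I ((!) gs) w) - b (the_inv_into ?I ((!) gs) w))"
  have u: "u (gs ! k) = a k - b k" if "k < length gs" for k
    using that bij by (simp add: u_def bij_betw_def the_inv_into_f_f)
  have "(\<Sum>w\<in>set gs. rat_scale (u w) w) = (\<Sum>k<length gs. rat_scale (u (gs ! k)) (gs ! k))"
    by (rule sum.reindex_bij_betw[OF bij, symmetric])
  also have "\<dots> = (\<Sum>k<length gs. of_rat (a k) * gs ! k - of_rat (b k) * gs ! k)"
    by (rule sum.cong) (auto simp: u rat_scale_def of_rat_diff algebra_simps)
  also have "\<dots> = 0" using eq by (simp add: sum_subtractf)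
  finally have "u (gs ! j) = 0"
    using Q.independentD[OF gs(2) finite_set order_refl] j by auto
  then show ?thesis using u[OF j] by simp
qed

text \<open>The properties of L = z + \<bb> and \<bb> on which the evaluation of cones rests.
  Disjointness keeps the far corner of a box out of L, the differences in c times the integers give
  finiteness of the box points, and the multiples in b allow cone generators to be moved into the
  lattice.\<close>

definition lattice_coset :: "'a set \<Rightarrow> 'a set \<Rightarrow> bool" where
  "lattice_coset L b \<longleftrightarrow> 0 \<in> b \<and> (\<forall>x\<in>b. \<forall>y\<in>b. x + y \<in> b) \<and> (\<forall>x\<in>b. - x \<in> b) \<and>
     (\<forall>x\<in>L. \<forall>y\<in>b. x + y \<in> L) \<and> L \<inter> b = {} \<and>
     (\<exists>c. c \<noteq> 0 \<and> (\<forall>x\<in>L. \<forall>y\<in>L. \<exists>a\<in>OF. x - y = c * a)) \<and>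
     (\<forall>x. \<exists>N::nat. N > 0 \<and> of_nat N * x \<in> b)"

lemma lattice_coset_sum:
  assumes "lattice_coset L b" "\<And>j. j \<in> J \<Longrightarrow> f j \<in> b"
  shows "(\<Sum>j\<in>J. of_nat (k j) * f j) \<in> b"
proof -
  have "of_nat m * x \<in> b" if "x \<in> b" for m :: nat and x
    using that assms(1) by (induction m) (auto simp: lattice_coset_def ring_distribs)
  then show ?thesis using assms
    by (induction J rule: infinite_finite_induct) (auto simp: lattice_coset_def)
qed

lemma finite_lattice_qbox:
  assumes L: "lattice_coset L b" and W: "finite W"
  shows "finite (L \<inter> qbox W)"
proof -
  obtain c where c: "c \<noteq> 0" "\<forall>x\<in>L. \<forall>y\<in>L. \<exists>a\<in>OF. x - y = c * a" using L unfolding lattice_coset_def by blast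
  show ?thesis
  proof (rule finite_bounded_embeddings[OF c(1), of _ "\<Sum>w\<in>W. \<Sum>i\<in>UNIV. \<bar>emb i w\<bar>"])
    fix x i assume "x \<in> L \<inter> qbox W"
    then obtain q where q: "\<forall>w\<in>W. 0 < q w \<and> q w \<le> 1" "x = (\<Sum>w\<in>W. of_rat (q w) * w)" by (auto simp: qbox_def)
    have "\<bar>emb i x\<bar> \<le> (\<Sum>w\<in>W. \<bar>of_rat (q w) * emb i w\<bar>)" unfolding q(2) by (simp add: sum_abs)
    also have "\<dots> \<le> (\<Sum>w\<in>W. \<Sum>i\<in>UNIV. \<bar>emb i w\<bar>)"
    proof (rule sum_mono)
      fix w assume w: "w \<in> W"
      have "\<bar>of_rat (q w) * emb i w\<bar> \<le> 1 * \<bar>emb i w\<bar>"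
        unfolding abs_mult using q(1) w by (intro mult_right_mono) auto
      also have "\<dots> \<le> (\<Sum>i\<in>UNIV. \<bar>emb i w\<bar>)" using member_le_sum[of i UNIV "\<lambda>i. \<bar>emb i w\<bar>"] by simp
      finally show "\<bar>of_rat (q w) * emb i w\<bar> \<le> (\<Sum>i\<in>UNIV. \<bar>emb i w\<bar>)" .
    qed
    finally show "\<bar>emb i x\<bar> \<le> (\<Sum>w\<in>W. \<Sum>i\<in>UNIV. \<bar>emb i w\<bar>)" .
  qed (use c in auto)
qed

text \<open>Each point of L in the cone is uniquely a box point of L plus a combination of the
  generators with natural coefficients. The cone is thus a finite disjoint union of sets, each
  described by a single pair of Barnes data.\<close>

lemma has_value_cone:
  assumes L: "lattice_coset L b"
    and gs: "distinct gs" "gs \<noteq> []" "Q.independent (set gs)" "set gs \<subseteq> b" "\<And>g. g \<in> set gs \<Longrightarrow> totally_positive emb g"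
  shows "has_value i (L \<inter> qcone (set gs)) (\<Sum>y\<in>L \<inter> qbox (set gs). deriv (barnes_xi (emb i y) (map (emb i) gs)) 0)"
proof -
  let ?d = "length gs"
  let ?S = "{ks :: nat list. length ks = ?d}"
  have bij: "bij_betw ((!) gs) {..<?d} (set gs)" by (rule bij_betw_nth[OF gs(1)]) auto
  have sum_set: "(\<Sum>w\<in>set gs. h w) = (\<Sum>j<?d. h (gs ! j))" for h :: "'a \<Rightarrow> 'a"
    by (rule sum.reindex_bij_betw[OF bij, symmetric])
  have sum_setr: "(\<Sum>w\<in>set gs. h w) = (\<Sum>j<?d. h (gs ! j))" for h :: "'a \<Rightarrow> real"
    by (rule sum.reindex_bij_betw[OF bij, symmetric])
  have gb: "gs ! j \<in> b" if "j < ?d" for j using gs(4) that by auto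
  have pos: "emb i g > 0" if "g \<in> set gs" for g using gs(5)[OF that] by (simp add: totally_positive_def)
  define \<phi> where "\<phi> = (\<lambda>y ks. y + (\<Sum>j<?d. of_nat (ks ! j) * gs ! j))"
  define R where "R = L \<inter> qbox (set gs)"
  have finR: "finite R" unfolding R_def by (rule finite_lattice_qbox[OF L finite_set])
  have Rq: "\<exists>q. (\<forall>j<?d. 0 < q j \<and> q j \<le> 1) \<and> y = (\<Sum>j<?d. of_rat (q j) * gs ! j)" if yR: "y \<in> R" for y
  proof -
    obtain q where q: "\<forall>w\<in>set gs. 0 < q w \<and> q w \<le> 1" "y = (\<Sum>w\<in>set gs. of_rat (q w) * w)"
      using yR by (auto simp: R_def qbox_def)
    then show ?thesis unfolding sum_set by (intro exI[of _ "\<lambda>j. q (gs ! j)"]) auto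
  qed
  have \<phi>_q: "\<phi> (\<Sum>j<?d. of_rat (q j) * gs ! j) ks = (\<Sum>j<?d. of_rat (q j + of_nat (ks ! j)) * gs ! j)" for q ks
    unfolding \<phi>_def by (simp add: of_rat_add ring_distribs sum.distrib)
  \<comment> \<open>Coefficients of box points lie in (0, 1], so they differ by less than 1, and
    natural parts with the same total must coincide.\<close>
  have uniq: "y = y' \<and> ks = ks'" if y: "y \<in> R" "y' \<in> R" and ks: "ks \<in> ?S" "ks' \<in> ?S" and eq: "\<phi> y ks = \<phi> y' ks'" for y y' ks ks'
  proof -
    obtain q where q: "\<forall>j<?d. 0 < q j \<and> q j \<le> 1" "y = (\<Sum>j<?d. of_rat (q j) * gs ! j)" using Rq[OF y(1)] by blast
    obtain q' where q': "\<forall>j<?d. 0 < q' j \<and> q' j \<le> 1" "y' = (\<Sum>j<?d. of_rat (q' j) * gs ! j)" using Rq[OF y(2)] by blast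
    have "ks ! j = ks' ! j" if "j < ?d" for j
    proof -
      have "q j + of_nat (ks ! j) = q' j + of_nat (ks' ! j)"
        by (rule rat_independent_list[OF gs(1,3) _ that]) (use eq in \<open>simp only: q(2) q'(2) \<phi>_q\<close>)
      moreover have "0 < q j" "q j \<le> 1" "0 < q' j" "q' j \<le> 1" using q q' that by auto
      ultimately have "\<bar>(of_nat (ks ! j) :: rat) - of_nat (ks' ! j)\<bar> < 1" by linarith
      then have "\<bar>of_int (int (ks ! j) - int (ks' ! j)) :: rat\<bar> < 1" by simp
      then show ?thesis by linarith
    qed
    then have "ks = ks'" using ks by (intro nth_equalityI) auto
    then show ?thesis using eq by (simp add: \<phi>_def)
  qed
  have single: "has_value i (\<phi> y ` ?S) (deriv (barnes_xi (emb i y) (map (emb i) gs)) 0)" if y: "y \<in> R" for y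
  proof -
    obtain q where q: "\<forall>w\<in>set gs. 0 < q w \<and> q w \<le> 1" "y = (\<Sum>w\<in>set gs. of_rat (q w) * w)"
      using y by (auto simp: R_def qbox_def)
    have ey: "emb i y = (\<Sum>w\<in>set gs. of_rat (q w) * emb i w)" unfolding q(2) by simp
    have "emb i y > 0" unfolding ey
      by (rule sum_pos) (use q(1) pos gs(2) in auto)
    moreover have "emb i y < sum_list (map (emb i) gs)"
    proof -
      \<comment> \<open>Here L and b being disjoint is used: the corner with all coefficients 1 lies
        in b. This makes w < |\<omega>| strict, as the second zeta function in \<xi>
        demands.\<close>
      have "\<exists>w\<in>set gs. q w \<noteq> 1"
      proof (rule ccontr)
        assume "\<not> (\<exists>w\<in>set gs. q w \<noteq> 1)"
        then have "y = (\<Sum>j<?d. of_nat 1 * gs ! j)" unfolding q(2) sum_set[symmetric] by simp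
        then have "y \<in> b" using lattice_coset_sum[OF L, of "{..<?d}" "\<lambda>j. gs ! j" "\<lambda>_. 1"] gb by simp
        then show False using y L by (auto simp: R_def lattice_coset_def)
      qed
      then obtain w where w: "w \<in> set gs" "q w < 1" using q(1) by force
      have "emb i y < (\<Sum>w\<in>set gs. 1 * emb i w)" unfolding ey
      proof (rule sum_strict_mono_ex1)
        show "\<forall>w\<in>set gs. of_rat (q w) * emb i w \<le> 1 * emb i w"
          using q(1) pos by (auto intro!: mult_right_mono simp: less_imp_le simp del: mult_1)
        show "\<exists>w\<in>set gs. of_rat (q w) * emb i w < 1 * emb i w"
          using w pos by (intro bexI[of _ w] mult_strict_right_mono) auto
      qed simp
      also have "\<dots> = sum_list (map (emb i) gs)" using gs(1) by (simp add: sum_list_distinct_conv_sum_set)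
      finally show ?thesis .
    qed
    ultimately have adm: "barnes_admissible (emb i y) (map (emb i) gs)"
      using pos gs(2) by (auto simp: barnes_admissible_def)
    have inj: "inj_on (\<phi> y) ?S" using uniq[OF y y] by (auto simp: inj_on_def)
    have "((\<lambda>x. exp (- emb i x * t)) has_sum barnes_gf (emb i y) (map (emb i) gs) t) (\<phi> y ` ?S)" if t: "t > 0" for t
    proof -
      have e: "emb i (\<phi> y ks) = lattice_pt (emb i y) (map (emb i) gs) ks" for ks
        by (simp add: \<phi>_def lattice_pt_def)
      have "((\<lambda>ks. exp (- lattice_pt (emb i y) (map (emb i) gs) ks * t)) has_sum barnes_gf (emb i y) (map (emb i) gs) t) ?S"
        using barnes_gf_has_sum[of "map (emb i) gs" t "emb i y"] pos t by auto
      then show ?thesis unfolding has_sum_reindex[OF inj] by (simp add: o_def e)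
    qed
    then show ?thesis unfolding has_value_def using adm
      by (intro exI[of _ "[(emb i y, map (emb i) gs)]"]) (auto simp: barnes_adm_list_def xi_deriv_sum_def barnes_sum_def)
  qed
  have "L \<inter> qcone (set gs) = (\<Union>y\<in>R. \<phi> y ` ?S)"
  proof (intro equalityI subsetI)
    fix x assume x: "x \<in> L \<inter> qcone (set gs)"
    then obtain q where q: "\<forall>w\<in>set gs. 0 < q w" "x = (\<Sum>w\<in>set gs. of_rat (q w) * w)" by (auto simp: qcone_def)
    \<comment> \<open>Ceiling minus 1 and not the floor: the box is open at 0 and closed at
      1.\<close>
    define k where "k = (\<lambda>w. nat (\<lceil>q w\<rceil> - 1))"
    have k: "0 < q w - of_nat (k w) \<and> q w - of_nat (k w) \<le> 1" if "w \<in> set gs" for w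
    proof -
      have "\<lceil>q w\<rceil> \<ge> 1" using q(1) that by (simp add: less_imp_le zero_less_ceiling one_le_ceiling)
      then have "of_nat (k w) = (of_int (\<lceil>q w\<rceil> - 1) :: rat)" by (simp add: k_def)
      then show ?thesis by (simp, linarith)
    qed
    define y where "y = x + - (\<Sum>j<?d. of_nat (k (gs ! j)) * gs ! j)"
    have "(\<Sum>j<?d. of_nat (k (gs ! j)) * gs ! j) \<in> b" by (rule lattice_coset_sum[OF L]) (use gb in auto)
    then have "y \<in> L" using x L unfolding y_def lattice_coset_def by blast
    moreover have "y = (\<Sum>w\<in>set gs. of_rat (q w - of_nat (k w)) * w)"
      unfolding y_def q(2) sum_set by (simp add: of_rat_diff ring_distribs sum_subtractf)
    then have "y \<in> qbox (set gs)" unfolding qbox_def using k by (intro CollectI exI[of _ "\<lambda>w. q w - of_nat (k w)"]) auto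
    ultimately have "y \<in> R" by (simp add: R_def)
    moreover have "x = \<phi> y (map k gs)" by (simp add: \<phi>_def y_def)
    ultimately show "x \<in> (\<Union>y\<in>R. \<phi> y ` ?S)" by (intro UN_I[of y] image_eqI[of _ _ "map k gs"]) auto
  next
    fix x assume "x \<in> (\<Union>y\<in>R. \<phi> y ` ?S)"
    then obtain y ks where y: "y \<in> R" "ks \<in> ?S" "x = \<phi> y ks" by auto
    have "(\<Sum>j<?d. of_nat (ks ! j) * gs ! j) \<in> b" by (rule lattice_coset_sum[OF L]) (use gb in auto)
    then have "x \<in> L" using y L unfolding \<phi>_def R_def lattice_coset_def by blast
    moreover have "x \<in> qcone (set gs)"
    proof -
      obtain q where q: "\<forall>j<?d. 0 < q j \<and> q j \<le> 1" "y = (\<Sum>j<?d. of_rat (q j) * gs ! j)" using Rq[OF y(1)] by blast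
      define idx where "idx = the_inv_into {..<?d} ((!) gs)"
      have idx: "idx (gs ! j) = j" if "j < ?d" for j
        using that bij by (simp add: idx_def bij_betw_def the_inv_into_f_f)
      have "x = (\<Sum>w\<in>set gs. of_rat (q (idx w) + of_nat (ks ! idx w)) * w)"
        unfolding sum_set y(3) q(2) \<phi>_q by (rule sum.cong) (auto simp: idx)
      moreover have "0 < q (idx w) + of_nat (ks ! idx w)" if mem: "w \<in> set gs" for w
      proof -
        obtain j where "j < ?d" "w = gs ! j" using mem by (auto simp: in_set_conv_nth)
        then show ?thesis using idx q(1) by (simp add: add_pos_nonneg)
      qed
      ultimately show ?thesis unfolding qcone_def by (intro CollectI exI[of _ "\<lambda>w. q (idx w) + of_nat (ks ! idx w)"]) auto
    qed
    ultimately show "x \<in> L \<inter> qcone (set gs)" by blast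
  qed
  moreover have "has_value i (\<Union>y\<in>R. \<phi> y ` ?S) (\<Sum>y\<in>R. deriv (barnes_xi (emb i y) (map (emb i) gs)) 0)"
    by (rule has_value_UN[OF finR single]) (use uniq in blast)+
  ultimately show ?thesis by (simp add: R_def)
qed

text \<open>A common multiple N moves the generators of a rational cone into b without changing the
  cone, after which the evaluation by box points applies; disjoint unions are additive.\<close>

lemma conic_has_value:
  assumes L: "lattice_coset L b" and A: "conic (totally_positive emb) A"
  shows "\<exists>v. has_value i (L \<inter> A) v"
  using A
proof induction
  case (conic_qcone W)
  obtain N :: nat where N: "N > 0" "\<And>w. w \<in> W \<Longrightarrow> of_nat N * w \<in> b"
  proof -
    have "\<exists>N::nat. N > 0 \<and> (\<forall>w\<in>W. of_nat N * w \<in> b)"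
      using conic_qcone(1)
    proof induction
      case (insert w W)
      then obtain N where N: "N > 0" "\<forall>w\<in>W. of_nat N * w \<in> b" by auto
      obtain M :: nat where M: "M > 0" "of_nat M * w \<in> b" using L unfolding lattice_coset_def by blast
      have mult: "of_nat k * x \<in> b" if "x \<in> b" for k :: nat and x
        using lattice_coset_sum[OF L, of "{()}" "\<lambda>_. x" "\<lambda>_. k"] that by simp
      have "of_nat (N * M) * v \<in> b" if "v \<in> insert w W" for v
        using mult[of "of_nat M * w" N] mult[of "of_nat N * v" M] M N that by (auto simp: mult_ac)
      then show ?case using N M by (intro exI[of _ "N * M"]) auto
    qed auto
    then show ?thesis using that by blast
  qed
  define V where "V = (\<lambda>w. of_nat N * w) ` W"
  have inj: "inj_on (\<lambda>w. of_nat N * w :: 'a) W" using N by (auto simp: inj_on_def)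
  have sumV: "(\<Sum>v\<in>V. of_rat (h v) * v) = (\<Sum>w\<in>W. of_rat (h (of_nat N * w) * of_nat N) * w)" for h
    unfolding V_def by (subst sum.reindex[OF inj]) (simp add: o_def of_rat_mult mult.assoc)
  have finV: "finite V" using conic_qcone(1) by (simp add: V_def)
  have indV: "Q.independent V"
  proof
    assume "Q.dependent V"
    then obtain u where u: "\<exists>v\<in>V. u v \<noteq> 0" "(\<Sum>v\<in>V. rat_scale (u v) v) = 0"
      using Q.dependent_finite[OF finV] by auto
    then have z: "(\<Sum>w\<in>W. rat_scale (u (of_nat N * w) * of_nat N) w) = 0" using sumV[of u] by (simp add: rat_scale_def)
    have "u (of_nat N * w) * of_nat N = 0" if "w \<in> W" for w
      by (rule Q.independentD[OF conic_qcone(3,1) order_refl z that])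
    then show False using u(1) N by (auto simp: V_def)
  qed
  have qV: "qcone V = qcone W"
  proof (intro equalityI subsetI)
    fix x assume "x \<in> qcone V"
    then obtain q where q: "\<forall>v\<in>V. 0 < q v" "x = (\<Sum>v\<in>V. of_rat (q v) * v)" by (auto simp: qcone_def)
    then show "x \<in> qcone W" unfolding sumV qcone_def using N
      by (intro CollectI exI[of _ "\<lambda>w. q (of_nat N * w) * of_nat N"]) (auto simp: V_def)
  next
    fix x assume "x \<in> qcone W"
    then obtain q where q: "\<forall>v\<in>W. 0 < q v" "x = (\<Sum>v\<in>W. of_rat (q v) * v)" by (auto simp: qcone_def)
    have "x = (\<Sum>v\<in>V. of_rat (q (v / of_nat N) / of_nat N) * v)"
      unfolding sumV q(2) using N by (intro sum.cong) auto
    then show "x \<in> qcone V" unfolding qcone_def using N q(1)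
      by (intro CollectI exI[of _ "\<lambda>v. q (v / of_nat N) / of_nat N"]) (auto simp: V_def)
  qed
  obtain gs where gs: "set gs = V" "distinct gs" using finite_distinct_list[OF finV] by blast
  have "has_value i (L \<inter> qcone (set gs)) (\<Sum>y\<in>L \<inter> qbox (set gs). deriv (barnes_xi (emb i y) (map (emb i) gs)) 0)"
  proof (rule has_value_cone[OF L gs(2)])
    show "gs \<noteq> []" using gs(1) conic_qcone(2) by (auto simp: V_def)
    show "Q.independent (set gs)" using gs(1) indV by simp
    show "set gs \<subseteq> b" using gs(1) N(2) by (auto simp: V_def)
    show "totally_positive emb g" if "g \<in> set gs" for g
      using that gs(1) conic_qcone(4) N(1) by (auto simp: V_def totally_positive_def)
  qed
  then show ?case using gs(1) qV by auto
next
  case conic_empty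
  then show ?case using has_value_empty by auto
next
  case (conic_Un A B)
  then obtain v w where "has_value i (L \<inter> A) v" "has_value i (L \<inter> B) w" by blast
  then have "has_value i ((L \<inter> A) \<union> (L \<inter> B)) (v + w)" by (rule has_value_Un) (use conic_Un in blast)
  then show ?case by (auto simp: Int_Un_distrib)
qed

text \<open>An inequality between two linear forms passes from the generators to all positive
  combinations, so it suffices to bound the ratios of coordinates of finitely many vectors.\<close>

lemma qcone_ratio_bounded:
  assumes "finite W" "\<And>w. w \<in> W \<Longrightarrow> totally_positive emb w"
  shows "\<exists>C>0. \<forall>x\<in>qcone W. \<forall>i j. emb i x \<le> C * emb j x"
proof -
  \<comment> \<open>The sum of all ratios bounds each of them; the summand 1 keeps C positive even
    for empty W.\<close>
  define C where "C = 1 + (\<Sum>w\<in>W. \<Sum>i\<in>UNIV. \<Sum>j\<in>UNIV. emb i w / emb j w)"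
  have pos: "emb i w > 0" if "w \<in> W" for i w using assms(2)[OF that] by (simp add: totally_positive_def)
  have nn: "emb i w / emb j w \<ge> 0" if "w \<in> W" for i j w using pos[OF that] by (simp add: less_imp_le)
  have C1: "C > 0" unfolding C_def using nn by (intro add_pos_nonneg sum_nonneg) auto
  have C: "emb i w \<le> C * emb j w" if w: "w \<in> W" for i j w
  proof -
    have "emb i w / emb j w \<le> (\<Sum>j\<in>UNIV. emb i w / emb j w)" by (rule member_le_sum) (use nn w in auto)
    also have "\<dots> \<le> (\<Sum>i\<in>UNIV. \<Sum>j\<in>UNIV. emb i w / emb j w)"
      by (rule member_le_sum[of i UNIV "\<lambda>i. \<Sum>j\<in>UNIV. emb i w / emb j w"]) (use nn w in \<open>auto intro!: sum_nonneg\<close>)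
    also have "\<dots> \<le> (\<Sum>w\<in>W. \<Sum>i\<in>UNIV. \<Sum>j\<in>UNIV. emb i w / emb j w)"
      by (rule member_le_sum[of w W "\<lambda>w. \<Sum>i\<in>UNIV. \<Sum>j\<in>UNIV. emb i w / emb j w"]) (use nn w assms in \<open>auto intro!: sum_nonneg\<close>)
    finally have "emb i w / emb j w \<le> C" by (simp add: C_def)
    then show ?thesis using pos[OF w, of j] by (simp add: divide_le_eq)
  qed
  have "emb i x \<le> C * emb j x" if x: "x \<in> qcone W" for x i j
  proof -
    obtain q where q: "\<forall>w\<in>W. 0 < q w" "x = (\<Sum>w\<in>W. of_rat (q w) * w)" using x unfolding qcone_def by blast
    have "emb i x = (\<Sum>w\<in>W. of_rat (q w) * emb i w)" unfolding q(2) by simp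
    also have "\<dots> \<le> (\<Sum>w\<in>W. of_rat (q w) * (C * emb j w))"
      using q(1) C by (intro sum_mono mult_left_mono) (auto simp: less_imp_le)
    also have "\<dots> = C * emb j x" unfolding q(2) by (simp add: sum_distrib_left mult_ac)
    finally show ?thesis .
  qed
  then show ?thesis using C1 by blast
qed

end

section \<open>Ideals and ray classes\<close>

lemma ideal_mult_0: "0 \<in> ideal_mult I J"
  unfolding ideal_mult_def by (intro CollectI exI[of _ "0::nat"]) auto

lemma ideal_mult_step:
  assumes "u \<in> ideal_mult I J" "x \<in> I" "y \<in> J"
  shows "u + x * y \<in> ideal_mult I J"
proof -
  obtain m :: nat and f g where fg: "u = (\<Sum>k<m. f k * g k)" "\<forall>k<m. f k \<in> I \<and> g k \<in> J"
    using assms(1) by (auto simp: ideal_mult_def)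
  have "u + x * y = (\<Sum>k<Suc m. (f(m := x)) k * (g(m := y)) k)"
  proof -
    have "(\<Sum>k<m. (f(m := x)) k * (g(m := y)) k) = (\<Sum>k<m. f k * g k)" by (rule sum.cong) auto
    then show ?thesis unfolding fg(1) by simp
  qed
  moreover have "\<forall>k<Suc m. (f(m := x)) k \<in> I \<and> (g(m := y)) k \<in> J"
    using fg(2) assms by (auto simp: less_Suc_eq)
  ultimately show ?thesis unfolding ideal_mult_def by blast
qed

lemma ideal_mult_induct [consumes 1, case_names zero step]:
  assumes "u \<in> ideal_mult I J" "P 0" "\<And>u x y. P u \<Longrightarrow> x \<in> I \<Longrightarrow> y \<in> J \<Longrightarrow> P (u + x * y)"
  shows "P u"
proof -
  obtain m :: nat and f g where fg: "u = (\<Sum>k<m. f k * g k)" "\<forall>k<m. f k \<in> I \<and> g k \<in> J"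
    using assms(1) by (auto simp: ideal_mult_def)
  have "P (\<Sum>k<m. f k * g k)" using fg(2)
    by (induction m) (auto intro: assms(2,3))
  then show ?thesis using fg(1) by simp
qed

lemma ideal_mult_mem: "x \<in> I \<Longrightarrow> y \<in> J \<Longrightarrow> x * y \<in> ideal_mult I J"
  using ideal_mult_step[OF ideal_mult_0] by force

lemma ideal_mult_add:
  assumes "u \<in> ideal_mult I J" "v \<in> ideal_mult I J"
  shows "u + v \<in> ideal_mult I J"
  using assms(2)
proof (induction rule: ideal_mult_induct)
  case (step v x y)
  then show ?case using ideal_mult_step[of "u + v"] by (simp add: add.assoc)
qed (use assms in simp)

lemma ideal_mult_scale_left:
  assumes "u \<in> ideal_mult I J" "\<And>x. x \<in> I \<Longrightarrow> c * x \<in> I'"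
  shows "c * u \<in> ideal_mult I' J"
  using assms(1)
proof (induction rule: ideal_mult_induct)
  case (step v x y)
  then show ?case using ideal_mult_step[OF step(1) assms(2)[OF step(2)] step(3)] by (simp add: algebra_simps)
qed (simp add: ideal_mult_0)

lemma ideal_mult_principal: "ideal_mult ((\<lambda>y. x * y) ` A) J = (\<lambda>y. x * y) ` ideal_mult A J" for x :: "'a::field_char_0"
proof (intro equalityI subsetI)
  fix u assume "u \<in> ideal_mult ((\<lambda>y. x * y) ` A) J"
  then show "u \<in> (\<lambda>y. x * y) ` ideal_mult A J"
  proof (induction rule: ideal_mult_induct)
    case zero
    then show ?case using ideal_mult_0 by force
  next
    case (step u v w)
    then obtain u' v' where "u = x * u'" "u' \<in> ideal_mult A J" "v = x * v'" "v' \<in> A" by auto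
    then have "u + v * w = x * (u' + v' * w)" "u' + v' * w \<in> ideal_mult A J"
      using step(3) by (auto simp: algebra_simps intro: ideal_mult_step)
    then show ?case by blast
  qed
next
  fix u assume "u \<in> (\<lambda>y. x * y) ` ideal_mult A J"
  then show "u \<in> ideal_mult ((\<lambda>y. x * y) ` A) J"
    by (auto intro: ideal_mult_scale_left)
qed

text \<open>Multiplication of the relation by the power m - 1 of its leading coefficient gives a
  monic integral equation for that coefficient times x.\<close>

lemma algebraic_int_leading_coeff_mult:
  fixes x :: "'a::field_char_0" and c :: "nat \<Rightarrow> int"
  assumes rel: "(\<Sum>k\<le>m. of_int (c k) * x ^ k) = 0" and m0: "m > 0"
  shows "algebraic_int (of_int (c m) * x)"
proof -
  define s where "s = c m"
  define e where "e = (\<lambda>k. of_int (c k * s ^ (m - 1 - k)) :: 'a)"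
  define q where "q = monom 1 m + (\<Sum>k<m. monom (e k) k)"
  have cq: "coeff q j = (if j = m then 1 else if j < m then e j else 0)" for j
  proof -
    have "(\<Sum>k<m. coeff (monom (e k) k) j) = (\<Sum>k<m. if k = j then e k else 0)"
      by (rule sum.cong) auto
    also have "\<dots> = (if j < m then e j else 0)" by (subst sum.delta) auto
    finally show ?thesis unfolding q_def coeff_add coeff_sum by auto
  qed
  have "degree q = m"
    by (rule antisym[OF degree_le le_degree]) (auto simp: cq)
  then have "lead_coeff q = 1" by (simp add: cq)
  moreover have "\<forall>j. coeff q j \<in> \<int>" unfolding cq e_def by (simp del: of_int_mult)
  moreover have "poly q (of_int s * x) = 0"
  proof -
    have "poly q (of_int s * x) = (of_int s * x) ^ m + (\<Sum>k<m. e k * (of_int s * x) ^ k)"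
      unfolding q_def by (simp add: poly_sum poly_monom)
    also have "(\<Sum>k<m. e k * (of_int s * x) ^ k) = (\<Sum>k<m. of_int s ^ (m - 1) * (of_int (c k) * x ^ k))"
    proof (rule sum.cong)
      fix k assume "k \<in> {..<m}"
      then have mk: "m - 1 = (m - 1 - k) + k" by auto
      have "(of_int s :: 'a) ^ (m - 1) = of_int s ^ ((m - 1 - k) + k)" using mk by presburger
      also have "\<dots> = of_int s ^ (m - 1 - k) * of_int s ^ k" by (rule power_add)
      finally have "(of_int s :: 'a) ^ (m - 1) = of_int s ^ (m - 1 - k) * of_int s ^ k" .
      then show "e k * (of_int s * x) ^ k = of_int s ^ (m - 1) * (of_int (c k) * x ^ k)"
        unfolding e_def power_mult_distrib of_int_mult of_int_power by (simp only: mult_ac)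
    qed simp
    also have "\<dots> = of_int s ^ (m - 1) * (\<Sum>k<m. of_int (c k) * x ^ k)" by (simp add: sum_distrib_left)
    also have "(of_int s * x) ^ m = of_int s ^ (m - 1) * (of_int s * x ^ m)"
    proof -
      obtain l where "m = Suc l" using m0 by (cases m) auto
      then show ?thesis by (simp add: power_mult_distrib)
    qed
    also have "of_int s ^ (m - 1) * (of_int s * x ^ m) + of_int s ^ (m - 1) * (\<Sum>k<m. of_int (c k) * x ^ k) =
       of_int s ^ (m - 1) * ((\<Sum>k<m. of_int (c k) * x ^ k) + of_int s * x ^ m)"
      by (simp only: distrib_left add.commute)
    also have "(\<Sum>k<m. of_int (c k) * x ^ k) + of_int s * x ^ m = (\<Sum>k\<le>m. of_int (c k) * x ^ k)"
      unfolding s_def lessThan_Suc_atMost[symmetric] by (rule sum.lessThan_Suc[symmetric])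
    finally show ?thesis using rel by simp
  qed
  ultimately show ?thesis unfolding s_def by (rule algebraic_int.intros)
qed

context totally_real_field begin

lemma integral_idealD:
  assumes "integral_ideal I"
  shows "I \<subseteq> OF" "0 \<in> I" "\<And>x y. x \<in> I \<Longrightarrow> y \<in> I \<Longrightarrow> x + y \<in> I" "\<And>r x. r \<in> OF \<Longrightarrow> x \<in> I \<Longrightarrow> r * x \<in> I"
    "\<And>x. x \<in> I \<Longrightarrow> - x \<in> I" "\<exists>x\<in>I. x \<noteq> 0"
proof -
  interpret I: ideal I "ring_of_integers :: 'a ring" using assms by (simp add: integral_ideal_def)
  show 1: "I \<subseteq> OF" by (rule I.a_subset)
  note sub = I.is_additive_subgroup
  show 0: "0 \<in> I" using additive_subgroup.zero_closed[OF sub] by (simp add: ring_of_integers_def)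
  show "\<And>x y. x \<in> I \<Longrightarrow> y \<in> I \<Longrightarrow> x + y \<in> I" using additive_subgroup.a_closed[OF sub] by (simp add: ring_of_integers_def)
  show m: "r * x \<in> I" if "r \<in> OF" "x \<in> I" for r x using I.I_l_closed[OF that(2,1)] by (simp add: ring_of_integers_def)
  show "\<And>x. x \<in> I \<Longrightarrow> - x \<in> I" using m[of "-1"] OF_minus[OF OF_1] by simp
  show "\<exists>x\<in>I. x \<noteq> 0" using assms 0 unfolding integral_ideal_def by blast
qed

lemma coprime_idealsD:
  fixes I J :: "'a set"
  assumes "coprime_ideals I J"
  shows "\<exists>x\<in>I. 1 - x \<in> J"
proof -
  have "1 \<in> I <+>\<^bsub>ring_of_integers\<^esub> J" using assms by (simp add: coprime_ideals_def)
  then obtain x y where "x \<in> I" "y \<in> J" "1 = x + y" by (auto simp: set_add_defs ring_of_integers_def)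
  moreover from this have "1 - x = y" by (metis add_diff_cancel_left')
  ultimately show ?thesis by blast
qed

lemma coprime_principalD:
  assumes "coprime_ideals (PIdl\<^bsub>ring_of_integers\<^esub> a) J"
  shows "\<exists>r\<in>OF. 1 - r * a \<in> J"
proof -
  obtain x where x: "x \<in> PIdl\<^bsub>ring_of_integers\<^esub> a" "1 - x \<in> J" using coprime_idealsD[OF assms] by blast
  obtain r where r: "r \<in> OF" "x = r \<otimes>\<^bsub>ring_of_integers\<^esub> a" using x(1) unfolding cgenideal_def by blast
  have "x = r * a" using r(2) by (simp add: ring_of_integers_def)
  then have "1 - r * a \<in> J" using x(2) by simp
  then show ?thesis using r(1) by blast
qed

text \<open>The n + 1 powers are too many to be independent. Repeated powers are treated apart
  because the set of powers would not show the repetition as a dependence.\<close>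

lemma exists_rational_relation:
  fixes x :: 'a
  shows "\<exists>a :: nat \<Rightarrow> rat. (\<exists>k\<le>CARD('n). a k \<noteq> 0) \<and> (\<Sum>k\<le>CARD('n). of_rat (a k) * x ^ k) = 0"
proof (cases "inj_on (\<lambda>k. x ^ k) {..CARD('n)}")
  case True
  let ?W = "(\<lambda>k. x ^ k) ` {..CARD('n)}"
  have "card ?W = Suc CARD('n)" using True by (simp add: card_image)
  have "Q.dependent ?W"
  proof (rule ccontr)
    assume ind: "\<not> Q.dependent ?W"
    obtain B where B: "?W \<subseteq> B" "finite B" "Q.independent B" "Q.span B = UNIV" using rat_basis_extend[OF ind] by metis
    have "card B = Q.dim (UNIV :: 'a set)" by (rule Q.basis_card_eq_dim) (use B in auto)
    then have "card B = CARD('n)" using field unfolding totally_real_number_field_def by simp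
    then show False using card_mono[OF B(2,1)] \<open>card ?W = Suc CARD('n)\<close> by simp
  qed
  then obtain u where u: "\<exists>v\<in>?W. u v \<noteq> 0" "(\<Sum>v\<in>?W. rat_scale (u v) v) = 0"
    unfolding Q.dependent_finite[OF finite_imageI[OF finite_atMost]] by blast
  have "(\<Sum>k\<le>CARD('n). of_rat (u (x ^ k)) * x ^ k) = 0"
    using u(2) by (subst (asm) sum.reindex[OF True]) (simp add: rat_scale_def)
  moreover have "\<exists>k\<le>CARD('n). u (x ^ k) \<noteq> 0" using u(1) by blast
  ultimately show ?thesis by (intro exI[of _ "\<lambda>k. u (x ^ k)"]) simp
next
  case False
  then obtain j k where jk: "j \<le> CARD('n)" "k \<le> CARD('n)" "j \<noteq> k" "x ^ j = x ^ k" by (auto simp: inj_on_def)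
  define a where "a = (\<lambda>l. (if l = j then 1 else 0) - (if l = k then 1 else 0) :: rat)"
  have "(\<Sum>l\<le>CARD('n). of_rat (a l) * x ^ l) = (\<Sum>l\<le>CARD('n). (if l = j then x ^ l else 0) - (if l = k then x ^ l else 0))"
    by (rule sum.cong) (auto simp: a_def)
  also have "\<dots> = (\<Sum>l\<le>CARD('n). if l = j then x ^ l else 0) - (\<Sum>l\<le>CARD('n). if l = k then x ^ l else 0)"
    by (rule sum_subtractf)
  also have "\<dots> = x ^ j - x ^ k" using jk(1,2) by (simp only: sum.delta[OF finite_atMost] atMost_iff if_True)
  also have "\<dots> = 0" using jk(4) by simp
  finally show ?thesis using jk by (intro exI[of _ a]) (auto simp: a_def intro!: exI[of _ j])
qed

text \<open>Clear the denominators of a rational relation between powers of x and cut it at its last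
  nonzero coefficient; that coefficient times x is integral, and its sign is adjusted to obtain a
  positive multiplier.\<close>

lemma exists_integral_multiple: "\<exists>N::nat. N > 0 \<and> of_nat N * x \<in> OF"
proof -
  let ?n = "CARD('n)"
  obtain a :: "nat \<Rightarrow> rat" where a: "\<exists>k\<le>?n. a k \<noteq> 0" "(\<Sum>k\<le>?n. of_rat (a k) * x ^ k) = 0"
    using exists_rational_relation by blast
  obtain D :: nat where D: "D > 0" "\<forall>q\<in>a ` {..?n}. of_nat D * q \<in> \<int>"
    using common_denominator[OF finite_imageI[OF finite_atMost]] by blast
  define c where "c = (\<lambda>k. \<lfloor>of_nat D * a k\<rfloor>)"
  have c: "of_int (c k) = of_nat D * a k" if "k \<le> ?n" for k
  proof -
    have "of_nat D * a k \<in> \<int>" using D(2) that by blast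
    then show ?thesis unfolding c_def by (elim Ints_cases) simp
  qed
  have c': "(of_int (c k) :: 'a) = of_nat D * of_rat (a k)" if "k \<le> ?n" for k
  proof -
    have "(of_int (c k) :: 'a) = of_rat (of_int (c k))" by simp
    also have "\<dots> = of_nat D * of_rat (a k)" unfolding c[OF that] by (simp add: of_rat_mult)
    finally show ?thesis .
  qed
  define m where "m = Max {k. k \<le> ?n \<and> a k \<noteq> 0}"
  have fin: "finite {k. k \<le> ?n \<and> a k \<noteq> 0}" by simp
  have "m \<in> {k. k \<le> ?n \<and> a k \<noteq> 0}" unfolding m_def by (rule Max_in[OF fin]) (use a(1) in blast)
  then have m: "m \<le> ?n" "a m \<noteq> 0" by blast+
  have above: "a k = 0" if k: "k \<le> ?n" "k > m" for k
  proof (rule ccontr)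
    assume "a k \<noteq> 0"
    then have "k \<le> m" unfolding m_def by (intro Max_ge[OF fin]) (use k in blast)
    then show False using k by simp
  qed
  have "of_nat D * a m \<noteq> 0" using m(2) D(1) by simp
  then have cm: "c m \<noteq> 0" using c[OF m(1)] by auto
  have rel: "(\<Sum>k\<le>m. of_int (c k) * x ^ k) = 0"
  proof -
    have "(\<Sum>k\<le>m. of_int (c k) * x ^ k) = (\<Sum>k\<le>m. of_nat D * (of_rat (a k) * x ^ k))"
      by (rule sum.cong) (use m(1) in \<open>auto simp: c' mult.assoc\<close>)
    also have "\<dots> = of_nat D * (\<Sum>k\<le>m. of_rat (a k) * x ^ k)" by (simp add: sum_distrib_left)
    also have "(\<Sum>k\<le>m. of_rat (a k) * x ^ k) = (\<Sum>k\<le>?n. of_rat (a k) * x ^ k)"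
      by (rule sum.mono_neutral_left) (use m(1) above in auto)
    finally show ?thesis using a(2) by simp
  qed
  have m0: "m > 0"
  proof (rule ccontr)
    assume "\<not> m > 0"
    then show False using rel cm by simp
  qed
  define s where "s = c m"
  have sx: "of_int s * x \<in> OF"
    unfolding OF_iff s_def by (rule algebraic_int_leading_coeff_mult[OF rel m0])
  have "of_nat (nat \<bar>s\<bar>) * x \<in> OF"
  proof (cases "s \<ge> 0")
    case True
    then show ?thesis using sx by simp
  next
    case False
    then have "(of_nat (nat \<bar>s\<bar>) :: 'a) = of_int (- s)" by (simp add: of_nat_nat)
    then have "of_nat (nat \<bar>s\<bar>) * x = - (of_int s * x)" by simp
    then show ?thesis using OF_minus[OF sx] by metis
  qed
  moreover have "nat \<bar>s\<bar> > 0" using cm by (simp add: s_def)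
  ultimately show ?thesis by blast
qed

lemma ideal_inv_1: "I \<subseteq> OF \<Longrightarrow> 1 \<in> ideal_inv I"
  by (auto simp: ideal_inv_def)

lemma ideal_inv_OF: "x \<in> ideal_inv I \<Longrightarrow> r \<in> OF \<Longrightarrow> r * x \<in> ideal_inv I"
  by (auto simp: ideal_inv_def mult.assoc)

section \<open>Ray units and members of a narrow ray class\<close>

lemma ray_unitsD:
  assumes "u \<in> ray_units emb \<ff>"
  shows "u \<in> OF" "inverse u \<in> OF" "totally_positive emb u" "u - 1 \<in> \<ff>" "u \<noteq> 0"
proof -
  obtain v where v: "v \<in> OF" "v * u = 1" "u \<in> OF" "totally_positive emb u" "u - 1 \<in> \<ff>"
    using assms by (auto simp: ray_units_def Units_def ring_of_integers_def)
  have "u * v = 1" using v(2) by (subst mult.commute)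
  then have "inverse u = v" by (rule inverse_unique)
  moreover have "u \<noteq> 0" using v(2) by auto
  ultimately show "u \<in> OF" "inverse u \<in> OF" "totally_positive emb u" "u - 1 \<in> \<ff>" "u \<noteq> 0" using v by auto
qed

lemma totally_positive_simps:
  "totally_positive emb u \<Longrightarrow> totally_positive emb v \<Longrightarrow> totally_positive emb (u * v)"
  "totally_positive emb u \<Longrightarrow> totally_positive emb (inverse u)"
  "totally_positive emb u \<Longrightarrow> totally_positive emb v \<Longrightarrow> totally_positive emb (u / v)"
  by (auto simp: totally_positive_def)

lemma ray_units_inverse:
  assumes "integral_ideal \<ff>" "u \<in> ray_units emb \<ff>"
  shows "inverse u \<in> ray_units emb \<ff>"
proof -
  note u = ray_unitsD[OF assms(2)]
  have "inverse u - 1 = inverse u * (- (u - 1))" using u(5) by (simp add: ring_distribs)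
  then have "inverse u - 1 \<in> \<ff>" using integral_idealD(4)[OF assms(1) u(2)] integral_idealD(5)[OF assms(1) u(4)] by metis
  moreover have "inverse u \<in> Units ring_of_integers"
  proof -
    have "u * inverse u = 1" "inverse u * u = 1" using u(5) by simp_all
    then show ?thesis unfolding Units_def using u(1,2)
      by (intro CollectI conjI bexI[of _ u]) (simp_all add: ring_of_integers_def)
  qed
  ultimately show ?thesis using u by (simp add: ray_units_def totally_positive_simps)
qed

text \<open>A class is a coset of the principal rays, so all its members are multiples of the same
  set \<open>ideal_mult OF g\<close>. This reduces the comparison of two members to a quotient of
  field elements.\<close>

lemma ray_class_representatives:
  assumes C: "\<CC> \<in> carrier (narrow_ray_class_group emb \<ff>)"
  shows "\<exists>g A B. integral_ideal A \<and> integral_ideal B \<and> coprime_ideals A \<ff> \<and> g = ideal_mult A (ideal_inv B) \<and>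
    (\<forall>\<aa>\<in>\<CC>. \<exists>x. totally_positive emb x \<and> mult_cong_one \<ff> x \<and> \<aa> = (\<lambda>y. x * y) ` ideal_mult OF g)"
proof -
  obtain g where g: "g \<in> carrier (ray_ideals \<ff>)" "\<CC> = narrow_ray emb \<ff> #>\<^bsub>ray_ideals \<ff>\<^esub> g"
  proof -
    have "\<CC> \<in> rcosets\<^bsub>ray_ideals \<ff>\<^esub> narrow_ray emb \<ff>"
      using C by (simp add: narrow_ray_class_group_def FactGroup_def)
    then show ?thesis using that unfolding RCOSETS_def by blast
  qed
  obtain A B where AB: "integral_ideal A" "integral_ideal B" "coprime_ideals A \<ff>" "g = ideal_mult A (ideal_inv B)"
    using g(1) unfolding ray_ideals_def partial_object.select_convs by blast
  have mult: "h \<otimes>\<^bsub>ray_ideals \<ff>\<^esub> g = ideal_mult h g" for h by (simp add: ray_ideals_def)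
  have "\<exists>x. totally_positive emb x \<and> mult_cong_one \<ff> x \<and> \<aa> = (\<lambda>y. x * y) ` ideal_mult OF g" if a: "\<aa> \<in> \<CC>" for \<aa>
  proof -
    obtain h where h: "h \<in> narrow_ray emb \<ff>" "\<aa> = ideal_mult h g"
      using a unfolding g(2) r_coset_def mult by blast
    obtain x where "totally_positive emb x" "mult_cong_one \<ff> x" "h = (\<lambda>y. x * y) ` OF"
      using h(1) unfolding narrow_ray_def by blast
    then show ?thesis using h(2) ideal_mult_principal[of _ OF g] by (intro exI[of _ x]) simp
  qed
  then show ?thesis by (intro exI[of _ g] exI[of _ A] exI[of _ B] conjI ballI AB)
qed

text \<open>The element is r \<alpha> d with d in the integral ideal A and d = 1 modulo \<ff>, and r
  an inverse of the numerator \<alpha> of x modulo \<ff>. It lies in \<aa> because it equals (r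
  \<beta>) (x d).\<close>

lemma ray_class_coprime:
  assumes f: "integral_ideal \<ff>" and a: "integral_ideal \<aa>" and C: "\<CC> \<in> carrier (narrow_ray_class_group emb \<ff>)" "\<aa> \<in> \<CC>"
  shows "\<exists>c\<in>\<aa>. 1 - c \<in> \<ff>"
proof -
  obtain g A B where g: "integral_ideal A" "integral_ideal B" "coprime_ideals A \<ff>" "g = ideal_mult A (ideal_inv B)"
    and all: "\<forall>\<aa>\<in>\<CC>. \<exists>x. totally_positive emb x \<and> mult_cong_one \<ff> x \<and> \<aa> = (\<lambda>y. x * y) ` ideal_mult OF g"
    using ray_class_representatives[OF C(1)] by (elim exE conjE)
  obtain x where x: "mult_cong_one \<ff> x" "\<aa> = (\<lambda>y. x * y) ` ideal_mult OF g"
    using bspec[OF all C(2)] by (elim exE conjE)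
  obtain \<alpha> \<beta> where ab: "\<alpha> \<in> OF" "\<beta> \<in> OF" "\<beta> \<noteq> 0" "x = \<alpha> / \<beta>" "coprime_ideals (PIdl\<^bsub>ring_of_integers\<^esub> \<alpha>) \<ff>"
    using x(1) unfolding mult_cong_one_def by blast
  obtain r where r: "r \<in> OF" "1 - r * \<alpha> \<in> \<ff>" using coprime_principalD[OF ab(5)] by blast
  obtain d where d: "d \<in> A" "1 - d \<in> \<ff>" using coprime_idealsD[OF g(3)] by blast
  have "d * 1 \<in> g" unfolding g(4) by (rule ideal_mult_mem[OF d(1) ideal_inv_1]) (rule integral_idealD(1)[OF g(2)])
  then have "1 * d \<in> ideal_mult OF g" by (intro ideal_mult_mem) auto
  then have "d \<in> ideal_mult OF g" by simp
  then have "x * d \<in> \<aa>" unfolding x(2) by (rule imageI)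
  then have "(r * \<beta>) * (x * d) \<in> \<aa>" by (rule integral_idealD(4)[OF a OF_mult[OF r(1) ab(2)]])
  moreover have "(r * \<beta>) * (x * d) = r * \<alpha> * d" using ab(3) by (simp add: ab(4))
  moreover have "1 - r * \<alpha> * d \<in> \<ff>"
  proof -
    have e: "1 - r * \<alpha> * d = (1 - d) + d * (1 - r * \<alpha>)" by (simp add: algebra_simps)
    have "d \<in> OF" using d(1) integral_idealD(1)[OF g(1)] by blast
    then show ?thesis unfolding e by (rule integral_idealD(3)[OF f d(2) integral_idealD(4)[OF f _ r(2)]])
  qed
  ultimately show ?thesis by (intro bexI[of _ "r * \<alpha> * d"]) simp_all
qed

section \<open>The cosets z + \<bb>, written as z (1 + u) with u in the product of \<ff> and the
  inverse of \<aa>\<close>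

definition shift_coset :: "'a set \<Rightarrow> 'a set \<Rightarrow> 'a \<Rightarrow> 'a set" where
  "shift_coset \<ff> \<aa> z = (\<lambda>b. z + b) ` shift_ideal \<ff> \<aa> z"

lemma shift_coset_iff:
  "x \<in> shift_coset \<ff> \<aa> z \<longleftrightarrow> (\<exists>u\<in>ideal_mult (ideal_inv \<aa>) \<ff>. x = z * (1 + u))"
  by (auto simp: shift_coset_def shift_ideal_def ring_distribs)

lemma shift_ideal_iff: "x \<in> shift_ideal \<ff> \<aa> z \<longleftrightarrow> (\<exists>u\<in>ideal_mult (ideal_inv \<aa>) \<ff>. x = z * u)"
  by (auto simp: shift_ideal_def)

lemma ideal_mult_inv_contains:
  fixes \<aa> \<ff> :: "'a set"
  assumes "integral_ideal \<aa>" "y \<in> \<ff>"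
  shows "y \<in> ideal_mult (ideal_inv \<aa>) \<ff>"
  using ideal_mult_mem[OF ideal_inv_1[OF integral_idealD(1)[OF assms(1)]] assms(2)] by simp

lemma ideal_mult_inv_OF:
  assumes "r \<in> OF" "u \<in> ideal_mult (ideal_inv \<aa>) \<ff>"
  shows "r * u \<in> ideal_mult (ideal_inv \<aa>) \<ff>"
  by (rule ideal_mult_scale_left[OF assms(2)]) (rule ideal_inv_OF[OF _ assms(1)])

lemma ideal_mult_inv_annihilates:
  fixes \<aa> \<ff> :: "'a set"
  assumes f: "integral_ideal \<ff>" and u: "u \<in> ideal_mult (ideal_inv \<aa>) \<ff>" and c: "c \<in> \<aa>"
  shows "c * u \<in> \<ff>"
  using u
proof (induction rule: ideal_mult_induct)
  case zero
  then show ?case using integral_idealD(2)[OF f] by simp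
next
  case (step v x y)
  have "x * c \<in> OF" using step(2) c by (simp add: ideal_inv_def)
  then have "(x * c) * y \<in> \<ff>" using integral_idealD(4)[OF f] step(3) by blast
  then have "c * v + (x * c) * y \<in> \<ff>" using integral_idealD(3)[OF f] step(1) by blast
  moreover have "c * v + (x * c) * y = c * (v + x * y)" by (simp add: algebra_simps)
  ultimately show ?case by metis
qed

text \<open>Disjointness amounts to 1 not lying in the product of \<ff> and the inverse of \<aa>. If
  it did, an element c of \<aa> with 1 - c in \<ff> would itself lie in \<ff>, and \<ff> would
  contain 1. A nonzero y0 in \<aa> carries the product into the integers, hence the constant z / y0;
  a nonzero element of \<ff> gives the multiples in \<bb>.\<close>

lemma shift_coset_lattice:
  assumes f: "integral_ideal \<ff>" "\<ff> \<noteq> OF" and a: "integral_ideal \<aa>" and cop: "\<exists>c\<in>\<aa>. 1 - c \<in> \<ff>" and z: "z \<noteq> 0"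
  shows "lattice_coset (shift_coset \<ff> \<aa> z) (shift_ideal \<ff> \<aa> z)"
proof -
  let ?I = "ideal_mult (ideal_inv \<aa>) \<ff>"
  have neg: "- u \<in> ?I" if "u \<in> ?I" for u
    using ideal_mult_inv_OF[OF OF_minus[OF OF_1] that] by simp
  have z0: "0 \<in> shift_ideal \<ff> \<aa> z" unfolding shift_ideal_iff by (rule bexI[OF _ ideal_mult_0]) simp
  have add: "x + y \<in> shift_ideal \<ff> \<aa> z" if xy: "x \<in> shift_ideal \<ff> \<aa> z" "y \<in> shift_ideal \<ff> \<aa> z" for x y
  proof -
    obtain u v where "u \<in> ?I" "v \<in> ?I" "x = z * u" "y = z * v" using xy unfolding shift_ideal_iff by blast
    then show ?thesis unfolding shift_ideal_iff
      by (intro bexI[of _ "u + v"]) (simp_all add: ring_distribs ideal_mult_add)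
  qed
  have minus: "- x \<in> shift_ideal \<ff> \<aa> z" if x: "x \<in> shift_ideal \<ff> \<aa> z" for x
  proof -
    obtain u where "u \<in> ?I" "x = z * u" using x unfolding shift_ideal_iff by blast
    then show ?thesis unfolding shift_ideal_iff
      by (intro bexI[of _ "- u"]) (simp_all add: neg)
  qed
  have coset: "x + y \<in> shift_coset \<ff> \<aa> z" if xy: "x \<in> shift_coset \<ff> \<aa> z" "y \<in> shift_ideal \<ff> \<aa> z" for x y
  proof -
    obtain u v where "u \<in> ?I" "v \<in> ?I" "x = z * (1 + u)" "y = z * v"
      using xy unfolding shift_ideal_iff shift_coset_iff by blast
    then show ?thesis unfolding shift_coset_iff
      by (intro bexI[of _ "u + v"]) (simp_all add: ring_distribs ideal_mult_add)
  qed
  have not1: "1 \<notin> ?I"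
  proof
    assume 1: "1 \<in> ?I"
    obtain c where c: "c \<in> \<aa>" "1 - c \<in> \<ff>" using cop by blast
    have "c \<in> \<ff>" using ideal_mult_inv_annihilates[OF f(1) 1 c(1)] by simp
    then have "c + (1 - c) \<in> \<ff>" using c(2) integral_idealD(3)[OF f(1)] by blast
    then have "r \<in> \<ff>" if "r \<in> OF" for r using integral_idealD(4)[OF f(1) that, of 1] by simp
    then show False using f(2) integral_idealD(1)[OF f(1)] by blast
  qed
  have disj: "shift_coset \<ff> \<aa> z \<inter> shift_ideal \<ff> \<aa> z = {}"
  proof (rule ccontr)
    assume "shift_coset \<ff> \<aa> z \<inter> shift_ideal \<ff> \<aa> z \<noteq> {}"
    then obtain x where x: "x \<in> shift_coset \<ff> \<aa> z" "x \<in> shift_ideal \<ff> \<aa> z" by blast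
    obtain u where u: "u \<in> ?I" "x = z * (1 + u)" using x(1) unfolding shift_coset_iff by blast
    obtain v where v: "v \<in> ?I" "x = z * v" using x(2) unfolding shift_ideal_iff by blast
    have uv: "u \<in> ?I" "v \<in> ?I" "z * (1 + u) = z * v" using u v by metis+
    then have "1 + u = v" using z by simp
    then have "1 = v + - u" by (simp add: algebra_simps)
    then show False using not1 ideal_mult_add[OF uv(2) neg[OF uv(1)]] by metis
  qed
  obtain y0 where y0: "y0 \<in> \<aa>" "y0 \<noteq> 0" using integral_idealD(6)[OF a] by blast
  have diff: "\<exists>o'\<in>OF. x - y = (z / y0) * o'" if xy: "x \<in> shift_coset \<ff> \<aa> z" "y \<in> shift_coset \<ff> \<aa> z" for x y
  proof -
    obtain u v where uv: "u \<in> ?I" "v \<in> ?I" "x = z * (1 + u)" "y = z * (1 + v)"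
      using xy unfolding shift_coset_iff by blast
    have "y0 * u \<in> OF" "y0 * v \<in> OF"
      using ideal_mult_inv_annihilates[OF f(1) _ y0(1)] uv integral_idealD(1)[OF f(1)] by blast+
    then have "y0 * u - y0 * v \<in> OF" by (rule OF_diff)
    moreover have "x - y = (z / y0) * (y0 * u - y0 * v)" using y0(2) by (simp add: uv field_simps)
    ultimately show ?thesis by blast
  qed
  obtain y where y: "y \<in> \<ff>" "y \<noteq> 0" using integral_idealD(6)[OF f(1)] by blast
  have mult: "\<exists>N::nat. N > 0 \<and> of_nat N * x \<in> shift_ideal \<ff> \<aa> z" for x
  proof -
    obtain N :: nat where N: "N > 0" "of_nat N * (x / (z * y)) \<in> OF" using exists_integral_multiple by blast
    have "(of_nat N * (x / (z * y))) * y \<in> ?I"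
      by (rule ideal_mult_inv_OF[OF N(2) ideal_mult_inv_contains[OF a y(1)]])
    moreover have "of_nat N * x = z * ((of_nat N * (x / (z * y))) * y)" using y(2) z by simp
    ultimately show ?thesis unfolding shift_ideal_iff using N(1) by blast
  qed
  show ?thesis unfolding lattice_coset_def
    using z0 add minus coset disj diff mult y0(2) z by (intro conjI ballI allI exI[of _ "z / y0"]) simp_all
qed

text \<open>Write u (1 + v) = 1 + ((u - 1) + u v); the difference u - 1 lies in \<ff>, which is
  contained in the product of \<ff> and the inverse of the integral ideal \<aa>.\<close>

lemma shift_coset_unit:
  assumes f: "integral_ideal \<ff>" and a: "integral_ideal \<aa>" and u: "u \<in> ray_units emb \<ff>"
    and x: "x \<in> shift_coset \<ff> \<aa> z"
  shows "u * x \<in> shift_coset \<ff> \<aa> z"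
proof -
  obtain v where v: "v \<in> ideal_mult (ideal_inv \<aa>) \<ff>" "x = z * (1 + v)" using x unfolding shift_coset_iff by blast
  have "(u - 1) + u * v \<in> ideal_mult (ideal_inv \<aa>) \<ff>"
    by (rule ideal_mult_add[OF ideal_mult_inv_contains[OF a] ideal_mult_inv_OF[OF _ v(1)]])
      (use ray_unitsD[OF u] in auto)
  moreover have "u * x = z * (1 + ((u - 1) + u * v))" by (simp add: v(2) algebra_simps)
  ultimately show ?thesis unfolding shift_coset_iff by blast
qed

text \<open>\<rho> is the quotient of the two multipliers x' and x. B = \<beta>' \<alpha> clears its
  denominators, since B \<rho> = \<alpha>' \<beta>, and it is invertible modulo \<ff> because both
  factors are; so \<rho> = 1 modulo \<ff> is expressed through integers.\<close>

lemma ray_class_quotient: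
  assumes f: "integral_ideal \<ff>" and C: "\<CC> \<in> carrier (narrow_ray_class_group emb \<ff>)" "\<aa> \<in> \<CC>" "\<aa>' \<in> \<CC>"
  shows "\<exists>\<rho> B. totally_positive emb \<rho> \<and> \<aa>' = (\<lambda>y. \<rho> * y) ` \<aa> \<and> B \<in> OF \<and> B * (1 - \<rho>) \<in> \<ff> \<and> (\<exists>r\<in>OF. 1 - r * B \<in> \<ff>)"
proof -
  obtain g where g: "\<forall>\<aa>\<in>\<CC>. \<exists>x. totally_positive emb x \<and> mult_cong_one \<ff> x \<and> \<aa> = (\<lambda>y. x * y) ` ideal_mult OF g"
    using ray_class_representatives[OF C(1)] by (elim exE conjE)
  obtain x where x: "totally_positive emb x" "mult_cong_one \<ff> x" "\<aa> = (\<lambda>y. x * y) ` ideal_mult OF g" using bspec[OF g C(2)] by (elim exE conjE)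
  obtain x' where x': "totally_positive emb x'" "mult_cong_one \<ff> x'" "\<aa>' = (\<lambda>y. x' * y) ` ideal_mult OF g" using bspec[OF g C(3)] by (elim exE conjE)
  obtain \<alpha> \<beta> where ab: "\<alpha> \<in> OF" "\<beta> \<in> OF" "\<beta> \<noteq> 0" "x = \<alpha> / \<beta>" "\<alpha> - \<beta> \<in> \<ff>" "coprime_ideals (PIdl\<^bsub>ring_of_integers\<^esub> \<alpha>) \<ff>"
    using x(2) unfolding mult_cong_one_def by blast
  obtain \<alpha>' \<beta>' where ab': "\<alpha>' \<in> OF" "\<beta>' \<in> OF" "\<beta>' \<noteq> 0" "x' = \<alpha>' / \<beta>'" "\<alpha>' - \<beta>' \<in> \<ff>" "coprime_ideals (PIdl\<^bsub>ring_of_integers\<^esub> \<beta>') \<ff>"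
    using x'(2) unfolding mult_cong_one_def by blast
  have nz: "x \<noteq> 0" "\<alpha> \<noteq> 0" using x(2) ab(4) by (auto simp: mult_cong_one_def)
  define \<rho> where "\<rho> = x' / x"
  define B where "B = \<beta>' * \<alpha>"
  have "totally_positive emb \<rho>" unfolding \<rho>_def by (rule totally_positive_simps(3)[OF x'(1) x(1)])
  moreover have "\<aa>' = (\<lambda>y. \<rho> * y) ` \<aa>"
    unfolding x(3) x'(3) image_image \<rho>_def using nz by simp
  moreover have "B \<in> OF" unfolding B_def using ab ab' by blast
  moreover have "B * (1 - \<rho>) \<in> \<ff>"
  proof -
    have "B * (1 - \<rho>) = \<alpha> * (- (\<alpha>' - \<beta>')) + \<alpha>' * (\<alpha> - \<beta>)"
      unfolding B_def \<rho>_def ab(4) ab'(4) using nz ab(3) ab'(3) by (simp add: field_simps)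
    moreover have "\<alpha> * (- (\<alpha>' - \<beta>')) + \<alpha>' * (\<alpha> - \<beta>) \<in> \<ff>"
      by (intro integral_idealD(3,4,5)[OF f] ab ab')
    ultimately show ?thesis by metis
  qed
  moreover have "\<exists>r\<in>OF. 1 - r * B \<in> \<ff>"
  proof -
    obtain r where r: "r \<in> OF" "1 - r * \<alpha> \<in> \<ff>" using coprime_principalD[OF ab(6)] by blast
    obtain r' where r': "r' \<in> OF" "1 - r' * \<beta>' \<in> \<ff>" using coprime_principalD[OF ab'(6)] by blast
    have "1 - (r * r') * B = (1 - r * \<alpha>) + (r * \<alpha>) * (1 - r' * \<beta>')" unfolding B_def by (simp add: algebra_simps)
    moreover have "(1 - r * \<alpha>) + (r * \<alpha>) * (1 - r' * \<beta>') \<in> \<ff>"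
      by (intro integral_idealD(3)[OF f] integral_idealD(4)[OF f] r r' OF_mult ab)
    ultimately have "1 - (r * r') * B \<in> \<ff>" by (simp only:)
    then show ?thesis by (intro bexI[OF _ OF_mult[OF r(1) r'(1)]])
  qed
  ultimately show ?thesis by blast
qed

text \<open>\<open>\<rho> - 1\<close> lies in \<open>\<aa>\<^sup>-\<^sup>1 \<ff>\<close> because \<open>\<aa>\<close> is prime to \<open>\<ff>\<close>.\<close>
lemma shift_coset_change:
  assumes f: "integral_ideal \<ff>" and a: "integral_ideal \<aa>" "integral_ideal \<aa>'"
    and C: "\<CC> \<in> carrier (narrow_ray_class_group emb \<ff>)" "\<aa> \<in> \<CC>" "\<aa>' \<in> \<CC>"
    and z: "totally_positive emb z" "totally_positive emb z'"
  shows "\<exists>y. totally_positive emb y \<and> shift_coset \<ff> \<aa>' z' = (\<lambda>x. y * x) ` shift_coset \<ff> \<aa> z"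
proof -
  obtain \<rho> B where \<rho>: "totally_positive emb \<rho>" "\<aa>' = (\<lambda>y. \<rho> * y) ` \<aa>" "B \<in> OF" "B * (1 - \<rho>) \<in> \<ff>" "\<exists>r\<in>OF. 1 - r * B \<in> \<ff>"
    using ray_class_quotient[OF f C] by blast
  let ?I = "ideal_mult (ideal_inv \<aa>) \<ff>"
  have nz: "\<rho> \<noteq> 0" "z \<noteq> 0" using \<rho>(1) z(1) by (auto simp: totally_positive_def)
  obtain r where r: "r \<in> OF" "1 - r * B \<in> \<ff>" using \<rho>(5) by blast
  \<comment> \<open>Split 1 = r B + (1 - r B): B (1 - \<rho>) lies in \<ff>, and so does 1 - r B,
    while v and (1 - \<rho>) v are integers.\<close>
  have kill: "(1 - \<rho>) * v \<in> \<ff>" if v: "v \<in> \<aa>" for v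
  proof -
    have vO: "v \<in> OF" using v integral_idealD(1)[OF a(1)] by blast
    have "\<rho> * v \<in> OF" using v integral_idealD(1)[OF a(2)] unfolding \<rho>(2) by blast
    then have w: "(1 - \<rho>) * v \<in> OF" using OF_diff[OF vO] by (simp add: ring_distribs)
    have "(1 - \<rho>) * v = (r * v) * (B * (1 - \<rho>)) + ((1 - \<rho>) * v) * (1 - r * B)" by (simp add: algebra_simps)
    moreover have "(r * v) * (B * (1 - \<rho>)) + ((1 - \<rho>) * v) * (1 - r * B) \<in> \<ff>"
      by (intro integral_idealD(3)[OF f] integral_idealD(4)[OF f] OF_mult r vO w \<rho>(4))
    ultimately show ?thesis by metis
  qed
  \<comment> \<open>Split once more with c in \<aa> and 1 - c in \<ff>: (1 - \<rho>) c lies in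
    \<ff>, and (1 - \<rho>) (1 - c) is a product of an element of the inverse ideal with one of
    \<ff>.\<close>
  have \<rho>I: "1 - \<rho> \<in> ?I"
  proof -
    obtain c where c: "c \<in> \<aa>" "1 - c \<in> \<ff>" using ray_class_coprime[OF f a(1) C(1,2)] by blast
    have "1 - \<rho> \<in> ideal_inv \<aa>" using kill integral_idealD(1)[OF f] by (auto simp: ideal_inv_def)
    then have "(1 - \<rho>) * c + (1 - \<rho>) * (1 - c) \<in> ?I"
      by (intro ideal_mult_add ideal_mult_inv_contains[OF a(1) kill[OF c(1)]] ideal_mult_mem c)
    then show ?thesis by (simp add: ring_distribs)
  qed
  have inv: "x \<in> ideal_inv \<aa>' \<longleftrightarrow> \<rho> * x \<in> ideal_inv \<aa>" for x
    unfolding \<rho>(2) by (auto simp: ideal_inv_def mult_ac)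
  have I': "u \<in> ideal_mult (ideal_inv \<aa>') \<ff> \<longleftrightarrow> \<rho> * u \<in> ?I" for u
  proof
    show "\<rho> * u \<in> ?I" if "u \<in> ideal_mult (ideal_inv \<aa>') \<ff>"
      by (rule ideal_mult_scale_left[OF that]) (simp add: inv)
    show "u \<in> ideal_mult (ideal_inv \<aa>') \<ff>" if "\<rho> * u \<in> ?I"
    proof -
      have "inverse \<rho> * (\<rho> * u) \<in> ideal_mult (ideal_inv \<aa>') \<ff>"
        by (rule ideal_mult_scale_left[OF that]) (use nz in \<open>simp add: inv mult.assoc[symmetric]\<close>)
      then show ?thesis using nz by (simp add: mult.assoc[symmetric])
    qed
  qed
  \<comment> \<open>With I the product for \<aa>, the one for \<aa>' is I / \<rho>, so z' (1 + I /
    \<rho>) = (z' / \<rho>) (\<rho> + I), and \<rho> + I = 1 + I by the preceding step.\<close>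
  define y where "y = z' / (\<rho> * z)"
  have "totally_positive emb y" unfolding y_def using \<rho>(1) z by (intro totally_positive_simps)
  moreover have "shift_coset \<ff> \<aa>' z' = (\<lambda>x. y * x) ` shift_coset \<ff> \<aa> z"
  proof (rule equalityI; rule subsetI)
    fix x assume "x \<in> shift_coset \<ff> \<aa>' z'"
    then obtain u where "u \<in> ideal_mult (ideal_inv \<aa>') \<ff>" "x = z' * (1 + u)" unfolding shift_coset_iff by blast
    then have u: "\<rho> * u \<in> ?I" "x = z' * (1 + u)" by (simp_all add: I')
    have "\<rho> * u + - 1 * (1 - \<rho>) \<in> ?I"
      by (intro ideal_mult_add u ideal_mult_inv_OF OF_minus OF_1 \<rho>I)
    then have "z * (1 + (\<rho> * u + - 1 * (1 - \<rho>))) \<in> shift_coset \<ff> \<aa> z" unfolding shift_coset_iff by blast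
    moreover have "x = y * (z * (1 + (\<rho> * u + - 1 * (1 - \<rho>))))"
      unfolding u(2) y_def using nz by (simp add: field_simps)
    ultimately show "x \<in> (\<lambda>x. y * x) ` shift_coset \<ff> \<aa> z" by blast
  next
    fix x assume "x \<in> (\<lambda>x. y * x) ` shift_coset \<ff> \<aa> z"
    then obtain w where w: "w \<in> shift_coset \<ff> \<aa> z" "x = y * w" by blast
    obtain u where u': "u \<in> ?I" "w = z * (1 + u)" using w(1) unfolding shift_coset_iff by blast
    have u: "u \<in> ?I" "x = y * (z * (1 + u))" using u' w(2) by simp_all
    have "(1 - \<rho>) + u \<in> ?I" by (intro ideal_mult_add u \<rho>I)
    then have "inverse \<rho> * ((1 - \<rho>) + u) \<in> ideal_mult (ideal_inv \<aa>') \<ff>"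
      unfolding I' using nz by (simp add: mult.assoc[symmetric])
    moreover have "x = z' * (1 + inverse \<rho> * ((1 - \<rho>) + u))"
      unfolding u(2) y_def using nz by (simp add: field_simps)
    ultimately show "x \<in> shift_coset \<ff> \<aa>' z'" unfolding shift_coset_iff by blast
  qed
  ultimately show ?thesis by blast
qed

section \<open>Comparison of two decompositions\<close>

text \<open>In coordinates with respect to a rational basis containing W, the cone is given by
  positivity of the coordinates in W and vanishing of the others. The set is cut by these conditions
  one at a time, each pulled back along multiplication by y.\<close>

lemma conic_Int_qcone:
  assumes A: "conic (totally_positive emb) A" and W: "finite W" "Q.independent W"
  shows "conic (totally_positive emb) (A \<inter> {x. y * x \<in> qcone W})"
proof -
  obtain B where B: "W \<subseteq> B" "finite B" "Q.independent B" "Q.span B = UNIV"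
    using rat_basis_extend[OF W(2)] by metis
  define co where "co = (\<lambda>b x. Q.representation B x b)"
  have co_add: "co b (u + v) = co b u + co b v" for b u v
    unfolding co_def using Q.representation_add[OF B(3), of v u] B(4) by simp
  have co_scale: "co b (of_rat q * u) = q * co b u" for b u q
    unfolding co_def using Q.representation_scale[OF B(3), of u q] B(4) by (simp add: rat_scale_def)
  have co_scale': "co b (y * (of_rat q * u)) = q * co b (y * u)" for b u q
    using co_scale[of b q "y * u"] by (simp only: mult.left_commute)
  have lf: "rat_functional (\<lambda>x. co b (y * x))" for b
    unfolding rat_functional_def by (simp add: co_add co_scale' distrib_left)
  define S where "S = (\<lambda>b. if b \<in> W then {x. co b (y * x) > 0} else {x. co b (y * x) = 0})"
  have fin: "conic (totally_positive emb) (A \<inter> (\<Inter>b\<in>B'. S b))" if "finite B'" for B'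
    using that
  proof induction
    case empty
    then show ?case using A by simp
  next
    case (insert b B')
    have "A \<inter> (\<Inter>b\<in>insert b B'. S b) = (A \<inter> (\<Inter>b\<in>B'. S b)) \<inter> S b" by blast
    moreover have "conic (totally_positive emb) ((A \<inter> (\<Inter>b\<in>B'. S b)) \<inter> S b)"
      by (rule conic_cut[OF totally_positive_combination lf insert.IH]) (auto simp: S_def)
    ultimately show ?case by simp
  qed
  have "y * x \<in> qcone W \<longleftrightarrow> x \<in> (\<Inter>b\<in>B. S b)" for x
  proof
    assume "y * x \<in> qcone W"
    then obtain q where q: "\<forall>w\<in>W. 0 < q w" "y * x = (\<Sum>w\<in>W. of_rat (q w) * w)" by (auto simp: qcone_def)
    have "Q.representation B (y * x) = (\<lambda>b. if b \<in> W then q b else 0)"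
    proof (rule Q.representation_eqI[OF B(3)])
      show "finite {b. (if b \<in> W then q b else 0) \<noteq> 0}" by (rule finite_subset[OF _ W(1)]) auto
      have "(\<Sum>b | (if b \<in> W then q b else 0) \<noteq> 0. rat_scale (if b \<in> W then q b else 0) b) = (\<Sum>b\<in>W. rat_scale (if b \<in> W then q b else 0) b)"
        by (rule sum.mono_neutral_left) (use W(1) in auto)
      also have "\<dots> = y * x" unfolding q(2) by (rule sum.cong) (auto simp: rat_scale_def)
      finally show "(\<Sum>b | (if b \<in> W then q b else 0) \<noteq> 0. rat_scale (if b \<in> W then q b else 0) b) = y * x" .
    qed (use B in \<open>auto split: if_splits\<close>)
    then show "x \<in> (\<Inter>b\<in>B. S b)" using q(1) by (auto simp: S_def co_def)
  next
    assume x: "x \<in> (\<Inter>b\<in>B. S b)"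
    have "y * x = (\<Sum>b\<in>B. of_rat (co b (y * x)) * b)"
      using Q.sum_representation_eq[OF B(3) _ B(2), of "y * x"] B(4) by (simp add: co_def rat_scale_def)
    also have "\<dots> = (\<Sum>b\<in>W. of_rat (co b (y * x)) * b)"
    proof (rule sum.mono_neutral_right)
      show "\<forall>b\<in>B - W. of_rat (co b (y * x)) * b = 0"
      proof
        fix b assume "b \<in> B - W"
        then have "co b (y * x) = 0" using x by (auto simp: S_def split: if_splits)
        then show "of_rat (co b (y * x)) * b = 0" by simp
      qed
    qed (use B in auto)
    finally have e: "y * x = (\<Sum>b\<in>W. of_rat (co b (y * x)) * b)" .
    have p: "co b (y * x) > 0" if "b \<in> W" for b
    proof -
      have "x \<in> S b" using x that B(1) by blast
      then show ?thesis using that by (simp add: S_def)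
    qed
    show "y * x \<in> qcone W"
      unfolding qcone_def by (intro CollectI exI[of _ "\<lambda>b. co b (y * x)"] conjI ballI e p)
  qed
  then have "A \<inter> {x. y * x \<in> qcone W} = A \<inter> (\<Inter>b\<in>B. S b)" by blast
  then show ?thesis using fin[OF B(2)] by simp
qed

text \<open>A negative coordinate of a generator would dominate in points where that generator has a
  large coefficient. A zero coordinate is impossible because an embedding vanishes only at
  0.\<close>

lemma cone_generators_positive:
  assumes W: "finite W" "independent (emb_vec emb ` W)" and sub: "open_cone (emb_vec emb ` W) \<subseteq> positive_orthant"
  shows "W \<noteq> {}" "\<And>w. w \<in> W \<Longrightarrow> totally_positive emb w"
proof -
  have pos: "emb j x > 0" if "x \<in> qcone W" for x j
    using sub emb_open_cone_iff[OF W, of x] that by (auto simp: positive_orthant_def)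
  show "W \<noteq> {}"
  proof
    assume "W = {}"
    then have "0 \<in> qcone W" by (simp add: qcone_def)
    then show False using pos[of 0 undefined] by simp
  qed
  fix w assume w: "w \<in> W"
  have "emb j w > 0" for j
  proof (rule ccontr)
    assume n: "\<not> emb j w > 0"
    have "emb_vec emb w \<noteq> 0" using W(2) w dependent_zero by (metis image_eqI)
    then have neg: "emb j w < 0" using n by (auto simp: not_less order_le_less)
    define S where "S = (\<Sum>v\<in>W - {w}. emb j v)"
    \<comment> \<open>Chosen so that the weight N on w already outweighs the total contribution S of
      the other generators to the j-th coordinate.\<close>
    obtain N :: nat where N: "S / (- emb j w) < of_nat N" using reals_Archimedean2 by blast
    define q where "q = (\<lambda>v. if v = w then of_nat (Suc N) else 1 :: rat)"
    have "(\<Sum>v\<in>W. of_rat (q v) * v) \<in> qcone W" unfolding qcone_def by (intro CollectI exI[of _ q]) (auto simp: q_def)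
    then have "0 < emb j (\<Sum>v\<in>W. of_rat (q v) * v)" by (rule pos)
    also have "emb j (\<Sum>v\<in>W. of_rat (q v) * v) = (\<Sum>v\<in>W. of_rat (q v) * emb j v)" by simp
    also have "\<dots> = of_rat (q w) * emb j w + (\<Sum>v\<in>W - {w}. of_rat (q v) * emb j v)"
      by (rule sum.remove[OF W(1) w])
    also have "(\<Sum>v\<in>W - {w}. of_rat (q v) * emb j v) = S" unfolding S_def by (rule sum.cong) (auto simp: q_def)
    also have "of_rat (q w) = real (Suc N)" by (simp add: q_def of_rat_add)
    finally have "0 < real (Suc N) * emb j w + S" .
    moreover have "S < real N * (- emb j w)" using N neg by (simp only: divide_less_eq)
    moreover have "real (Suc N) * emb j w = real N * emb j w + emb j w" by (simp add: ring_distribs)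
    ultimately show False using neg by linarith
  qed
  then show "totally_positive emb w" by (simp add: totally_positive_def)
qed

lemma emb_translate_cone_iff:
  assumes W: "finite W" "independent (emb_vec emb ` W)" and u: "u \<noteq> 0"
  shows "emb_vec emb x \<in> translate_cone emb u (open_cone (emb_vec emb ` W)) \<longleftrightarrow> inverse u * x \<in> qcone W"
proof -
  have "emb_vec emb x = emb_vec emb u * v \<longleftrightarrow> v = emb_vec emb (inverse u * x)" for v
    using u by (auto simp: vec_eq_iff field_simps)
  then show ?thesis unfolding translate_cone_def image_iff emb_open_cone_iff[OF W, symmetric] by auto
qed

lemma shintani_cover:
  assumes \<Phi>: "shintani_decomposition emb \<ff> \<Phi>"
    and W: "\<And>\<sigma>. \<sigma> \<in> \<Phi> \<Longrightarrow> finite (W \<sigma>) \<and> independent (emb_vec emb ` W \<sigma>) \<and> open_cone (emb_vec emb ` W \<sigma>) = \<sigma>"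
    and x: "totally_positive emb x"
  shows "\<exists>u\<in>ray_units emb \<ff>. \<exists>\<sigma>\<in>\<Phi>. inverse u * x \<in> qcone (W \<sigma>)"
proof -
  have "emb_vec emb x \<in> positive_orthant" using x by (simp add: positive_orthant_def totally_positive_def)
  then obtain u \<sigma> where u: "u \<in> ray_units emb \<ff>" "\<sigma> \<in> \<Phi>" "emb_vec emb x \<in> translate_cone emb u \<sigma>"
    using \<Phi> unfolding shintani_decomposition_def by blast
  have "emb_vec emb x \<in> translate_cone emb u (open_cone (emb_vec emb ` W \<sigma>))" using u(3) W[OF u(2)] by simp
  then have "inverse u * x \<in> qcone (W \<sigma>)"
    using emb_translate_cone_iff[of "W \<sigma>" u x] W[OF u(2)] ray_unitsD(5)[OF u(1)] by simp
  then show ?thesis using u by blast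
qed

lemma shintani_unique:
  assumes \<Phi>: "shintani_decomposition emb \<ff> \<Phi>"
    and W: "\<And>\<sigma>. \<sigma> \<in> \<Phi> \<Longrightarrow> finite (W \<sigma>) \<and> independent (emb_vec emb ` W \<sigma>) \<and> open_cone (emb_vec emb ` W \<sigma>) = \<sigma>"
    and 1: "u \<in> ray_units emb \<ff>" "\<sigma> \<in> \<Phi>" "inverse u * x \<in> qcone (W \<sigma>)"
    and 2: "v \<in> ray_units emb \<ff>" "\<tau> \<in> \<Phi>" "inverse v * x \<in> qcone (W \<tau>)"
  shows "u = v \<and> \<sigma> = \<tau>"
proof (rule ccontr)
  assume ne: "\<not> (u = v \<and> \<sigma> = \<tau>)"
  have "emb_vec emb x \<in> translate_cone emb u \<sigma>"
    using emb_translate_cone_iff[of "W \<sigma>" u x] W[OF 1(2)] ray_unitsD(5)[OF 1(1)] 1(3) by simp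
  moreover have "emb_vec emb x \<in> translate_cone emb v \<tau>"
    using emb_translate_cone_iff[of "W \<tau>" v x] W[OF 2(2)] ray_unitsD(5)[OF 2(1)] 2(3) by simp
  moreover have "disjoint_family_on (\<lambda>(\<epsilon>, \<sigma>). translate_cone emb \<epsilon> \<sigma>) (ray_units emb \<ff> \<times> \<Phi>)"
    using \<Phi> by (simp add: shintani_decomposition_def)
  from disjoint_family_onD[OF this, of "(u, \<sigma>)" "(v, \<tau>)"] ne 1 2
  have "translate_cone emb u \<sigma> \<inter> translate_cone emb v \<tau> = {}" by auto
  ultimately show False by blast
qed

text \<open>Both sums are evaluated on the common refinement by the sets
  \<open>L \<inter> \<sigma> \<inter> (y \<epsilon>)\<^sup>-\<^sup>1 \<sigma>'\<close>, of which only finitely many are nonempty.\<close>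
lemma sum_values_eq:
  assumes f: "integral_ideal \<ff>" and L: "lattice_coset L b"
    and stable: "\<And>u x. u \<in> ray_units emb \<ff> \<Longrightarrow> x \<in> L \<Longrightarrow> u * x \<in> L"
    and y: "totally_positive emb y"
    and \<Phi>: "shintani_decomposition emb \<ff> \<Phi>" "shintani_decomposition emb \<ff> \<Phi>'"
    and W: "\<And>\<sigma>. \<sigma> \<in> \<Phi> \<Longrightarrow> finite (W \<sigma>) \<and> independent (emb_vec emb ` W \<sigma>) \<and> open_cone (emb_vec emb ` W \<sigma>) = \<sigma>"
    and W': "\<And>\<sigma>. \<sigma> \<in> \<Phi>' \<Longrightarrow> finite (W' \<sigma>) \<and> independent (emb_vec emb ` W' \<sigma>) \<and> open_cone (emb_vec emb ` W' \<sigma>) = \<sigma>"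
    and v: "\<And>\<sigma>. \<sigma> \<in> \<Phi> \<Longrightarrow> has_value i (L \<inter> qcone (W \<sigma>)) (v \<sigma>)"
    and v': "\<And>\<sigma>. \<sigma> \<in> \<Phi>' \<Longrightarrow> has_value i ((\<lambda>x. y * x) ` L \<inter> qcone (W' \<sigma>)) (v' \<sigma>)"
  shows "(\<Sum>\<sigma>\<in>\<Phi>. v \<sigma>) = (\<Sum>\<sigma>\<in>\<Phi>'. v' \<sigma>)"
proof -
  let ?E = "ray_units emb \<ff>"
  have fin: "finite \<Phi>" "finite \<Phi>'" using \<Phi> by (auto simp: shintani_decomposition_def)
  have y0: "y \<noteq> 0" and ypos: "emb j y > 0" for j using y by (auto simp: totally_positive_def)
  have orth: "open_cone (emb_vec emb ` W \<sigma>) \<subseteq> positive_orthant" if "\<sigma> \<in> \<Phi>" for \<sigma>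
    using \<Phi>(1) W[OF that] that by (auto simp: shintani_decomposition_def)
  have orth': "open_cone (emb_vec emb ` W' \<sigma>) \<subseteq> positive_orthant" if "\<sigma> \<in> \<Phi>'" for \<sigma>
    using \<Phi>(2) W'[OF that] that by (auto simp: shintani_decomposition_def)
  have pos: "totally_positive emb w" if "\<sigma> \<in> \<Phi>" "w \<in> W \<sigma>" for \<sigma> w
    using cone_generators_positive(2)[OF _ _ orth[OF that(1)] that(2)] W[OF that(1)] by blast
  have pos': "totally_positive emb w" if "\<sigma> \<in> \<Phi>'" "w \<in> W' \<sigma>" for \<sigma> w
    using cone_generators_positive(2)[OF _ _ orth'[OF that(1)] that(2)] W'[OF that(1)] by blast
  have posx: "totally_positive emb x" if "\<sigma> \<in> \<Phi>" "x \<in> qcone (W \<sigma>)" for \<sigma> x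
    using orth[OF that(1)] emb_open_cone_iff[of "W \<sigma>" x] W[OF that(1)] that(2)
    by (auto simp: positive_orthant_def totally_positive_def)
  have posx': "totally_positive emb x" if "\<sigma> \<in> \<Phi>'" "x \<in> qcone (W' \<sigma>)" for \<sigma> x
    using orth'[OF that(1)] emb_open_cone_iff[of "W' \<sigma>" x] W'[OF that(1)] that(2)
    by (auto simp: positive_orthant_def totally_positive_def)
  \<comment> \<open>The same index set sorts both sides: a piece lies in the first cone, and its
    multiple by y u lies in the second cone and in y L, because L is stable under units.\<close>
  define piece where "piece = (\<lambda>(\<sigma>, \<sigma>', u). {x \<in> L. x \<in> qcone (W \<sigma>) \<and> (y * u) * x \<in> qcone (W' \<sigma>')})"
  define T where "T = {p \<in> \<Phi> \<times> \<Phi>' \<times> ?E. piece p \<noteq> {}}"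
  have finT: "finite T"
  proof -
    define E' where "E' = (\<lambda>\<sigma> \<sigma>'. {u \<in> ?E. \<exists>x\<in>qcone (W \<sigma>). (y * u) * x \<in> qcone (W' \<sigma>')})"
    have "finite (E' \<sigma> \<sigma>')" if s: "\<sigma> \<in> \<Phi>" "\<sigma>' \<in> \<Phi>'" for \<sigma> \<sigma>'
    proof -
      obtain C where C: "C > 0" "\<forall>x\<in>qcone (W \<sigma>). \<forall>i j. emb i x \<le> C * emb j x"
        using qcone_ratio_bounded[of "W \<sigma>"] W[OF s(1)] pos[OF s(1)] by blast
      obtain C' where C': "C' > 0" "\<forall>x\<in>qcone (W' \<sigma>'). \<forall>i j. emb i x \<le> C' * emb j x"
        using qcone_ratio_bounded[of "W' \<sigma>'"] W'[OF s(2)] pos'[OF s(2)] by blast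
      \<comment> \<open>Bounds the change of coordinate caused by y. Comparing coordinates i and j
        of y u x and of x then bounds the ratio of the embeddings of u by C' C M.\<close>
      define M where "M = Max (range (\<lambda>(i, j). emb j y / emb i y))"
      have M: "emb j y \<le> M * emb i y" for i j
      proof -
        have "emb j y / emb i y \<le> M" unfolding M_def by (rule Max_ge) (auto intro: image_eqI[of _ _ "(i, j)"])
        then show ?thesis using ypos[of i] by (simp add: divide_le_eq)
      qed
      show ?thesis
      proof (rule finite_units_bounded_ratio[of _ "C' * C * M"])
        fix u assume "u \<in> E' \<sigma> \<sigma>'"
        then show "u \<in> OF \<and> inverse u \<in> OF \<and> totally_positive emb u" using ray_unitsD[of u \<ff>] by (auto simp: E'_def)
      next
        fix u i j assume "u \<in> E' \<sigma> \<sigma>'"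
        then obtain x where x: "u \<in> ?E" "x \<in> qcone (W \<sigma>)" "(y * u) * x \<in> qcone (W' \<sigma>')" by (auto simp: E'_def)
        have xp: "emb k x > 0" and up: "emb k u > 0" for k
          using posx[OF s(1) x(2)] ray_unitsD(3)[OF x(1)] by (auto simp: totally_positive_def)
        have "emb i y * emb i u * emb i x \<le> C' * (emb j y * emb j u * emb j x)"
          using C'(2) x(3) by (force simp: mult.assoc)
        also have "\<dots> \<le> C' * ((M * emb i y) * emb j u * (C * emb i x))"
          using C'(1) M[of j i] C xp x(2) up ypos
          by (intro mult_left_mono mult_mono) (auto intro!: mult_nonneg_nonneg order_trans[OF less_imp_le[OF ypos] M] simp: less_imp_le)
        finally have "(emb i y * emb i x) * emb i u \<le> (emb i y * emb i x) * (C' * C * M * emb j u)" by (simp add: mult_ac)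
        then show "emb i u \<le> C' * C * M * emb j u" using xp[of i] ypos[of i] by (simp add: mult_le_cancel_left_pos)
      qed
    qed
    then have "finite (SIGMA \<sigma>:\<Phi>. SIGMA \<sigma>':\<Phi>'. E' \<sigma> \<sigma>')" using fin by (intro finite_SigmaI) auto
    moreover have "T \<subseteq> (SIGMA \<sigma>:\<Phi>. SIGMA \<sigma>':\<Phi>'. E' \<sigma> \<sigma>')" by (auto simp: T_def piece_def E'_def)
    ultimately show ?thesis using finite_subset by blast
  qed
  have "\<exists>c. has_value i (piece p) c" if p: "p \<in> T" for p
  proof -
    obtain \<sigma> \<sigma>' u where s: "p = (\<sigma>, \<sigma>', u)" "\<sigma> \<in> \<Phi>" "\<sigma>' \<in> \<Phi>'" using p by (auto simp: T_def)
    have i1: "Q.independent (W \<sigma>)" "Q.independent (W' \<sigma>')"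
      using rat_independent_if_real_independent W[OF s(2)] W'[OF s(3)] by blast+
    have "conic (totally_positive emb) (qcone (W \<sigma>))"
      using cone_generators_positive(1)[OF _ _ orth[OF s(2)]] W[OF s(2)] pos[OF s(2)] i1 by (intro conic_qcone) auto
    then have "conic (totally_positive emb) (qcone (W \<sigma>) \<inter> {x. (y * u) * x \<in> qcone (W' \<sigma>')})"
      by (rule conic_Int_qcone) (use W'[OF s(3)] i1 in auto)
    from conic_has_value[OF L this] obtain c where
      "has_value i (L \<inter> (qcone (W \<sigma>) \<inter> {x. (y * u) * x \<in> qcone (W' \<sigma>')})) c" by blast
    moreover have "L \<inter> (qcone (W \<sigma>) \<inter> {x. (y * u) * x \<in> qcone (W' \<sigma>')}) = piece p" by (auto simp: piece_def s(1))
    ultimately show ?thesis by auto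
  qed
  then obtain c where c: "\<And>p. p \<in> T \<Longrightarrow> has_value i (piece p) (c p)" by metis
  \<comment> \<open>The unit translates of the second family partition the orthant. Read at y x
    instead of x, this partitions the points of L in a fixed first cone into pieces.\<close>
  have 1: "v \<sigma> = (\<Sum>p | p \<in> T \<and> fst p = \<sigma>. c p)" if \<sigma>: "\<sigma> \<in> \<Phi>" for \<sigma>
  proof (rule has_value_unique[OF v[OF \<sigma>]])
    have "has_value i (\<Union>p\<in>{p \<in> T. fst p = \<sigma>}. piece p) (\<Sum>p | p \<in> T \<and> fst p = \<sigma>. c p)"
    proof (rule has_value_UN)
      fix p r assume pr: "p \<in> {p \<in> T. fst p = \<sigma>}" "r \<in> {p \<in> T. fst p = \<sigma>}" "p \<noteq> r"
      obtain \<tau> u where p: "p = (\<sigma>, \<tau>, u)" "\<tau> \<in> \<Phi>'" "u \<in> ?E" using pr(1) by (cases p) (auto simp: T_def)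
      obtain \<tau>' u' where r: "r = (\<sigma>, \<tau>', u')" "\<tau>' \<in> \<Phi>'" "u' \<in> ?E" using pr(2) by (cases r) (auto simp: T_def)
      show "piece p \<inter> piece r = {}"
      proof (rule ccontr)
        assume "piece p \<inter> piece r \<noteq> {}"
        then obtain x where x: "(y * u) * x \<in> qcone (W' \<tau>)" "(y * u') * x \<in> qcone (W' \<tau>')" by (auto simp: piece_def p r)
        have "inverse (inverse u) * (y * x) \<in> qcone (W' \<tau>)" "inverse (inverse u') * (y * x) \<in> qcone (W' \<tau>')"
          using x by (simp_all add: mult_ac)
        then have "inverse u = inverse u' \<and> \<tau> = \<tau>'"
          using shintani_unique[OF \<Phi>(2) W', of "inverse u" \<tau> "y * x" "inverse u'" \<tau>'] p r ray_units_inverse[OF f] by blast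
        then show False using pr(3) p r by simp
      qed
    qed (use finT c in auto)
    moreover have "(\<Union>p\<in>{p \<in> T. fst p = \<sigma>}. piece p) = L \<inter> qcone (W \<sigma>)"
    proof (intro equalityI subsetI)
      fix x assume x: "x \<in> L \<inter> qcone (W \<sigma>)"
      have "totally_positive emb (y * x)" using posx[OF \<sigma>] x y by (auto intro: totally_positive_simps)
      from shintani_cover[OF \<Phi>(2) W' this] obtain u \<tau> where u: "u \<in> ?E" "\<tau> \<in> \<Phi>'" "inverse u * (y * x) \<in> qcone (W' \<tau>)" by blast
      \<comment> \<open>The cover gives \<open>inverse u * (y * x)\<close> in the second cone,
        whereas a piece is indexed by the unit that multiplies; hence the inverse.\<close>
      have mem: "x \<in> piece (\<sigma>, \<tau>, inverse u)" using x u(3) by (simp add: piece_def mult_ac)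
      moreover have "(\<sigma>, \<tau>, inverse u) \<in> T"
        using mem \<sigma> u ray_units_inverse[OF f u(1)] by (auto simp: T_def)
      ultimately show "x \<in> (\<Union>p\<in>{p \<in> T. fst p = \<sigma>}. piece p)" by force
    qed (auto simp: piece_def)
    ultimately show "has_value i (L \<inter> qcone (W \<sigma>)) (\<Sum>p | p \<in> T \<and> fst p = \<sigma>. c p)" by simp
  qed
  have 2: "v' \<tau> = (\<Sum>p | p \<in> T \<and> fst (snd p) = \<tau>. c p)" if \<tau>: "\<tau> \<in> \<Phi>'" for \<tau>
  proof (rule has_value_unique[OF v'[OF \<tau>]])
    \<comment> \<open>Multiplication by y u is totally positive, so it preserves the value of a
      piece; the images partition the part of y L in a fixed second cone, now by the partition
      property of the first family.\<close>
    define img where "img = (\<lambda>p. (\<lambda>x. (y * snd (snd p)) * x) ` piece p)"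
    have "has_value i (\<Union>p\<in>{p \<in> T. fst (snd p) = \<tau>}. img p) (\<Sum>p | p \<in> T \<and> fst (snd p) = \<tau>. c p)"
    proof (rule has_value_UN)
      fix p assume p: "p \<in> {p \<in> T. fst (snd p) = \<tau>}"
      then have "snd (snd p) \<in> ?E" by (auto simp: T_def)
      then have "emb i (y * snd (snd p)) > 0" using ray_unitsD(3) ypos by (auto simp: totally_positive_def)
      then show "has_value i (img p) (c p)" unfolding img_def using c p by (intro has_value_scale) auto
    next
      fix p r assume pr: "p \<in> {p \<in> T. fst (snd p) = \<tau>}" "r \<in> {p \<in> T. fst (snd p) = \<tau>}" "p \<noteq> r"
      obtain \<sigma> u where p: "p = (\<sigma>, \<tau>, u)" "\<sigma> \<in> \<Phi>" "u \<in> ?E" using pr(1) by (cases p) (auto simp: T_def)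
      obtain \<sigma>' u' where r: "r = (\<sigma>', \<tau>, u')" "\<sigma>' \<in> \<Phi>" "u' \<in> ?E" using pr(2) by (cases r) (auto simp: T_def)
      show "img p \<inter> img r = {}"
      proof (rule ccontr)
        assume "img p \<inter> img r \<noteq> {}"
        then obtain t where t: "t \<in> img p" "t \<in> img r" by blast
        obtain x where x1: "x \<in> qcone (W \<sigma>)" "t = (y * u) * x" using t(1) by (auto simp: img_def piece_def p)
        obtain x' where x2: "x' \<in> qcone (W \<sigma>')" "t = (y * u') * x'" using t(2) by (auto simp: img_def piece_def r)
        have x: "x \<in> qcone (W \<sigma>)" "x' \<in> qcone (W \<sigma>')" "(y * u) * x = (y * u') * x'" using x1 x2 by metis+
        have nz: "u \<noteq> 0" "u' \<noteq> 0" using ray_unitsD(5) p(3) r(3) by blast+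
        have e: "u * x = u' * x'" using x(3) y0 by (simp add: mult.assoc)
        have "inverse u * (u * x) \<in> qcone (W \<sigma>)" using x(1) nz by (simp add: mult.assoc[symmetric])
        moreover have "inverse u' * (u * x) \<in> qcone (W \<sigma>')" unfolding e using x(2) nz by (simp add: mult.assoc[symmetric])
        ultimately have "u = u' \<and> \<sigma> = \<sigma>'"
          using shintani_unique[OF \<Phi>(1) W, of u \<sigma> "u * x" u' \<sigma>'] p r by blast
        then show False using pr(3) p r by simp
      qed
    qed (use finT in auto)
    moreover have "(\<Union>p\<in>{p \<in> T. fst (snd p) = \<tau>}. img p) = (\<lambda>x. y * x) ` L \<inter> qcone (W' \<tau>)"
    proof (intro equalityI subsetI)
      fix x assume "x \<in> (\<Union>p\<in>{p \<in> T. fst (snd p) = \<tau>}. img p)"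
      then obtain \<sigma> u w where w: "u \<in> ?E" "w \<in> L" "(y * u) * w \<in> qcone (W' \<tau>)" "x = (y * u) * w"
        by (auto simp: img_def piece_def T_def)
      have "x = y * (u * w)" by (simp add: w(4) mult.assoc)
      then have "x \<in> (\<lambda>x. y * x) ` L" by (rule image_eqI[OF _ stable[OF w(1,2)]])
      then show "x \<in> (\<lambda>x. y * x) ` L \<inter> qcone (W' \<tau>)" using w(3,4) by simp
    next
      fix x assume "x \<in> (\<lambda>x. y * x) ` L \<inter> qcone (W' \<tau>)"
      then obtain w where w: "w \<in> L" "x = y * w" "x \<in> qcone (W' \<tau>)" by blast
      have "w = inverse y * x" using w(2) y0 by simp
      then have "totally_positive emb w" using posx'[OF \<tau> w(3)] y by (auto intro: totally_positive_simps)
      from shintani_cover[OF \<Phi>(1) W this] obtain u \<sigma> where u: "u \<in> ?E" "\<sigma> \<in> \<Phi>" "inverse u * w \<in> qcone (W \<sigma>)" by blast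
      have nz: "u \<noteq> 0" using ray_unitsD(5)[OF u(1)] .
      have xe: "x = (y * u) * (inverse u * w)" using nz by (simp add: w(2))
      have mem: "inverse u * w \<in> piece (\<sigma>, \<tau>, u)"
        using stable[OF ray_units_inverse[OF f u(1)] w(1)] u(3) w(3) xe by (simp add: piece_def)
      then have "(\<sigma>, \<tau>, u) \<in> T" using \<tau> u by (auto simp: T_def)
      moreover have "x \<in> img (\<sigma>, \<tau>, u)" unfolding img_def using xe mem by force
      ultimately show "x \<in> (\<Union>p\<in>{p \<in> T. fst (snd p) = \<tau>}. img p)" by force
    qed
    ultimately show "has_value i ((\<lambda>x. y * x) ` L \<inter> qcone (W' \<tau>)) (\<Sum>p | p \<in> T \<and> fst (snd p) = \<tau>. c p)" by simp
  qed
  have "(\<Sum>\<sigma>\<in>\<Phi>. v \<sigma>) = (\<Sum>\<sigma>\<in>\<Phi>. \<Sum>p | p \<in> T \<and> fst p = \<sigma>. c p)" by (rule sum.cong) (auto simp: 1)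
  also have "\<dots> = (\<Sum>p\<in>T. c p)" by (rule sum.group[OF finT fin(1)]) (auto simp: T_def)
  also have "\<dots> = (\<Sum>\<tau>\<in>\<Phi>'. \<Sum>p | p \<in> T \<and> fst (snd p) = \<tau>. c p)" by (rule sum.group[OF finT fin(2), symmetric]) (auto simp: T_def)
  also have "\<dots> = (\<Sum>\<tau>\<in>\<Phi>'. v' \<tau>)" by (rule sum.cong) (auto simp: 2)
  finally show ?thesis .
qed

section \<open>The invariant as an exponential, and its independence of the choices\<close>

definition cone_value :: "'n \<Rightarrow> 'a set \<Rightarrow> 'a list \<Rightarrow> complex" where
  "cone_value i L gs = (\<Sum>y\<in>L \<inter> qbox (set gs). deriv (barnes_xi (emb i y) (map (emb i) gs)) 0)"

lemma X_invariant_eq_exp: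
  assumes L: "lattice_coset (shift_coset \<ff> \<aa> z) (shift_ideal \<ff> \<aa> z)"
    and \<Phi>: "finite \<Phi>" and gen: "\<And>\<sigma>. \<sigma> \<in> \<Phi> \<Longrightarrow> independent (emb_vec emb ` set (gen \<sigma>))"
  shows "X_invariant emb \<ff> i \<aa> z \<Phi> gen = exp (\<Sum>\<sigma>\<in>\<Phi>. cone_value i (shift_coset \<ff> \<aa> z) (gen \<sigma>))"
proof -
  let ?L = "shift_coset \<ff> \<aa> z"
  have "(\<Prod>y\<in>{y \<in> (\<lambda>b. z + b) ` shift_ideal \<ff> \<aa> z. emb_vec emb y \<in> half_open_parallelepiped (emb_vec emb ` set (gen \<sigma>))}.
      multiple_sine (emb i y) (map (emb i) (gen \<sigma>))) = exp (cone_value i ?L (gen \<sigma>))" if "\<sigma> \<in> \<Phi>" for \<sigma>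
  proof -
    have "{y \<in> (\<lambda>b. z + b) ` shift_ideal \<ff> \<aa> z. emb_vec emb y \<in> half_open_parallelepiped (emb_vec emb ` set (gen \<sigma>))} = ?L \<inter> qbox (set (gen \<sigma>))"
      unfolding emb_parallelepiped_iff[OF finite_set gen[OF that]] shift_coset_def by blast
    then show ?thesis unfolding cone_value_def multiple_sine_def
      using finite_lattice_qbox[OF L finite_set, of "gen \<sigma>"] by (simp add: exp_sum)
  qed
  then show ?thesis unfolding X_invariant_def using \<Phi> by (simp add: exp_sum)
qed

lemma X_invariant_unique:
  assumes f: "integral_ideal \<ff>" "\<ff> \<noteq> OF" and C: "\<CC> \<in> carrier (narrow_ray_class_group emb \<ff>)"
    and adm: "admissible emb \<ff> \<CC> \<aa> z \<Phi> gen" "admissible emb \<ff> \<CC> \<aa>' z' \<Phi>' gen'"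
  shows "X_invariant emb \<ff> i \<aa> z \<Phi> gen = X_invariant emb \<ff> i \<aa>' z' \<Phi>' gen'"
proof -
  have adm_lattice: "lattice_coset (shift_coset \<ff> \<aa> z) (shift_ideal \<ff> \<aa> z)"
    if "admissible emb \<ff> \<CC> \<aa> z \<Phi> gen" for \<aa> z \<Phi> gen
  proof -
    have a: "integral_ideal \<aa>" "\<aa> \<in> \<CC>" "totally_positive emb z" using that by (auto simp: admissible_def)
    then have "z \<noteq> 0" by (auto simp: totally_positive_def)
    then show ?thesis using shift_coset_lattice[OF f a(1) ray_class_coprime[OF f(1) a(1) C a(2)]] by blast
  qed
  have adm_gen: "finite (set (gen \<sigma>)) \<and> independent (emb_vec emb ` set (gen \<sigma>)) \<and> open_cone (emb_vec emb ` set (gen \<sigma>)) = \<sigma>"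
    if "admissible emb \<ff> \<CC> \<aa> z \<Phi> gen" "\<sigma> \<in> \<Phi>" for \<aa> z \<Phi> gen \<sigma>
    using that by (simp add: admissible_def)
  have adm_value: "has_value i (shift_coset \<ff> \<aa> z \<inter> qcone (set (gen \<sigma>))) (cone_value i (shift_coset \<ff> \<aa> z) (gen \<sigma>))"
    if ad: "admissible emb \<ff> \<CC> \<aa> z \<Phi> gen" "\<sigma> \<in> \<Phi>" for \<aa> z \<Phi> gen \<sigma>
  proof -
    have g: "distinct (gen \<sigma>)" "set (gen \<sigma>) \<subseteq> shift_ideal \<ff> \<aa> z" "independent (emb_vec emb ` set (gen \<sigma>))"
      using ad by (auto simp: admissible_def)
    have "\<sigma> \<subseteq> positive_orthant" using ad by (auto simp: admissible_def shintani_decomposition_def)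
    then have sub: "open_cone (emb_vec emb ` set (gen \<sigma>)) \<subseteq> positive_orthant" using adm_gen[OF ad] by simp
    show ?thesis unfolding cone_value_def
      by (rule has_value_cone[OF adm_lattice[OF ad(1)] g(1)])
        (use cone_generators_positive[OF finite_set g(3) sub] rat_independent_if_real_independent[OF finite_set g(3)] g(2) in auto)
  qed
  have X: "X_invariant emb \<ff> i \<aa> z \<Phi> gen = exp (\<Sum>\<sigma>\<in>\<Phi>. cone_value i (shift_coset \<ff> \<aa> z) (gen \<sigma>))"
    if ad: "admissible emb \<ff> \<CC> \<aa> z \<Phi> gen" for \<aa> z \<Phi> gen
    by (rule X_invariant_eq_exp[OF adm_lattice[OF ad]]) (use ad in \<open>auto simp: admissible_def shintani_decomposition_def\<close>)
  have a: "integral_ideal \<aa>" "integral_ideal \<aa>'" "\<aa> \<in> \<CC>" "\<aa>' \<in> \<CC>" "totally_positive emb z" "totally_positive emb z'"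
    "shintani_decomposition emb \<ff> \<Phi>" "shintani_decomposition emb \<ff> \<Phi>'"
    using adm by (auto simp: admissible_def)
  obtain y where y: "totally_positive emb y" "shift_coset \<ff> \<aa>' z' = (\<lambda>x. y * x) ` shift_coset \<ff> \<aa> z"
    using shift_coset_change[OF f(1) a(1,2) C a(3-6)] by blast
  have "(\<Sum>\<sigma>\<in>\<Phi>. cone_value i (shift_coset \<ff> \<aa> z) (gen \<sigma>)) = (\<Sum>\<sigma>\<in>\<Phi>'. cone_value i (shift_coset \<ff> \<aa>' z') (gen' \<sigma>))"
    by (rule sum_values_eq[OF f(1) adm_lattice[OF adm(1)] shift_coset_unit[OF f(1) a(1)] y(1) a(7,8) adm_gen[OF adm(1)] adm_gen[OF adm(2)]
      adm_value[OF adm(1)] adm_value[OF adm(2), unfolded y(2)], folded y(2)])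
  then show ?thesis unfolding X[OF adm(1)] X[OF adm(2)] by (rule arg_cong)
qed

end

theorem theorem4p9:
  fixes emb :: "'n::finite \<Rightarrow> 'a::field_char_0 \<Rightarrow> real"
    and \<ff> :: "'a set" and \<CC> :: "'a set set" and i :: 'n
    and \<aa> \<aa>' :: "'a set" and z z' :: 'a
    and \<Phi> \<Phi>' :: "(real ^ 'n) set set"
    and gen gen' :: "(real ^ 'n) set \<Rightarrow> 'a list"
  assumes "totally_real_number_field TYPE('a) CARD('n)"
    and "real_embeddings emb"
    and "integral_ideal \<ff>" and "\<ff> \<noteq> carrier ring_of_integers"
    and "\<CC> \<in> carrier (narrow_ray_class_group emb \<ff>)"
    and "admissible emb \<ff> \<CC> \<aa> z \<Phi> gen"
    and "admissible emb \<ff> \<CC> \<aa>' z' \<Phi>' gen'"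
  shows "X_invariant emb \<ff> i \<aa> z \<Phi> gen = X_invariant emb \<ff> i \<aa>' z' \<Phi>' gen'"
proof -
  have "ring (ring_of_integers :: 'a ring)"
    using assms(3) by (auto simp: integral_ideal_def ideal_def)
  then interpret totally_real_field emb
    by (rule totally_real_field.intro[OF assms(1,2)])
  show ?thesis by (rule X_invariant_unique[OF assms(3-7)])
qed

end
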